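(* Let either $d=2$ and $q\ge3$ be an odd integer, or $d=3$ and $q\in\{3,5\}$. Let $\{u_h^n\}_{n=0}^N\subset V_h$ be the solution of the fully discrete scheme $$(u_h^{n+1}-u_h^n,v_h)+\tau(\nabla u_h^{n+1},\nabla v_h)=\tau(I_hF^{n+1},v_h)+(G(u_h^n),v_h)\,\Delta W_n+\tfrac12\bigl(DG(u_h^n)G(u_h^n)[(\Delta W_n)^2-\tau],v_h\bigr)\qquad\forall v_h\in V_h,$$ $\mathbb P$-a.s. for $n=0,\dots,N-1$, with $u_h^0=P_hu_0$ and $F^{n+1}=u_h^{n+1}-(u_h^{n+1})^q$. If the triangulation $\mathcal T_h$ satisfies the mesh condition $$\frac1{d(d-1)}\sum_{K\supset E}|\kappa_E^K|\cot\theta_E^K\ge0\quad\text{for every edge }E,$$ then there is a constant $C>0$, independent of $\tau$ and $h$, such that $$\sup_{0\le n\le N}\mathbb E\bigl[\|u_h^n\|_{L^2}^2\bigr]+\sum_{n=0}^{N-1}\mathbb E\bigl[\|u_h^{n+1}-u_h^n\|_{L^2}^2\bigr]+\tau\sum_{n=0}^{N-1}\mathbb E\bigl[\|\nabla u_h^{n+1}\|_{L^2}^2\bigr]+\frac\tau2\sum_{n=0}^{N-1}\mathbb E\bigl[\|u_h^{n+1}\|_{L^{q+1}}^{q+1}\bigr]\le C .$$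
   Context: $D=(0,L)^d\subset\mathbb R^d$, $T>0$, $N\in\mathbb N$, $\tau=T/N$, $t_n=n\tau$, $W$ is a real-valued Wiener process on a filtered probability space, $\Delta W_n=W(t_{n+1})-W(t_n)$, and the process $u_h^n$ is $\mathcal F_{t_n}$-adapted. $\mathcal T_h$ is a triangulation of $D$ of mesh size $h$. Mesh notation: for a simplex $K$ with vertices $a_1,\dots,a_{d+1}$, let $E=E_{ij}$ be the edge joining $a_i$ and $a_j$, $S_i$ the $(d-1)$-dimensional face opposite to $a_i$, $\theta_E^K$ the angle between the faces $S_i$ and $S_j$, and $\kappa_E^K=S_i\cap S_j$; for $d=2$ the mesh condition is the Delaunay condition. $V_h=\{v_h\in H_0^1(D):v_h|_K\in\mathcal P_1(K)\ \forall K\in\mathcal T_h\}$ is the space of continuous piecewise linear functions vanishing on $\partial D$, $I_h:C(\bar D)\to V_h$ is the nodal interpolation operator, and $P_h:L^2(D)\to V_h$ is the $L^2$-projection. The initial datum $u_0$ is sufficiently smooth. $G:H_0^1(D)\to H_0^1(D)$ satisfies the following assumptions, formulated for Hilbert spaces $\mathcal H,\mathcal K$ and $G:\mathcal H\to\mathcal K$ (they are used with $\mathcal H=\mathcal K=L^2(D)$ and with $\mathcal H=\mathcal K=H_0^1(D)$); $D^kG(u)\in\mathcal L_k(\mathcal H,\mathcal K)$ denotes the $k$-th Gateaux derivative, where $\mathcal L_k(\mathcal H,\mathcal K)$ is the space of $k$-linear maps from $\mathcal H^k$ to $\mathcal K$. There is $C>0$ such that for all $v,w\in\mathcal H$: $\|G(v)-G(w)\|_{\mathcal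 K}\le C\|v-w\|_{\mathcal H}$; $\|G(v)\|_{\mathcal K}\le C(\|v\|_{\mathcal H}+1)$; $\|DG\|_{L^\infty(\mathcal H;\mathcal L(\mathcal H,\mathcal K))}+\|D^2G\|_{L^\infty(\mathcal H;\mathcal L_2(\mathcal H,\mathcal K))}\le C$; $\|(DG(v)-DG(w))G(w)\|_{\mathcal K}\le C\|v-w\|_{\mathcal H}$. *)

theory Defs
  imports "HOL-Analysis.Analysis" "HOL-Probability.Probability"
begin

section \<open>Function spaces\<close>

text \<open>
  Elements of $L^2(D)$ and $H^1_0(D)$ are represented by functions on the whole Euclidean space.
  Only their values on \<open>D\<close> matter, and functions that agree almost everywhere on \<open>D\<close> are
  at norm distance 0 of each other.
\<close>

definition cube :: "real \<Rightarrow> 'a::euclidean_space set" where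
  "cube L = {x. \<forall>b\<in>Basis. 0 < x \<bullet> b \<and> x \<bullet> b < L}"

definition L2_inner ::
    "'a::euclidean_space set \<Rightarrow> ('a \<Rightarrow> 'b::euclidean_space) \<Rightarrow> ('a \<Rightarrow> 'b) \<Rightarrow> real" where
  "L2_inner D f g = (LINT x|lebesgue_on D. f x \<bullet> g x)"

definition Lp_norm ::
    "'a::euclidean_space set \<Rightarrow> nat \<Rightarrow> ('a \<Rightarrow> 'b::euclidean_space) \<Rightarrow> real" where
  "Lp_norm D p f = root p (LINT x|lebesgue_on D. norm (f x) ^ p)"

definition L2 :: "'a::euclidean_space set \<Rightarrow> ('a \<Rightarrow> 'b::euclidean_space) set" where
  "L2 D = {f \<in> borel_measurable (lebesgue_on D). integrable (lebesgue_on D) (\<lambda>x. (norm (f x))\<^sup>2)}"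

primrec Ck :: "nat \<Rightarrow> ('a::euclidean_space \<Rightarrow> real) \<Rightarrow> bool" where
  "Ck 0 f \<longleftrightarrow> continuous_on UNIV f"
| "Ck (Suc k) f \<longleftrightarrow>
     (\<forall>x. f differentiable (at x)) \<and> (\<forall>b\<in>Basis. Ck k (\<lambda>x. frechet_derivative f (at x) b))"

definition test_functions :: "'a::euclidean_space set \<Rightarrow> ('a \<Rightarrow> real) set" where
  "test_functions D =
     {\<phi>. (\<forall>k. Ck k \<phi>) \<and> compact (closure {x. \<phi> x \<noteq> 0}) \<and> closure {x. \<phi> x \<noteq> 0} \<subseteq> D}"

definition is_weak_gradient ::
    "'a::euclidean_space set \<Rightarrow> ('a \<Rightarrow> real) \<Rightarrow> ('a \<Rightarrow> 'a) \<Rightarrow> bool" where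
  "is_weak_gradient D u g \<longleftrightarrow> g \<in> L2 D \<and>
     (\<forall>\<phi>\<in>test_functions D. \<forall>b\<in>Basis.
        (LINT x|lebesgue_on D. u x * frechet_derivative \<phi> (at x) b)
          = - (LINT x|lebesgue_on D. (g x \<bullet> b) * \<phi> x))"

text \<open>Weak gradients are unique up to null sets; \<open>grad D u\<close> selects one representative.\<close>

definition grad :: "'a::euclidean_space set \<Rightarrow> ('a \<Rightarrow> real) \<Rightarrow> 'a \<Rightarrow> 'a" where
  "grad D u = (SOME g. is_weak_gradient D u g)"

definition H1 :: "'a::euclidean_space set \<Rightarrow> ('a \<Rightarrow> real) set" where
  "H1 D = {u \<in> L2 D. \<exists>g. is_weak_gradient D u g}"

definition H1_norm :: "'a::euclidean_space set \<Rightarrow> ('a \<Rightarrow> real) \<Rightarrow> real" where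
  "H1_norm D u = sqrt ((Lp_norm D 2 u)\<^sup>2 + (Lp_norm D 2 (grad D u))\<^sup>2)"

definition H10 :: "'a::euclidean_space set \<Rightarrow> ('a \<Rightarrow> real) set" where
  "H10 D = {u \<in> H1 D. \<exists>\<phi>. (\<forall>n. \<phi> n \<in> test_functions D) \<and>
              (\<lambda>n. H1_norm D (\<lambda>x. u x - \<phi> n x)) \<longlonglongrightarrow> 0}"


section \<open>Assumptions on the noise coefficient\<close>

text \<open>
  \<open>H\<close> is a vector space of functions and \<open>nrm\<close> its norm, with functions at distance 0
  identified; accordingly (bi)linearity is required only up to that identification.
\<close>

definition bounded_operator ::
    "('a \<Rightarrow> real) set \<Rightarrow> (('a \<Rightarrow> real) \<Rightarrow> real) \<Rightarrow> (('a \<Rightarrow> real) \<Rightarrow> 'a \<Rightarrow> real) \<Rightarrow> bool" where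
  "bounded_operator H nrm A \<longleftrightarrow>
     (\<forall>v\<in>H. A v \<in> H) \<and>
     (\<forall>v\<in>H. \<forall>w\<in>H. \<forall>a b.
        nrm (\<lambda>x. A (\<lambda>y. a * v y + b * w y) x - (a * A v x + b * A w x)) = 0) \<and>
     (\<exists>B. \<forall>v\<in>H. nrm (A v) \<le> B * nrm v)"

definition bounded_bilinear_operator ::
    "('a \<Rightarrow> real) set \<Rightarrow> (('a \<Rightarrow> real) \<Rightarrow> real) \<Rightarrow>
     (('a \<Rightarrow> real) \<Rightarrow> ('a \<Rightarrow> real) \<Rightarrow> 'a \<Rightarrow> real) \<Rightarrow> bool" where
  "bounded_bilinear_operator H nrm A \<longleftrightarrow>
     (\<forall>v\<in>H. bounded_operator H nrm (A v) \<and> bounded_operator H nrm (\<lambda>w. A w v)) \<and>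
     (\<exists>B. \<forall>v\<in>H. \<forall>w\<in>H. nrm (A v w) \<le> B * nrm v * nrm w)"

definition first_gateaux_derivative ::
    "('a \<Rightarrow> real) set \<Rightarrow> (('a \<Rightarrow> real) \<Rightarrow> real) \<Rightarrow> (('a \<Rightarrow> real) \<Rightarrow> 'a \<Rightarrow> real) \<Rightarrow>
     (('a \<Rightarrow> real) \<Rightarrow> ('a \<Rightarrow> real) \<Rightarrow> 'a \<Rightarrow> real) \<Rightarrow> bool" where
  "first_gateaux_derivative H nrm G DG \<longleftrightarrow>
     (\<forall>u\<in>H. bounded_operator H nrm (DG u) \<and>
       (\<forall>v\<in>H. ((\<lambda>t. nrm (\<lambda>x. (G (\<lambda>y. u y + t * v y) x - G u x) / t - DG u v x)) \<longlongrightarrow> 0) (at 0)))"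

definition second_gateaux_derivative ::
    "('a \<Rightarrow> real) set \<Rightarrow> (('a \<Rightarrow> real) \<Rightarrow> real) \<Rightarrow>
     (('a \<Rightarrow> real) \<Rightarrow> ('a \<Rightarrow> real) \<Rightarrow> 'a \<Rightarrow> real) \<Rightarrow>
     (('a \<Rightarrow> real) \<Rightarrow> ('a \<Rightarrow> real) \<Rightarrow> ('a \<Rightarrow> real) \<Rightarrow> 'a \<Rightarrow> real) \<Rightarrow> bool" where
  "second_gateaux_derivative H nrm DG D2G \<longleftrightarrow>
     (\<forall>u\<in>H. bounded_bilinear_operator H nrm (D2G u) \<and>
       (\<forall>v\<in>H. \<forall>w\<in>H.
          ((\<lambda>t. nrm (\<lambda>x. (DG (\<lambda>y. u y + t * w y) v x - DG u v x) / t - D2G u v w x)) \<longlongrightarrow> 0) (at 0)))"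

text \<open>The suprema are the $L^\infty$-norms of $DG$ and $D^2G$ with values in the operator norms.\<close>

definition noise_coefficient_on ::
    "('a \<Rightarrow> real) set \<Rightarrow> (('a \<Rightarrow> real) \<Rightarrow> real) \<Rightarrow> (('a \<Rightarrow> real) \<Rightarrow> 'a \<Rightarrow> real) \<Rightarrow>
     (('a \<Rightarrow> real) \<Rightarrow> ('a \<Rightarrow> real) \<Rightarrow> 'a \<Rightarrow> real) \<Rightarrow>
     (('a \<Rightarrow> real) \<Rightarrow> ('a \<Rightarrow> real) \<Rightarrow> ('a \<Rightarrow> real) \<Rightarrow> 'a \<Rightarrow> real) \<Rightarrow> bool" where
  "noise_coefficient_on H nrm G DG D2G \<longleftrightarrow>
     (\<forall>v\<in>H. G v \<in> H) \<and>
     first_gateaux_derivative H nrm G DG \<and>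
     second_gateaux_derivative H nrm DG D2G \<and>
     (\<exists>C>0.
        (\<forall>v\<in>H. \<forall>w\<in>H. nrm (\<lambda>x. G v x - G w x) \<le> C * nrm (\<lambda>x. v x - w x)) \<and>
        (\<forall>v\<in>H. nrm (G v) \<le> C * (nrm v + 1)) \<and>
        (SUP u\<in>H. SUP v\<in>{v\<in>H. nrm v \<le> 1}. ennreal (nrm (DG u v))) +
          (SUP u\<in>H. SUP v\<in>{v\<in>H. nrm v \<le> 1}. SUP w\<in>{w\<in>H. nrm w \<le> 1}. ennreal (nrm (D2G u v w)))
          \<le> ennreal C \<and>
        (\<forall>v\<in>H. \<forall>w\<in>H.
           nrm (\<lambda>x. DG v (G w) x - DG w (G w) x) \<le> C * nrm (\<lambda>x. v x - w x)))"

definition noise_coefficient ::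
    "'a::euclidean_space set \<Rightarrow> (('a \<Rightarrow> real) \<Rightarrow> 'a \<Rightarrow> real) \<Rightarrow>
     (('a \<Rightarrow> real) \<Rightarrow> ('a \<Rightarrow> real) \<Rightarrow> 'a \<Rightarrow> real) \<Rightarrow>
     (('a \<Rightarrow> real) \<Rightarrow> ('a \<Rightarrow> real) \<Rightarrow> ('a \<Rightarrow> real) \<Rightarrow> 'a \<Rightarrow> real) \<Rightarrow> bool" where
  "noise_coefficient D G DG D2G \<longleftrightarrow>
     noise_coefficient_on (L2 D) (Lp_norm D 2) G DG D2G \<and>
     noise_coefficient_on (H10 D) (H1_norm D) G DG D2G"


section \<open>Triangulations\<close>

text \<open>The members of the mesh are closed simplices of full dimension.\<close>

definition mesh_of :: "'a::euclidean_space set \<Rightarrow> 'a set set \<Rightarrow> bool" where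
  "mesh_of D \<T> \<longleftrightarrow>
     triangulation \<T> \<and> (\<forall>K\<in>\<T>. int DIM('a) simplex K) \<and> \<Union>\<T> = closure D"

definition vertices :: "'a::euclidean_space set \<Rightarrow> 'a set" where
  "vertices K = {a. a extreme_point_of K}"

definition nodes :: "'a::euclidean_space set set \<Rightarrow> 'a set" where
  "nodes \<T> = (\<Union>K\<in>\<T>. vertices K)"

text \<open>
  An edge is given by its two endpoints \<open>a\<close>, \<open>b\<close>. With \<open>S\<^sub>a\<close>, \<open>S\<^sub>b\<close> the faces of \<open>K\<close> opposite
  to \<open>a\<close>, \<open>b\<close>, the set \<open>kappa K a b\<close> is their intersection.
\<close>

definition opposite_face :: "'a::euclidean_space set \<Rightarrow> 'a \<Rightarrow> 'a set" where
  "opposite_face K a = convex hull (vertices K - {a})"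

definition kappa :: "'a::euclidean_space set \<Rightarrow> 'a \<Rightarrow> 'a \<Rightarrow> 'a set" where
  "kappa K a b = opposite_face K a \<inter> opposite_face K b"

text \<open>
  The dihedral angle of \<open>K\<close> between \<open>S\<^sub>a\<close> and \<open>S\<^sub>b\<close>: the angle between the vectors that are
  orthogonal to \<open>kappa K a b\<close> and point into \<open>S\<^sub>b\<close> (towards \<open>a\<close>) and \<open>S\<^sub>a\<close> (towards \<open>b\<close>).
  In dimension 2 this is the interior angle at the third vertex.
\<close>

definition dihedral_angle :: "'a::euclidean_space set \<Rightarrow> 'a \<Rightarrow> 'a \<Rightarrow> real" where
  "dihedral_angle K a b =
     (let A = affine hull (kappa K a b);
          p = a - closest_point A a;
          q = b - closest_point A b
      in arccos ((p \<bullet> q) / (norm p * norm q)))"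

text \<open>
  The $(d-2)$-dimensional measure of \<open>kappa K a b\<close>, needed only for $d = 2$ (a point, with
  counting measure) and $d = 3$ (a segment, with its length).
\<close>

definition kappa_measure :: "'a::euclidean_space set \<Rightarrow> real" where
  "kappa_measure S = (if aff_dim S = 0 then 1 else diameter S)"

definition mesh_condition :: "'a::euclidean_space set set \<Rightarrow> bool" where
  "mesh_condition \<T> \<longleftrightarrow>
     (\<forall>a b. a \<noteq> b \<and> (\<exists>K\<in>\<T>. {a, b} \<subseteq> vertices K) \<longrightarrow>
        1 / (real DIM('a) * (real DIM('a) - 1)) *
          (\<Sum>K\<in>{K\<in>\<T>. {a, b} \<subseteq> vertices K}.
             kappa_measure (kappa K a b) * cot (dihedral_angle K a b)) \<ge> 0)"


section \<open>The finite element space\<close>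

definition piecewise_affine :: "'a::euclidean_space set set \<Rightarrow> ('a \<Rightarrow> real) \<Rightarrow> bool" where
  "piecewise_affine \<T> v \<longleftrightarrow> (\<forall>K\<in>\<T>. \<exists>c d. \<forall>x\<in>K. v x = c \<bullet> x + d)"

text \<open>
  The elements are continuous representatives: being affine on each of the closed simplices,
  they are continuous on \<open>closure D\<close>, and they vanish pointwise on the boundary.
\<close>

definition fe_space :: "'a::euclidean_space set \<Rightarrow> 'a set set \<Rightarrow> ('a \<Rightarrow> real) set" where
  "fe_space D \<T> = {v \<in> H10 D. piecewise_affine \<T> v \<and> (\<forall>x\<in>frontier D. v x = 0)}"

text \<open>
  The nodal interpolant lies in the space with zero boundary values, so only the values at the
  interior nodes are interpolated (for functions vanishing on the boundary: at all nodes).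
  These conditions determine it on \<open>closure D\<close>.
\<close>

definition nodal_interpolant ::
    "'a::euclidean_space set \<Rightarrow> 'a set set \<Rightarrow> ('a \<Rightarrow> real) \<Rightarrow> 'a \<Rightarrow> real" where
  "nodal_interpolant D \<T> f =
     (SOME v. piecewise_affine \<T> v \<and> (\<forall>a\<in>nodes \<T>. v a = (if a \<in> D then f a else 0)))"

text \<open>
  \<open>p\<close> is the $L^2(D)$-projection of \<open>f\<close> onto \<open>V\<close>. A relation is used, since \<open>p\<close> is
  determined on \<open>D\<close> only.
\<close>

definition is_L2_projection ::
    "'a::euclidean_space set \<Rightarrow> ('a \<Rightarrow> real) set \<Rightarrow> ('a \<Rightarrow> real) \<Rightarrow> ('a \<Rightarrow> real) \<Rightarrow> bool" where
  "is_L2_projection D V f p \<longleftrightarrow> p \<in> V \<and> (\<forall>v\<in>V. L2_inner D p v = L2_inner D f v)"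


section \<open>Wiener process\<close>

text \<open>
  The filtration is indexed by all reals, but only times \<open>t \<ge> 0\<close> matter: a filtration on
  \<open>{0..}\<close> extends to negative times by its value at 0.
\<close>

definition filtered_prob_space :: "'w measure \<Rightarrow> (real \<Rightarrow> 'w measure) \<Rightarrow> bool" where
  "filtered_prob_space M \<F> \<longleftrightarrow>
     prob_space M \<and> filtration (space M) \<F> \<and> (\<forall>t. subalgebra M (\<F> t))"

definition wiener_process ::
    "'w measure \<Rightarrow> (real \<Rightarrow> 'w measure) \<Rightarrow> (real \<Rightarrow> 'w \<Rightarrow> real) \<Rightarrow> bool" where
  "wiener_process M \<F> W \<longleftrightarrow>
     (AE \<omega> in M. W 0 \<omega> = 0) \<and>
     (\<forall>t\<ge>0. W t \<in> borel_measurable (\<F> t)) \<and>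
     (\<forall>s\<ge>0. \<forall>t>s.
        distributed M lborel (\<lambda>\<omega>. W t \<omega> - W s \<omega>) (normal_density 0 (sqrt (t - s))) \<and>
        prob_space.indep_set M (sets (\<F> s))
          {(\<lambda>\<omega>. W t \<omega> - W s \<omega>) -` B \<inter> space M | B. B \<in> sets borel}) \<and>
     (AE \<omega> in M. continuous_on {0..} (\<lambda>t. W t \<omega>))"


section \<open>The fully discrete scheme\<close>

text \<open>
  \<open>u n \<omega>\<close> is $u_h^n(\omega)$. Adaptedness of the process with values in the finite-dimensional
  space \<open>fe_space D \<T>\<close> is expressed through the point evaluations on \<open>closure D\<close>.
\<close>

definition scheme_solution ::
    "'a::euclidean_space set \<Rightarrow> 'a set set \<Rightarrow> nat \<Rightarrow>
     (('a \<Rightarrow> real) \<Rightarrow> 'a \<Rightarrow> real) \<Rightarrow> (('a \<Rightarrow> real) \<Rightarrow> ('a \<Rightarrow> real) \<Rightarrow> 'a \<Rightarrow> real) \<Rightarrow>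
     'w measure \<Rightarrow> (real \<Rightarrow> 'w measure) \<Rightarrow> (real \<Rightarrow> 'w \<Rightarrow> real) \<Rightarrow>
     ('a \<Rightarrow> real) \<Rightarrow> real \<Rightarrow> nat \<Rightarrow> (nat \<Rightarrow> 'w \<Rightarrow> 'a \<Rightarrow> real) \<Rightarrow> bool" where
  "scheme_solution D \<T> q G DG M \<F> W u0 T N u \<longleftrightarrow>
     (let \<tau> = T / real N; t = (\<lambda>n. real n * \<tau>);
          \<Delta>W = (\<lambda>n \<omega>. W (t (Suc n)) \<omega> - W (t n) \<omega>);
          V = fe_space D \<T>
      in
        (\<forall>n\<le>N. \<forall>\<omega>\<in>space M. u n \<omega> \<in> V) \<and>
        (\<forall>n\<le>N. \<forall>x\<in>closure D. (\<lambda>\<omega>. u n \<omega> x) \<in> borel_measurable (\<F> (t n))) \<and>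
        (AE \<omega> in M. is_L2_projection D V u0 (u 0 \<omega>)) \<and>
        (AE \<omega> in M. \<forall>n<N. \<forall>v\<in>V.
           L2_inner D (\<lambda>x. u (Suc n) \<omega> x - u n \<omega> x) v
             + \<tau> * L2_inner D (grad D (u (Suc n) \<omega>)) (grad D v)
           = \<tau> * L2_inner D
                 (nodal_interpolant D \<T> (\<lambda>x. u (Suc n) \<omega> x - (u (Suc n) \<omega> x) ^ q)) v
             + L2_inner D (G (u n \<omega>)) v * \<Delta>W n \<omega>
             + 1 / 2 * L2_inner D
                 (\<lambda>x. DG (u n \<omega>) (G (u n \<omega>)) x * ((\<Delta>W n \<omega>)\<^sup>2 - \<tau>)) v))"

end

theory Submission
  imports Defs
begin

text \<open>
The bound is an energy estimate: the scheme is tested with \<open>v = u\<^sup>n\<^sup>+\<^sup>1\<close>. The implicit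
difference then contributes half of \<open>\<parallel>u\<^sup>n\<^sup>+\<^sup>1\<parallel>\<^sup>2 - \<parallel>u\<^sup>n\<parallel>\<^sup>2 + \<parallel>u\<^sup>n\<^sup>+\<^sup>1 - u\<^sup>n\<parallel>\<^sup>2\<close>, the
gradient term is dissipative, and two contributions need an idea.

The nonlinearity enters through its nodal interpolant, so the sign of
\<open>(I\<^sub>h(u\<^sup>q), u)\<close> is not visible pointwise. On a simplex with nodal values \<open>v\<^sub>i\<close> the integral is
\<open>\<Sum> v\<^sub>i\<^sup>q v\<^sub>j m\<^sub>i\<^sub>j\<close>, where the mass matrix is \<open>m\<^sub>i\<^sub>j = \<beta> (1 + \<delta>\<^sub>i\<^sub>j)\<close>. That the mixed moments
of the barycentric coordinates are half of the square moments follows from bisecting the simplex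
at the midpoint of an edge: each half is an affine image of the whole
(\<open>mixed_moment\<close>). What remains is an inequality between
power sums, \<open>\<Sum> v\<^sub>i\<^sup>q\<^sup>+\<^sup>1 + (\<Sum> v\<^sub>i\<^sup>q) (\<Sum> v\<^sub>i) \<ge> c \<Sum> v\<^sub>i\<^sup>q\<^sup>+\<^sup>1\<close> (\<open>sign_balance\<close>). It holds for all
odd \<open>q\<close> in a triangle; in a tetrahedron with one value of one sign and three of the other it
depends on the size of \<open>q\<close> and reduces, for \<open>q = 3\<close> and \<open>q = 5\<close>, to explicit sums of squares.
Since \<open>|u|\<^sup>q\<^sup>+\<^sup>1\<close> is bounded on a simplex by the sum of its nodal values, \<open>(I\<^sub>h(u\<^sup>q), u)\<close>
controls a fixed multiple of the \<open>(q+1)\<close>-st power of the \<open>L\<^sup>q\<^sup>+\<^sup>1\<close>-norm, with a constant that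
depends on \<open>q\<close> only (\<open>lumped_nonlinearity_coercive\<close>). This dissipation also absorbs the term
\<open>\<tau> \<parallel>u\<^sup>n\<^sup>+\<^sup>1\<parallel>\<^sup>2\<close>, for time steps of any size.

In the noise terms \<open>u\<^sup>n\<^sup>+\<^sup>1\<close> is replaced by \<open>u\<^sup>n\<close>; the error is absorbed in
\<open>\<parallel>u\<^sup>n\<^sup>+\<^sup>1 - u\<^sup>n\<parallel>\<^sup>2\<close> and leaves \<open>\<parallel>G(u\<^sup>n)\<parallel>\<^sup>2 (\<Delta>W)\<^sup>2\<close> and
\<open>\<parallel>DG(u\<^sup>n)G(u\<^sup>n)\<parallel>\<^sup>2 ((\<Delta>W)\<^sup>2 - \<tau>)\<^sup>2\<close>. The coefficients at time \<open>n\<close> are independent of the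
increment, so the terms linear in \<open>\<Delta>W\<close> and \<open>(\<Delta>W)\<^sup>2 - \<tau>\<close> have mean zero and the remaining
ones are of order \<open>\<tau> (1 + \<parallel>u\<^sup>n\<parallel>\<^sup>2)\<close>, because \<open>G\<close> and \<open>u \<mapsto> DG(u)G(u)\<close> are Lipschitz on \<open>L\<^sup>2\<close>
(\<open>noise_coefficient_lipschitz\<close>). Independence requires measurability of these coefficients.
Adaptedness only speaks about point evaluations, and the finite expansion of \<open>u\<^sup>n\<close> in hat
functions carries it over (\<open>lipschitz_functional_measurable\<close>). The discrete Gronwall lemma
concludes.
\<close>

section \<open>Affine substitutions in Lebesgue integrals\<close>

text \<open>
Integrate \<open>1\<^sub>B(x) 1\<^sub>b\<^sub>o\<^sub>x(x + y)\<close> over \<open>\<mu>\<close> in \<open>x\<close> and Lebesgue measure in \<open>y\<close>. The integral over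
\<open>y\<close> first gives \<open>\<mu>(B)\<close>. Translating \<open>x\<close> by \<open>-y\<close> first and then integrating over \<open>y\<close> gives
\<open>\<mu>(box)\<close> times the volume of \<open>B\<close>, by invariance of Lebesgue measure under reflection.
\<close>

lemma translation_invariant_measure_unique:
  fixes \<mu> :: "'a::euclidean_space measure"
  assumes sets [measurable_cong]: "sets \<mu> = sets borel" and sf: "sigma_finite_measure \<mu>"
    and inv: "\<And>t. distr \<mu> borel ((+) t) = \<mu>" and B: "B \<in> sets borel"
  shows "emeasure \<mu> B = emeasure \<mu> (box 0 One) * emeasure lborel B"
proof -
  interpret sigma_finite_measure \<mu> by fact
  interpret P: pair_sigma_finite \<mu> "lborel :: 'a measure" ..
  define f :: "'a \<Rightarrow> ennreal" where "f = indicator B"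
  define g :: "'a \<Rightarrow> ennreal" where "g = indicator (box 0 One)"
  have [measurable]: "f \<in> borel_measurable borel" "g \<in> borel_measurable borel"
    using B by (auto simp: f_def g_def)
  have shift: "(\<integral>\<^sup>+x. h (t + x) \<partial>\<mu>) = (\<integral>\<^sup>+x. h x \<partial>\<mu>)"
    if [measurable]: "h \<in> borel_measurable borel" for h :: "'a \<Rightarrow> ennreal" and t
    using nn_integral_distr[of "(+) t" \<mu> borel h] inv[of t] by simp
  have shiftl: "(\<integral>\<^sup>+x. h (t + x) \<partial>lborel) = (\<integral>\<^sup>+x. h x \<partial>lborel)"
    if [measurable]: "h \<in> borel_measurable borel" for h :: "'a \<Rightarrow> ennreal" and t
    using nn_integral_distr[of "(+) t" lborel borel h] lborel_distr_plus[of t] by simp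
  have reflect: "(\<integral>\<^sup>+y. f (x - y) \<partial>lborel) = (\<integral>\<^sup>+y. f y \<partial>lborel)" for x
  proof -
    have "(lborel :: 'a measure) = distr lborel borel (\<lambda>y. x - y)"
      using lborel_affine[of "-1" x] by (simp add: density_1)
    then have "(\<integral>\<^sup>+y. f y \<partial>lborel) = (\<integral>\<^sup>+y. f y \<partial>distr lborel borel (\<lambda>y. x - y))"
      by simp
    then show ?thesis by (simp add: nn_integral_distr)
  qed
  have "emeasure \<mu> B = (\<integral>\<^sup>+x. f x * (\<integral>\<^sup>+y. g y \<partial>lborel) \<partial>\<mu>)"
    using B sets by (simp add: f_def g_def)
  also have "\<dots> = (\<integral>\<^sup>+x. (\<integral>\<^sup>+y. f x * g (x + y) \<partial>lborel) \<partial>\<mu>)"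
    by (subst nn_integral_cmult) (auto simp: shiftl)
  also have "\<dots> = (\<integral>\<^sup>+y. (\<integral>\<^sup>+x. f x * g (x + y) \<partial>\<mu>) \<partial>lborel)"
    by (rule P.Fubini'[symmetric]) measurable
  also have "\<dots> = (\<integral>\<^sup>+y. (\<integral>\<^sup>+x. f (x - y) * g x \<partial>\<mu>) \<partial>lborel)"
  proof (rule nn_integral_cong)
    fix y :: 'a
    show "(\<integral>\<^sup>+x. f x * g (x + y) \<partial>\<mu>) = (\<integral>\<^sup>+x. f (x - y) * g x \<partial>\<mu>)"
      using shift[of "\<lambda>x. f x * g (x + y)" "- y"] by (simp add: add.commute)
  qed
  also have "\<dots> = (\<integral>\<^sup>+x. (\<integral>\<^sup>+y. f (x - y) * g x \<partial>lborel) \<partial>\<mu>)"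
    by (rule P.Fubini') measurable
  also have "\<dots> = (\<integral>\<^sup>+x. g x * emeasure lborel B \<partial>\<mu>)"
  proof (rule nn_integral_cong)
    fix x
    have "(\<integral>\<^sup>+y. f (x - y) * g x \<partial>lborel) = (\<integral>\<^sup>+y. f y \<partial>lborel) * g x"
      by (subst nn_integral_multc) (auto simp: reflect)
    then show "(\<integral>\<^sup>+y. f (x - y) * g x \<partial>lborel) = g x * emeasure lborel B"
      using B by (simp add: f_def mult.commute)
  qed
  also have "\<dots> = emeasure \<mu> (box 0 One) * emeasure lborel B"
    by (subst nn_integral_multc) (auto simp: g_def sets)
  finally show ?thesis .
qed

text \<open>
The image of Lebesgue measure under an affine bijection is again translation invariant, hence a
multiple of it. The factor is the inverse of the modulus of the determinant; its value stays
implicit, since every application below determines it by comparing volumes.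
\<close>

lemma integral_affine_substitution:
  fixes g :: "'a::euclidean_space \<Rightarrow> 'a"
  assumes lin: "linear g" and inj: "inj g"
  shows "\<exists>\<kappa>>0. \<forall>f::'a \<Rightarrow> real. f \<in> borel_measurable borel \<longrightarrow>
    (LINT x|lborel. f (g x + t)) = \<kappa> * (LINT x|lborel. f x)"
proof -
  define A where "A = (\<lambda>x. g x + t)"
  define \<mu> where "\<mu> = distr lborel borel A"
  have contg: "continuous_on UNIV g" using lin linear_continuous_on linear_conv_bounded_linear by blast
  have [measurable]: "A \<in> borel_measurable borel"
    unfolding A_def by (intro borel_measurable_continuous_onI continuous_intros contg)
  have surj: "surj g" using lin inj linear_injective_imp_surjective by blast
  have sets: "sets \<mu> = sets borel" by (simp add: \<mu>_def)
  obtain b where b: "b > 0" "\<And>x. b * norm x \<le> norm (g x)"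
    using linear_inj_bounded_below_pos[OF lin] inj by (metis mult.commute)
  have fin: "emeasure \<mu> (cball 0 r) < \<infinity>" for r
  proof -
    have "A -` cball 0 r \<subseteq> cball 0 ((r + norm t) / b)"
    proof
      fix x assume "x \<in> A -` cball 0 r"
      then have "norm (g x) \<le> r + norm t"
        using norm_triangle_ineq4[of "g x + t" t] by (simp add: A_def)
      then have "b * norm x \<le> r + norm t" using b(2)[of x] by linarith
      then show "x \<in> cball 0 ((r + norm t) / b)" using b(1) by (simp add: field_simps)
    qed
    then have "emeasure lborel (A -` cball 0 r) \<le> emeasure lborel (cball (0::'a) ((r + norm t) / b))"
      by (rule emeasure_mono) simp
    also have "\<dots> < \<infinity>" using emeasure_bounded_finite[OF bounded_cball] by simp
    finally show ?thesis by (simp add: \<mu>_def emeasure_distr)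
  qed
  have sf: "sigma_finite_measure \<mu>"
  proof
    show "\<exists>X. countable X \<and> X \<subseteq> sets \<mu> \<and> \<Union> X = space \<mu> \<and> (\<forall>a\<in>X. emeasure \<mu> a \<noteq> \<infinity>)"
      by (rule exI[of _ "range (\<lambda>n::nat. cball 0 (real n))"])
        (auto simp: sets \<mu>_def[THEN arg_cong[where f=space]] real_arch_simple
          fin[THEN less_imp_neq, simplified])
  qed
  have inv: "distr \<mu> borel ((+) s) = \<mu>" for s
  proof -
    obtain r where r: "g r = s" using surj by (metis surjD)
    have "distr \<mu> borel ((+) s) = distr lborel borel (\<lambda>x. s + A x)"
      unfolding \<mu>_def by (subst distr_distr) (auto simp: comp_def)
    also have "(\<lambda>x. s + A x) = (\<lambda>x. A (r + x))"
      by (auto simp: A_def r[symmetric] linear_add[OF lin])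
    also have "distr lborel borel (\<lambda>x. A (r + x)) = distr (distr lborel borel ((+) r)) borel A"
      by (subst distr_distr) (auto simp: comp_def)
    also have "\<dots> = \<mu>" by (simp add: lborel_distr_plus \<mu>_def)
    finally show ?thesis .
  qed
  define k where "k = emeasure \<mu> (box 0 One)"
  have \<mu>: "emeasure \<mu> B = k * emeasure lborel B" if "B \<in> sets borel" for B
    using translation_invariant_measure_unique[OF sets sf inv that] by (simp add: k_def)
  have "bounded (box (0::'a) One)" by simp
  then obtain r where "\<forall>x\<in>box (0::'a) One. norm x \<le> r" unfolding bounded_iff by blast
  then have "box (0::'a) One \<subseteq> cball 0 r" by auto
  then have "k \<le> emeasure \<mu> (cball 0 r)" unfolding k_def by (intro emeasure_mono) (auto simp: sets)
  then have kfin: "k < \<infinity>" using fin[of r] by simp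
  \<comment> \<open>Otherwise the measure would vanish, but the preimage of the whole space has infinite volume.\<close>
  have "emeasure \<mu> UNIV = \<infinity>" by (simp add: \<mu>_def emeasure_distr)
  then have k0: "k \<noteq> 0" using \<mu>[of UNIV] by auto
  define \<kappa> where "\<kappa> = enn2real k"
  have \<kappa>: "\<kappa> > 0" "k = ennreal \<kappa>" using k0 kfin by (auto simp: \<kappa>_def enn2real_positive_iff zero_less_iff_neq_zero)
  have eq: "\<mu> = density lborel (\<lambda>_. ennreal \<kappa>)"
    by (rule measure_eqI) (auto simp: sets emeasure_density nn_integral_cmult_indicator \<mu> \<kappa>(2))
  show ?thesis
  proof (intro exI conjI allI impI)
    show "0 < \<kappa>" by (fact \<kappa>(1))
    fix f :: "'a \<Rightarrow> real" assume [measurable]: "f \<in> borel_measurable borel"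
    have "(LINT x|lborel. f (g x + t)) = (LINT x|\<mu>. f x)"
      by (simp add: \<mu>_def integral_distr) (simp add: A_def)
    also have "\<dots> = \<kappa> * (LINT x|lborel. f x)"
      unfolding eq by (subst integral_density) (use \<kappa>(1) in auto)
    finally show "(LINT x|lborel. f (g x + t)) = \<kappa> * (LINT x|lborel. f x)" .
  qed
qed

section \<open>Second moments of barycentric coordinates\<close>

text \<open>
After translating one of the points to the origin, the others are linearly independent.
\<close>

lemma affine_function_interpolates:
  fixes V :: "'a::euclidean_space set" and y :: "'a \<Rightarrow> real"
  assumes "\<not> affine_dependent V"
  shows "\<exists>c d. \<forall>a\<in>V. c \<bullet> a + d = y a"
proof (cases "V = {}")
  case False
  then obtain a0 where a0: "a0 \<in> V" by blast
  define B where "B = (\<lambda>x. - a0 + x) ` (V - {a0})"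
  have "independent B"
    using assms affine_dependent_iff_dependent2[OF a0] by (simp add: B_def)
  then obtain g :: "'a \<Rightarrow> real" where g: "linear g" "\<And>z. z \<in> B \<Longrightarrow> g z = y (a0 + z) - y a0"
    using linear_independent_extend[of B "\<lambda>z. y (a0 + z) - y a0"] by blast
  define c where "c = adjoint g 1"
  have c: "c \<bullet> x = g x" for x
    using adjoint_works[OF g(1), of x 1] by (simp add: c_def inner_commute)
  show ?thesis
  proof (intro exI ballI)
    fix a assume a: "a \<in> V"
    show "c \<bullet> a + (y a0 - g a0) = y a"
    proof (cases "a = a0")
      case False
      then have "- a0 + a \<in> B" using a by (auto simp: B_def)
      then show ?thesis using g(2)[of "- a0 + a"] by (simp add: c linear_diff[OF g(1)])
    qed (simp add: c)
  qed
qed simp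

text \<open>
The affine maps that act on two barycentric coordinates only differ from the identity by a
rank-one term. Such a map is injective as soon as \<open>c \<bullet> w \<noteq> -1\<close>.
\<close>

lemma shear_substitution:
  fixes c w :: "'a::euclidean_space"
  assumes "c \<bullet> w \<noteq> -1"
  shows "\<exists>\<kappa>>0. \<forall>f::'a \<Rightarrow> real. f \<in> borel_measurable borel \<longrightarrow>
     (LINT x|lborel. f (x + (c \<bullet> x + d) *\<^sub>R w)) = \<kappa> * (LINT x|lborel. f x)"
proof -
  define g where "g = (\<lambda>x. x + (c \<bullet> x) *\<^sub>R w)"
  have lin: "linear g"
    by (rule linearI) (auto simp: g_def inner_add_right scaleR_add_left scaleR_add_right)
  have "x = 0" if "g x = 0" for x
  proof -
    have "c \<bullet> g x = (c \<bullet> x) * (1 + c \<bullet> w)"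
      by (simp add: g_def inner_add_right algebra_simps)
    then have "c \<bullet> x = 0" using that assms by (simp add: add_eq_0_iff)
    then show ?thesis using that by (simp add: g_def)
  qed
  then have inj: "inj g" using linear_injective_0[OF lin] by blast
  show ?thesis
    using integral_affine_substitution[OF lin inj, of "d *\<^sub>R w"]
    by (simp add: g_def scaleR_add_left add.assoc)
qed

text \<open>
A simplex of full dimension is described by its vertices together with its barycentric
coordinates \<open>l a\<close>, extended to affine functions on the whole space.
\<close>

locale barycentric_coordinates =
  fixes V :: "'a::euclidean_space set" and l :: "'a \<Rightarrow> 'a \<Rightarrow> real"
  assumes fin: "finite V" and full: "affine hull V = UNIV"
    and aff: "a \<in> V \<Longrightarrow> \<exists>c d. \<forall>x. l a x = c \<bullet> x + d"
    and delta: "a \<in> V \<Longrightarrow> b \<in> V \<Longrightarrow> l a b = (if a = b then 1 else 0)"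
begin

abbreviation "K \<equiv> convex hull V"

lemma shift: "k \<in> V \<Longrightarrow> l k (x + s *\<^sub>R (a - b)) = l k x + s * (l k a - l k b)"
  using aff[of k] by (auto simp: inner_add_right inner_diff_right algebra_simps)

lemma coordinates: "(\<Sum>a\<in>V. l a x) = 1" "(\<Sum>a\<in>V. l a x *\<^sub>R a) = x"
proof -
  obtain u where u: "sum u V = 1" "(\<Sum>b\<in>V. u b *\<^sub>R b) = x"
    using full unfolding affine_hull_finite[OF fin] by blast
  have "l a x = u a" if a: "a \<in> V" for a
  proof -
    obtain c d where cd: "\<forall>x. l a x = c \<bullet> x + d" using aff[OF a] by blast
    have "l a x = (\<Sum>b\<in>V. u b * (c \<bullet> b)) + (\<Sum>b\<in>V. u b) * d"
      unfolding cd[rule_format] by (simp add: u(1)) (simp add: u(2)[symmetric] inner_sum_right)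
    also have "\<dots> = (\<Sum>b\<in>V. u b * l a b)"
      by (simp add: cd sum_distrib_right sum.distrib distrib_left)
    also have "\<dots> = (\<Sum>b\<in>V. if a = b then u b else 0)"
      by (intro sum.cong) (auto simp: delta a)
    also have "\<dots> = u a" using a fin by simp
    finally show ?thesis .
  qed
  then show "(\<Sum>a\<in>V. l a x) = 1" "(\<Sum>a\<in>V. l a x *\<^sub>R a) = x" using u by (auto cong: sum.cong)
qed

lemma mem_simplex_iff: "x \<in> K \<longleftrightarrow> (\<forall>a\<in>V. 0 \<le> l a x)"
proof
  assume "x \<in> K"
  then obtain u where u: "\<forall>b\<in>V. 0 \<le> u b" "sum u V = 1" "(\<Sum>b\<in>V. u b *\<^sub>R b) = x"
    using convex_hull_finite[OF fin] by auto
  show "\<forall>a\<in>V. 0 \<le> l a x"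
  proof
    fix a assume a: "a \<in> V"
    obtain c d where cd: "\<forall>x. l a x = c \<bullet> x + d" using aff[OF a] by blast
    have "l a x = (\<Sum>b\<in>V. u b * (c \<bullet> b)) + (\<Sum>b\<in>V. u b) * d"
      unfolding cd[rule_format] by (simp add: u(2)) (simp add: u(3)[symmetric] inner_sum_right)
    also have "\<dots> = (\<Sum>b\<in>V. u b * l a b)"
      by (simp add: cd sum_distrib_right sum.distrib distrib_left)
    also have "\<dots> \<ge> 0"
      by (intro sum_nonneg mult_nonneg_nonneg) (auto simp: u delta a)
    finally show "0 \<le> l a x" .
  qed
next
  assume "\<forall>a\<in>V. 0 \<le> l a x"
  then show "x \<in> K"
    unfolding convex_hull_finite[OF fin] using coordinates[of x] by (auto intro: exI[of _ "\<lambda>a. l a x"])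
qed

lemma mem_simplex_iff_pair:
  assumes "a \<in> V" "b \<in> V"
  shows "x \<in> K \<longleftrightarrow> 0 \<le> l a x \<and> 0 \<le> l b x \<and> (\<forall>k\<in>V - {a, b}. 0 \<le> l k x)"
  unfolding mem_simplex_iff using assms by auto

lemma affine_eq_sum:
  assumes "\<forall>x\<in>K. v x = c \<bullet> x + d" and "x \<in> K"
  shows "v x = (\<Sum>a\<in>V. v a * l a x)"
proof -
  have "(\<Sum>a\<in>V. v a * l a x) = (\<Sum>a\<in>V. (c \<bullet> a) * l a x) + d * (\<Sum>a\<in>V. l a x)"
    unfolding sum_distrib_left sum.distrib[symmetric]
    by (intro sum.cong) (use assms(1) hull_inc[of _ V] in \<open>auto simp: algebra_simps\<close>)
  also have "(\<Sum>a\<in>V. (c \<bullet> a) * l a x) = c \<bullet> (\<Sum>a\<in>V. l a x *\<^sub>R a)"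
    by (simp add: inner_sum_right mult.commute)
  finally show ?thesis using assms by (simp add: coordinates)
qed

lemma continuous: "a \<in> V \<Longrightarrow> continuous_on S (l a)"
proof -
  assume "a \<in> V"
  then obtain c d where "l a = (\<lambda>x. c \<bullet> x + d)" using aff by blast
  then show ?thesis by (auto intro!: continuous_intros)
qed

lemma measurable_coord [measurable]: "a \<in> V \<Longrightarrow> l a \<in> borel_measurable borel"
  by (intro borel_measurable_continuous_onI continuous)

lemma compact_simplex: "compact K" using fin by (simp add: finite_imp_compact_convex_hull)

lemma measurable_simplex [measurable]: "K \<in> sets borel"
  using compact_simplex by (simp add: borel_compact)

definition simplex_integral :: "('a \<Rightarrow> real) \<Rightarrow> real" where "simplex_integral f = (LINT x|lborel. indicator K x * f x)"

lemma integrable_on_simplex: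
  assumes "continuous_on UNIV f"
  shows "integrable lborel (\<lambda>x. indicator K x * f x :: real)"
  using borel_integrable_compact[OF compact_simplex continuous_on_subset[OF assms]]
  by (simp add: indicator_scaleR_eq_if mult.commute if_distrib indicator_def cong: if_cong)

lemma simplex_integral_add: "continuous_on UNIV f \<Longrightarrow> continuous_on UNIV g \<Longrightarrow> simplex_integral (\<lambda>x. f x + g x) = simplex_integral f + simplex_integral g"
  unfolding simplex_integral_def distrib_left by (intro Bochner_Integration.integral_add integrable_on_simplex)

lemma simplex_integral_cmult: "simplex_integral (\<lambda>x. r * f x) = r * simplex_integral f"
  unfolding simplex_integral_def by (subst integral_mult_right_zero[symmetric]) (simp add: ac_simps)

lemma simplex_integral_sum: "(\<And>i. i \<in> I \<Longrightarrow> continuous_on UNIV (f i)) \<Longrightarrow> simplex_integral (\<lambda>x. \<Sum>i\<in>I. f i x) = (\<Sum>i\<in>I. simplex_integral (f i))"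
  unfolding simplex_integral_def sum_distrib_left by (intro Bochner_Integration.integral_sum integrable_on_simplex)

lemma volume_pos: "0 < simplex_integral (\<lambda>_. 1)"
proof -
  have "K \<noteq> {}" using full by auto
  moreover have "affine hull K = UNIV" using full by simp
  ultimately have "interior K \<noteq> {}"
    using rel_interior_interior[of K] rel_interior_eq_empty[OF convex_convex_hull[of V]] by simp
  then have "\<not> negligible K" using negligible_convex_interior[OF convex_convex_hull] by blast
  then have "emeasure lborel K \<noteq> 0"
    by (auto simp: negligible_iff_null_sets null_sets_def)
  moreover have "emeasure lborel K < \<infinity>"
    using emeasure_bounded_finite[OF compact_imp_bounded[OF compact_simplex]] .
  ultimately have "0 < measure lborel K"
    by (simp add: measure_def enn2real_positive_iff zero_less_iff_neq_zero)
  then show ?thesis by (simp add: simplex_integral_def)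
qed

text \<open>
The reflection that exchanges the coordinates \<open>l a\<close> and \<open>l b\<close> maps the simplex onto itself, so
the constant function shows that its substitution factor is 1.
\<close>

lemma swap_invariant:
  assumes ab: "a \<in> V" "b \<in> V" "a \<noteq> b" and [measurable]: "f \<in> borel_measurable borel"
  shows "simplex_integral (\<lambda>x. f (x + (l b x - l a x) *\<^sub>R (a - b))) = simplex_integral f"
proof -
  define R where "R = (\<lambda>x. x + (l b x - l a x) *\<^sub>R (a - b))"
  obtain ca da cb db where la: "\<forall>x. l a x = ca \<bullet> x + da" and lb: "\<forall>x. l b x = cb \<bullet> x + db"
    using aff ab by metis
  have "(cb - ca) \<bullet> (a - b) = (l b a - l b b) - (l a a - l a b)"
    by (simp add: la lb algebra_simps)
  also have "\<dots> = -2" using ab by (simp add: delta)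
  finally have "(cb - ca) \<bullet> (a - b) \<noteq> -1" by simp
  have R: "R = (\<lambda>x. x + ((cb - ca) \<bullet> x + (db - da)) *\<^sub>R (a - b))"
    by (simp add: R_def la lb inner_diff_left fun_eq_iff algebra_simps)
  from shear_substitution[OF \<open>(cb - ca) \<bullet> (a - b) \<noteq> -1\<close>, of "db - da"] obtain \<kappa> :: real where
    "\<forall>f::'a \<Rightarrow> real. f \<in> borel_measurable borel \<longrightarrow>
      (LINT x|lborel. f (x + ((cb - ca) \<bullet> x + (db - da)) *\<^sub>R (a - b))) = \<kappa> * (LINT x|lborel. f x)" by blast
  then have \<kappa>: "(LINT x|lborel. f (R x)) = \<kappa> * (LINT x|lborel. f x)"
    if "f \<in> borel_measurable borel" for f :: "'a \<Rightarrow> real" using that by (simp only: R)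
  have coord: "l k (R x) = (if k = a then l b x else if k = b then l a x else l k x)" if "k \<in> V" for k x
    using that ab by (auto simp: R_def shift delta)
  have "R x \<in> K \<longleftrightarrow> x \<in> K" for x
    unfolding mem_simplex_iff_pair[OF ab(1,2)] using coord ab by auto
  then have ind: "indicator K (R x) = (indicator K x :: real)" for x
    by (simp add: indicator_def)
  have *: "simplex_integral (\<lambda>x. h (R x)) = \<kappa> * simplex_integral h" if [measurable]: "h \<in> borel_measurable borel" for h
    unfolding simplex_integral_def using \<kappa>[of "\<lambda>x. indicator K x * h x"] by (simp add: ind)
  from *[of "\<lambda>_. 1"] volume_pos have "\<kappa> = 1" by simp
  then show ?thesis using *[of f] by (simp add: R_def)
qed

text \<open>
The map moves \<open>b\<close> to the midpoint of the edge and fixes the other vertices, hence it maps the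
simplex onto the half that contains \<open>a\<close>.
\<close>

lemma half_simplex:
  assumes ab: "a \<in> V" "b \<in> V" "a \<noteq> b"
  shows "\<exists>\<kappa>. \<forall>f. f \<in> borel_measurable borel \<longrightarrow>
    simplex_integral (\<lambda>x. f (x + (l b x / 2) *\<^sub>R (a - b))) = \<kappa> * simplex_integral (\<lambda>x. indicator {x. l b x \<le> l a x} x * f x)"
proof -
  define A where "A = (\<lambda>x. x + (l b x / 2) *\<^sub>R (a - b))"
  obtain cb db where lb: "\<forall>x. l b x = cb \<bullet> x + db" using aff ab by metis
  have "(cb /\<^sub>R 2) \<bullet> (a - b) = (l b a - l b b) / 2"
    by (simp add: lb algebra_simps)
  also have "\<dots> \<noteq> -1" using ab by (simp add: delta)
  finally have "(cb /\<^sub>R 2) \<bullet> (a - b) \<noteq> -1" .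
  have A: "A = (\<lambda>x. x + ((cb /\<^sub>R 2) \<bullet> x + db / 2) *\<^sub>R (a - b))"
    by (simp add: A_def lb add_divide_distrib fun_eq_iff)
  from shear_substitution[OF \<open>(cb /\<^sub>R 2) \<bullet> (a - b) \<noteq> -1\<close>, of "db / 2"] obtain \<kappa> :: real where
    "\<forall>f::'a \<Rightarrow> real. f \<in> borel_measurable borel \<longrightarrow>
      (LINT x|lborel. f (x + ((cb /\<^sub>R 2) \<bullet> x + db / 2) *\<^sub>R (a - b))) = \<kappa> * (LINT x|lborel. f x)" by blast
  then have \<kappa>: "(LINT x|lborel. f (A x)) = \<kappa> * (LINT x|lborel. f x)"
    if "f \<in> borel_measurable borel" for f :: "'a \<Rightarrow> real" using that by (simp only: A)
  have coord: "l k (A x) = (if k = a then l a x + l b x / 2 else if k = b then l b x / 2 else l k x)" if "k \<in> V" for k x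
    using that ab by (auto simp: A_def shift delta)
  have "A x \<in> K \<and> l b (A x) \<le> l a (A x) \<longleftrightarrow> x \<in> K" for x
  proof -
    have la: "l a (A x) = l a x + l b x / 2" and lb: "l b (A x) = l b x / 2" using coord ab by simp_all
    have "(\<forall>k\<in>V - {a, b}. 0 \<le> l k (A x)) = (\<forall>k\<in>V - {a, b}. 0 \<le> l k x)" using coord by simp
    then show ?thesis unfolding mem_simplex_iff_pair[OF ab(1,2)] la lb by linarith
  qed
  then have ind: "indicator K (A x) * indicator {x. l b x \<le> l a x} (A x) = (indicator K x :: real)" for x
    by (auto simp: indicator_def)
  have [measurable]: "{x. l b x \<le> l a x} \<in> sets borel"
    using ab by measurable
  show ?thesis
  proof (intro exI allI impI)
    fix f :: "'a \<Rightarrow> real" assume [measurable]: "f \<in> borel_measurable borel"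
    have "simplex_integral (\<lambda>x. f (A x)) = \<kappa> * simplex_integral (\<lambda>x. indicator {x. l b x \<le> l a x} x * f x)"
      unfolding simplex_integral_def using \<kappa>[of "\<lambda>x. indicator K x * (indicator {x. l b x \<le> l a x} x * f x)"]
      unfolding mult.assoc[symmetric] ind by simp
    then show "simplex_integral (\<lambda>x. f (x + (l b x / 2) *\<^sub>R (a - b))) = \<kappa> * simplex_integral (\<lambda>x. indicator {x. l b x \<le> l a x} x * f x)"
      by (simp only: A_def)
  qed
qed

text \<open>
The two halves are exchanged by the reflection of the edge, so they have equal volume. Each is
the image of the whole simplex, and comparing volumes shows that both factors are 2.
\<close>

lemma simplex_integral_bisect:
  assumes ab: "a \<in> V" "b \<in> V" "a \<noteq> b" and f: "continuous_on UNIV f"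
  shows "simplex_integral f = (simplex_integral (\<lambda>x. f (x + (l b x / 2) *\<^sub>R (a - b))) + simplex_integral (\<lambda>x. f (x + (l a x / 2) *\<^sub>R (b - a)))) / 2"
proof -
  define K1 where "K1 = {x. l b x \<le> l a x}"
  define K2 where "K2 = {x. l a x \<le> l b x}"
  obtain ca da cb db where la: "\<forall>x. l a x = ca \<bullet> x + da" and lb: "\<forall>x. l b x = cb \<bullet> x + db"
    using aff ab by metis
  have [measurable]: "K1 \<in> sets borel" "K2 \<in> sets borel"
    unfolding K1_def K2_def using ab by measurable
  have split: "simplex_integral h = simplex_integral (\<lambda>x. indicator K1 x * h x) + simplex_integral (\<lambda>x. indicator K2 x * h x)"
    if h: "continuous_on UNIV h" for h
  proof -
    have [measurable]: "h \<in> borel_measurable borel" using h by (rule borel_measurable_continuous_onI)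
    have "ca - cb \<noteq> 0"
    proof
      assume "ca - cb = 0"
      then have "l a a - l b a = l a b - l b b" by (simp add: la lb)
      then show False using ab by (simp add: delta)
    qed
    then have "negligible {x. (ca - cb) \<bullet> x = db - da}" by (intro negligible_hyperplane) auto
    then have "AE x in lebesgue. x \<notin> {x. (ca - cb) \<bullet> x = db - da}"
      by (intro AE_not_in) (simp add: negligible_iff_null_sets)
    then have ae: "AE x in lborel. l a x \<noteq> l b x"
      by (simp add: AE_completion_iff la lb algebra_simps)
    have int: "integrable lborel (\<lambda>x. indicator S x * (indicator K x * h x) :: real)" if "S \<in> sets borel" for S
      using integrable_mult_indicator[of S lborel, OF _ integrable_on_simplex[OF h]] that by simp
    have "simplex_integral h = (LINT x|lborel. indicator K1 x * (indicator K x * h x) + indicator K2 x * (indicator K x * h x))"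
      unfolding simplex_integral_def
    proof (rule integral_cong_AE)
      show "AE x in lborel. indicator K x * h x
          = indicator K1 x * (indicator K x * h x) + indicator K2 x * (indicator K x * h x)"
        using ae by eventually_elim (auto simp: indicator_def K1_def K2_def)
    qed measurable
    also have "\<dots> = (LINT x|lborel. indicator K1 x * (indicator K x * h x)) + (LINT x|lborel. indicator K2 x * (indicator K x * h x))"
      by (intro Bochner_Integration.integral_add int) auto
    finally show ?thesis by (simp add: simplex_integral_def ac_simps)
  qed
  obtain \<kappa>1 where \<kappa>1: "\<forall>f. f \<in> borel_measurable borel \<longrightarrow>
    simplex_integral (\<lambda>x. f (x + (l b x / 2) *\<^sub>R (a - b))) = \<kappa>1 * simplex_integral (\<lambda>x. indicator K1 x * f x)"
    using half_simplex[OF ab, folded K1_def] by blast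
  obtain \<kappa>2 where \<kappa>2: "\<forall>f. f \<in> borel_measurable borel \<longrightarrow>
    simplex_integral (\<lambda>x. f (x + (l a x / 2) *\<^sub>R (b - a))) = \<kappa>2 * simplex_integral (\<lambda>x. indicator K2 x * f x)"
    using half_simplex[OF ab(2,1) ab(3)[symmetric], folded K2_def] by blast
  have "simplex_integral (indicator K1) = simplex_integral (\<lambda>x. indicator K1 (x + (l b x - l a x) *\<^sub>R (a - b)))"
    by (rule swap_invariant[OF ab, symmetric]) simp
  also have "(\<lambda>x. indicator K1 (x + (l b x - l a x) *\<^sub>R (a - b))) = (indicator K2 :: _ \<Rightarrow> real)"
    using ab by (auto simp: fun_eq_iff indicator_def K1_def K2_def shift delta)
  finally have same: "simplex_integral (indicator K1) = simplex_integral (indicator K2)" .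
  have "simplex_integral (\<lambda>_. 1) = 2 * simplex_integral (indicator K1)" using split[of "\<lambda>_. 1"] same by simp
  moreover have "simplex_integral (\<lambda>_. 1) = \<kappa>1 * simplex_integral (indicator K1)" "simplex_integral (\<lambda>_. 1) = \<kappa>2 * simplex_integral (indicator K1)"
    using \<kappa>1[rule_format, of "\<lambda>_. 1"] \<kappa>2[rule_format, of "\<lambda>_. 1"] same by simp_all
  ultimately have "\<kappa>1 = 2" "\<kappa>2 = 2" using volume_pos by auto
  then show ?thesis
    using \<kappa>1[rule_format, of f] \<kappa>2[rule_format, of f] split[OF f] borel_measurable_continuous_onI[OF f] by simp
qed

text \<open>
Under the two halving maps the product \<open>l a * l b\<close> becomes \<open>l a * l b / 2 + (l b)\<^sup>2 / 4\<close> and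
\<open>l a * l b / 2 + (l a)\<^sup>2 / 4\<close>. The bisection formula is thus a linear equation for the mixed moment.
\<close>

lemma mixed_moment:
  assumes ab: "a \<in> V" "b \<in> V" "a \<noteq> b"
  shows "simplex_integral (\<lambda>x. l a x * l b x) = (simplex_integral (\<lambda>x. l a x * l a x) + simplex_integral (\<lambda>x. l b x * l b x)) / 4"
proof -
  have c: "continuous_on UNIV (l a)" "continuous_on UNIV (l b)" using ab continuous by auto
  have eq: "(\<lambda>x. l a (x + (l b x / 2) *\<^sub>R (a - b)) * l b (x + (l b x / 2) *\<^sub>R (a - b)))
      = (\<lambda>x. (1/2) * (l a x * l b x) + (1/4) * (l b x * l b x))"
    "(\<lambda>x. l a (x + (l a x / 2) *\<^sub>R (b - a)) * l b (x + (l a x / 2) *\<^sub>R (b - a)))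
      = (\<lambda>x. (1/2) * (l a x * l b x) + (1/4) * (l a x * l a x))"
    using ab by (auto simp: fun_eq_iff shift delta add_divide_distrib distrib_right distrib_left)
  have "simplex_integral (\<lambda>x. l a x * l b x) = (simplex_integral (\<lambda>x. (1/2) * (l a x * l b x) + (1/4) * (l b x * l b x))
     + simplex_integral (\<lambda>x. (1/2) * (l a x * l b x) + (1/4) * (l a x * l a x))) / 2"
    using simplex_integral_bisect[OF ab, of "\<lambda>x. l a x * l b x"] c unfolding eq by (auto intro: continuous_intros)
  also have "\<dots> = ((1/2) * simplex_integral (\<lambda>x. l a x * l b x) + (1/4) * simplex_integral (\<lambda>x. l b x * l b x)
     + ((1/2) * simplex_integral (\<lambda>x. l a x * l b x) + (1/4) * simplex_integral (\<lambda>x. l a x * l a x))) / 2"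
  proof -
    have cc: "continuous_on UNIV (\<lambda>x. r * (l a x * l b x))" "continuous_on UNIV (\<lambda>x. r * (l a x * l a x))"
      "continuous_on UNIV (\<lambda>x. r * (l b x * l b x))" for r
      by (intro continuous_intros c)+
    show ?thesis by (simp only: simplex_integral_add[OF cc(1) cc(2)] simplex_integral_add[OF cc(1) cc(3)] simplex_integral_cmult)
  qed
  finally show ?thesis by (simp add: field_simps)
qed

lemma square_moment:
  assumes ab: "a \<in> V" "b \<in> V"
  shows "simplex_integral (\<lambda>x. l a x * l a x) = simplex_integral (\<lambda>x. l b x * l b x)"
proof (cases "a = b")
  case False
  then show ?thesis
    using swap_invariant[OF ab, of "\<lambda>x. l a x * l a x"] ab
    by (simp add: shift delta)
qed simp

text \<open>
The mass matrix of a simplex is a multiple of the identity plus the all-ones matrix. The volume,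
being the integral of the squared sum of all coordinates, is expressed by the same factor.
\<close>

lemma integral_product:
  "\<exists>\<beta>\<ge>0. simplex_integral (\<lambda>_. 1) = \<beta> * (real (card V) + (real (card V))\<^sup>2) \<and>
    (\<forall>v w. simplex_integral (\<lambda>x. (\<Sum>a\<in>V. v a * l a x) * (\<Sum>a\<in>V. w a * l a x)) = \<beta> * ((\<Sum>a\<in>V. v a * w a) + (\<Sum>a\<in>V. v a) * (\<Sum>a\<in>V. w a)))"
proof -
  have "V \<noteq> {}" using full by auto
  then obtain a0 where a0: "a0 \<in> V" by blast
  \<comment> \<open>All square moments agree, so any vertex serves to define \<open>\<beta>\<close>.\<close>
  define \<beta> where "\<beta> = simplex_integral (\<lambda>x. l a0 x * l a0 x) / 2"
  have "0 \<le> \<beta>" by (auto simp: \<beta>_def simplex_integral_def intro!: integral_nonneg_AE)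
  have m: "simplex_integral (\<lambda>x. l a x * l b x) = \<beta> * ((if a = b then 1 else 0) + 1)" if "a \<in> V" "b \<in> V" for a b
    using that mixed_moment[of a b] square_moment[OF _ a0] by (simp add: \<beta>_def)
  have prod: "simplex_integral (\<lambda>x. (\<Sum>a\<in>V. v a * l a x) * (\<Sum>a\<in>V. w a * l a x)) = \<beta> * ((\<Sum>a\<in>V. v a * w a) + (\<Sum>a\<in>V. v a) * (\<Sum>a\<in>V. w a))" for v w
  proof -
    have "simplex_integral (\<lambda>x. (\<Sum>a\<in>V. v a * l a x) * (\<Sum>a\<in>V. w a * l a x)) = simplex_integral (\<lambda>x. \<Sum>a\<in>V. \<Sum>b\<in>V. (v a * w b) * (l a x * l b x))"
      by (simp add: sum_product ac_simps)
    also have "\<dots> = (\<Sum>a\<in>V. \<Sum>b\<in>V. simplex_integral (\<lambda>x. (v a * w b) * (l a x * l b x)))"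
      by (subst simplex_integral_sum, (intro continuous_intros continuous; assumption), intro sum.cong refl simplex_integral_sum)
         (auto intro!: continuous_intros continuous)
    also have "\<dots> = (\<Sum>a\<in>V. \<Sum>b\<in>V. \<beta> * (if a = b then v a * w b else 0) + \<beta> * (v a * w b))"
      by (intro sum.cong refl) (auto simp: simplex_integral_cmult m algebra_simps)
    also have "\<dots> = (\<Sum>a\<in>V. \<beta> * (v a * w a)) + \<beta> * ((\<Sum>a\<in>V. v a) * (\<Sum>a\<in>V. w a))"
      using fin by (simp add: sum.distrib sum_distrib_left[symmetric] sum_product)
    finally show ?thesis by (simp add: sum_distrib_left[symmetric] distrib_left)
  qed
  moreover have "simplex_integral (\<lambda>_. 1) = \<beta> * (real (card V) + (real (card V))\<^sup>2)"
    using prod[of "\<lambda>_. 1" "\<lambda>_. 1"] by (simp add: coordinates power2_eq_square)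
  ultimately show ?thesis using \<open>0 \<le> \<beta>\<close> by blast
qed

end

section \<open>Sign balance of nodal values\<close>

text \<open>
For positive values \<open>x1, x2\<close> and negative values \<open>-y1, -y2\<close> the right-hand side is the sum of the
nonnegative terms \<open>(x\<^sub>i\<^sup>q - y\<^sub>j\<^sup>q) (x\<^sub>i - y\<^sub>j)\<close> and of products of values with equal sign. If some
\<open>y\<^sub>j\<close> is at most half of the maximum \<open>x1\<close>, the corresponding difference term is large;
otherwise \<open>y1\<^sup>q y2\<close> is.
\<close>

lemma sign_balance_two_two_aux:
  fixes x1 x2 y1 y2 :: real
  assumes nn: "0 \<le> x1" "0 \<le> x2" "0 \<le> y1" "0 \<le> y2" and q: "q \<ge> 1"
    and max: "x2 \<le> x1" "y1 \<le> x1" "y2 \<le> x1"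
  shows "(x1 ^ (q+1) + x2 ^ (q+1) + y1 ^ (q+1) + y2 ^ (q+1)) / 2 ^ (q+3)
    \<le> (x1 ^ (q+1) + x2 ^ (q+1)) + (y1 ^ (q+1) + y2 ^ (q+1)) + ((x1 ^ q + x2 ^ q) - (y1 ^ q + y2 ^ q)) * ((x1 + x2) - (y1 + y2))"
    (is "?l \<le> ?S")
proof -
  have pair: "0 \<le> (x ^ q - y ^ q) * (x - y)" if "0 \<le> x" "0 \<le> y" for x y :: real
  proof (cases "x \<le> y")
    case True
    then show ?thesis using power_mono[of x y q] that by (simp add: mult_nonpos_nonpos)
  next
    case False
    then show ?thesis using power_mono[of y x q] that by simp
  qed
  have far: "(x1/2) ^ (q+1) \<le> (x1 ^ q - y ^ q) * (x1 - y)" if "0 \<le> y" "y \<le> x1/2" for y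
  proof -
    have "y ^ q \<le> (x1/2) ^ q" using that by (intro power_mono)
    moreover have "2 * (x1/2) ^ q \<le> x1 ^ q"
    proof -
      have "(2::real) ^ 1 \<le> 2 ^ q" using q by (intro power_increasing) auto
      then have "2 * (x1/2) ^ q \<le> 2 ^ q * (x1/2) ^ q" using nn(1) by (intro mult_right_mono) auto
      then show ?thesis by (simp add: power_divide)
    qed
    ultimately have "(x1/2) ^ q * (x1/2) \<le> (x1 ^ q - y ^ q) * (x1 - y)"
      using that nn(1) zero_le_power[of "x1/2" q] by (intro mult_mono) linarith+
    then show ?thesis by (simp add: mult.commute)
  qed
  have S: "?S = ((x1 ^ q - y1 ^ q) * (x1 - y1) + (x1 ^ q - y2 ^ q) * (x1 - y2)
      + (x2 ^ q - y1 ^ q) * (x2 - y1) + (x2 ^ q - y2 ^ q) * (x2 - y2))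
      + (x1 ^ q * x2 + x2 ^ q * x1 + y1 ^ q * y2 + y2 ^ q * y1)"
    by (simp add: algebra_simps)
  have nnx: "0 \<le> x1 ^ q * x2" "0 \<le> x2 ^ q * x1" "0 \<le> y1 ^ q * y2" "0 \<le> y2 ^ q * y1"
    using nn by auto
  have "(x1/2) ^ (q+1) \<le> ?S"
  proof (cases "y1 \<le> x1/2 \<or> y2 \<le> x1/2")
    case True
    then show ?thesis
      unfolding S using far[of y1] far[of y2] pair[of x1 y1] pair[of x1 y2] pair[of x2 y1] pair[of x2 y2] nn nnx
      by linarith
  next
    case False
    then have "(x1/2) ^ q * (x1/2) \<le> y1 ^ q * y2"
      using nn by (intro mult_mono power_mono) auto
    then show ?thesis
      unfolding S using pair[of x1 y1] pair[of x1 y2] pair[of x2 y1] pair[of x2 y2] nn nnx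
      unfolding power_add power_one_right by linarith
  qed
  moreover have "?l \<le> (x1/2) ^ (q+1)"
  proof -
    have "x1 ^ (q+1) + x2 ^ (q+1) + y1 ^ (q+1) + y2 ^ (q+1) \<le> 4 * x1 ^ (q+1)"
      using power_mono[OF max(1) nn(2), of "q+1"] power_mono[OF max(2) nn(3), of "q+1"]
        power_mono[OF max(3) nn(4), of "q+1"] by linarith
    then have "?l \<le> 4 * x1 ^ (q+1) / 2 ^ (q+3)" by (intro divide_right_mono) auto
    also have "\<dots> = (x1/2) ^ (q+1)" by (simp add: power_add power_divide)
    finally show ?thesis .
  qed
  ultimately show ?thesis by linarith
qed

lemma sign_balance_two_two:
  fixes x1 x2 y1 y2 :: real
  assumes nn: "0 \<le> x1" "0 \<le> x2" "0 \<le> y1" "0 \<le> y2" and q: "q \<ge> 1"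
  shows "(x1 ^ (q+1) + x2 ^ (q+1) + y1 ^ (q+1) + y2 ^ (q+1)) / 2 ^ (q+3)
    \<le> (x1 ^ (q+1) + x2 ^ (q+1)) + (y1 ^ (q+1) + y2 ^ (q+1)) + ((x1 ^ q + x2 ^ q) - (y1 ^ q + y2 ^ q)) * ((x1 + x2) - (y1 + y2))"
proof -
  consider "x2 \<le> x1 \<and> y1 \<le> x1 \<and> y2 \<le> x1" | "x1 \<le> x2 \<and> y1 \<le> x2 \<and> y2 \<le> x2"
    | "x1 \<le> y1 \<and> x2 \<le> y1 \<and> y2 \<le> y1" | "x1 \<le> y2 \<and> x2 \<le> y2 \<and> y1 \<le> y2" by linarith
  then show ?thesis
  proof cases
    case 1 then show ?thesis using sign_balance_two_two_aux[of x1 x2 y1 y2 q] assms by simp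
  next
    case 2 then show ?thesis using sign_balance_two_two_aux[of x2 x1 y1 y2 q] assms by (simp add: algebra_simps)
  next
    case 3 then show ?thesis using sign_balance_two_two_aux[of y1 y2 x1 x2 q] assms by (simp add: algebra_simps)
  next
    case 4 then show ?thesis using sign_balance_two_two_aux[of y2 y1 x1 x2 q] assms by (simp add: algebra_simps)
  qed
qed

lemma power_tangent:
  fixes a y :: real assumes "0 \<le> a" "0 \<le> y"
  shows "a ^ n + real n * a ^ (n - 1) * (y - a) \<le> y ^ n"
proof (induction n)
  case (Suc n)
  show ?case
  proof (cases n)
    case (Suc m)
    have "(a ^ n + real n * a ^ (n - 1) * (y - a)) * y \<le> y ^ n * y"
      using Suc.IH assms by (intro mult_right_mono) auto
    moreover have "(a ^ n + real n * a ^ (n - 1) * (y - a)) * y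
      = a ^ Suc n + real (Suc n) * a ^ n * (y - a) + real n * a ^ (n - 1) * (y - a)\<^sup>2"
      using Suc by (simp add: algebra_simps power2_eq_square)
    moreover have "0 \<le> real n * a ^ (n - 1) * (y - a)\<^sup>2" using assms by simp
    ultimately show ?thesis by (simp add: mult.commute)
  qed simp
qed simp

lemma power_mean_three:
  fixes y1 y2 y3 :: real
  assumes nn: "0 \<le> y1" "0 \<le> y2" "0 \<le> y3"
  shows "3 * ((y1 + y2 + y3) / 3) ^ n \<le> y1 ^ n + y2 ^ n + y3 ^ n"
proof -
  define a where "a = (y1 + y2 + y3) / 3"
  have a: "0 \<le> a" using nn by (simp add: a_def)
  define k where "k = real n * a ^ (n - 1)"
  have "k * (y1 - a) + k * (y2 - a) + k * (y3 - a) = k * (y1 + y2 + y3 - 3 * a)"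
    by (simp add: algebra_simps)
  also have "\<dots> = 0" by (simp add: a_def)
  finally show ?thesis
    using power_tangent[OF a nn(1), of n] power_tangent[OF a nn(2), of n] power_tangent[OF a nn(3), of n]
    unfolding k_def a_def[symmetric] by linarith
qed

text \<open>
This is the left-hand side of the sign balance with one value \<open>x\<close> and three values \<open>-a\<close>, less a
quarter of the sum of the powers; that quarter is the margin that makes the balance quantitative.
The representation is found by completing squares, starting from the highest power of \<open>x\<close>.
\<close>

lemma balance_sextic_nonneg: fixes x a :: real
  assumes "0 \<le> x" "0 \<le> a"
  shows "0 \<le> (3/4) * (x ^ 6 + 3 * a ^ 6) + (x ^ 5 - 3 * a ^ 5) * (x - 3 * a)"
proof -
  have "(3/4) * (x ^ 6 + 3 * a ^ 6) + (x ^ 5 - 3 * a ^ 5) * (x - 3 * a)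
    = (7/4) * (x ^ 3 - (6/7) * x\<^sup>2 * a - (4/5) * x * a\<^sup>2 - a ^ 3)\<^sup>2
      + a\<^sup>2 * ((3/2) * (x\<^sup>2 + x * a / 3 - 2 * a\<^sup>2)\<^sup>2 + (1/70) * x ^ 4 + x ^ 3 * a / 10
        + a\<^sup>2 * ((13/10 * x - 3/2 * a)\<^sup>2 + (7/300) * x\<^sup>2 + x * a / 10 + (5/4) * a\<^sup>2))"
    by (simp add: eval_nat_numeral algebra_simps)
  also have "\<dots> \<ge> 0" using assms by (intro add_nonneg_nonneg mult_nonneg_nonneg) auto
  finally show ?thesis .
qed


lemma balance_quartic_nonneg: fixes x a :: real
  assumes "0 \<le> x" "0 \<le> a"
  shows "0 \<le> (3/4) * (x ^ 4 + 3 * a ^ 4) + (x ^ 3 - 3 * a ^ 3) * (x - 3 * a)"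
proof -
  have "(3/4) * (x ^ 4 + 3 * a ^ 4) + (x ^ 3 - 3 * a ^ 3) * (x - 3 * a)
    = (7/4) * (x\<^sup>2 - (6/7) * x * a - a\<^sup>2)\<^sup>2
      + a\<^sup>2 * ((x - 3 * a)\<^sup>2 + (17/14) * x\<^sup>2 + a\<^sup>2 / 2)"
    by (simp add: eval_nat_numeral algebra_simps)
  also have "\<dots> \<ge> 0" using assms by (intro add_nonneg_nonneg mult_nonneg_nonneg) auto
  finally show ?thesis .
qed


text \<open>
The product can be negative only if the sums of the \<open>y\<^sub>i\<close> and of their powers lie on different
sides of \<open>x\<close> and \<open>x\<^sup>q\<close>. If \<open>y1 + y2 + y3 \<le> x\<close>, both factors are nonnegative. Otherwise the expression
decreases when the \<open>y\<^sub>i\<close> are replaced by their mean, by convexity of powers, and a polynomial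
inequality in two variables remains. For \<open>x = 1\<close> and equal \<open>y\<^sub>i\<close> slightly below 1 the expression
is negative when \<open>q\<close> is large, so a restriction on \<open>q\<close> is natural here.
\<close>

lemma sign_balance_one_three:
  fixes x y1 y2 y3 :: real
  assumes nn: "0 \<le> x" "0 \<le> y1" "0 \<le> y2" "0 \<le> y3" and q: "q = 3 \<or> q = 5"
  shows "(x ^ (q+1) + y1 ^ (q+1) + y2 ^ (q+1) + y3 ^ (q+1)) / 2 ^ (q+3)
    \<le> x ^ (q+1) + (y1 ^ (q+1) + y2 ^ (q+1) + y3 ^ (q+1)) + (x ^ q - (y1 ^ q + y2 ^ q + y3 ^ q)) * (x - (y1 + y2 + y3))"
proof -
  define a where "a = (y1 + y2 + y3) / 3"
  have a: "0 \<le> a" "y1 + y2 + y3 = 3 * a" using nn by (simp_all add: a_def)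
  define T where "T = x ^ (q+1) + (y1 ^ (q+1) + y2 ^ (q+1) + y3 ^ (q+1))"
  have T0: "0 \<le> T" using nn by (simp add: T_def)
  have pm: "3 * a ^ k \<le> y1 ^ k + y2 ^ k + y3 ^ k" for k
    using power_mean_three[OF nn(2-4), of k] by (simp add: a_def)
  have "0 \<le> (3/4) * T + (x ^ q - (y1 ^ q + y2 ^ q + y3 ^ q)) * (x - 3 * a)"
  proof (cases "3 * a \<le> x")
    case True
    have le: "y ^ q \<le> y * x ^ (q - 1)" if "0 \<le> y" "y \<le> x" for y
    proof -
      have "y * y ^ (q - 1) \<le> y * x ^ (q - 1)" using that by (intro mult_left_mono power_mono) auto
      then show ?thesis using q by (auto simp: eval_nat_numeral)
    qed
    have "y1 ^ q + y2 ^ q + y3 ^ q \<le> y1 * x ^ (q - 1) + y2 * x ^ (q - 1) + y3 * x ^ (q - 1)"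
      using True a(2) nn by (intro add_mono le) linarith+
    also have "\<dots> = (3 * a) * x ^ (q - 1)" unfolding a(2)[symmetric] by (simp only: distrib_right)
    also have "\<dots> \<le> x * x ^ (q - 1)" using True nn by (intro mult_right_mono) auto
    also have "\<dots> = x ^ q" using q by (auto simp: eval_nat_numeral)
    finally show ?thesis using True T0 by simp
  next
    case False
    have "(3/4) * (x ^ (q+1) + 3 * a ^ (q+1)) \<le> (3/4) * T" unfolding T_def using pm[of "q+1"] by simp
    moreover have "(3 * a ^ q - x ^ q) * (3 * a - x) \<le> ((y1 ^ q + y2 ^ q + y3 ^ q) - x ^ q) * (3 * a - x)"
      using False pm[of q] by (intro mult_right_mono) auto
    moreover have "0 \<le> (3/4) * (x ^ (q+1) + 3 * a ^ (q+1)) + (x ^ q - 3 * a ^ q) * (x - 3 * a)"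
      using q
    proof
      assume q: "q = 3"
      show ?thesis using balance_quartic_nonneg[OF nn(1) a(1)] unfolding q by simp
    next
      assume q: "q = 5"
      show ?thesis using balance_sextic_nonneg[OF nn(1) a(1)] unfolding q by simp
    qed
    ultimately show ?thesis by (simp add: algebra_simps)
  qed
  moreover have "T / 2 ^ (q+3) \<le> T / 4"
    using T0 q by (intro divide_left_mono) auto
  ultimately have "T / 2 ^ (q+3) \<le> T + (x ^ q - (y1 ^ q + y2 ^ q + y3 ^ q)) * (x - 3 * a)"
    by linarith
  then show ?thesis unfolding T_def a(2)[symmetric] by (simp only: add.assoc)
qed

text \<open>
Padding with zeros reduces sets with fewer than two elements to the case of exactly two values.
\<close>

lemma power_sums_two:
  fixes f :: "'a \<Rightarrow> real"
  assumes "finite A" "card A \<le> 2" "\<forall>a. 0 \<le> f a"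
  shows "\<exists>x\<ge>0. \<exists>y\<ge>0. \<forall>k>0. (\<Sum>a\<in>A. f a ^ k) = x ^ k + y ^ k"
proof -
  have "card A = 0 \<or> card A = 1 \<or> card A = 2" using assms(2) by linarith
  then consider "A = {}" | a where "A = {a}" | a b where "A = {a, b}" "a \<noteq> b"
    using assms(1) unfolding One_nat_def card_1_singleton_iff card_2_iff card_0_eq[OF assms(1)] by blast
  then show ?thesis
  proof cases
    case 1
    then have "\<forall>k>0. (\<Sum>a\<in>A. f a ^ k) = 0 ^ k + 0 ^ k" by (simp add: power_0_left)
    then show ?thesis by blast
  next
    case (2 a)
    then have "\<forall>k>0. (\<Sum>a\<in>A. f a ^ k) = f a ^ k + 0 ^ k" by (simp add: power_0_left)
    then show ?thesis using assms(3) by blast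
  next
    case (3 a b)
    then have "\<forall>k>0. (\<Sum>a\<in>A. f a ^ k) = f a ^ k + f b ^ k" by simp
    then show ?thesis using assms(3) by blast
  qed
qed

text \<open>
The inequality is invariant under changing all signs, so only the sizes of the sets of
nonnegative and of negative values matter. With at most three values, neither set exceeds two
elements unless the other one is empty.
\<close>

lemma sign_balance:
  fixes v :: "'a \<Rightarrow> real"
  assumes fin: "finite V" and q: "odd q" and card: "card V \<le> 3 \<or> card V = 4 \<and> q \<in> {3, 5}"
  shows "(\<Sum>a\<in>V. v a ^ (q+1)) / 2 ^ (q+3) \<le> (\<Sum>a\<in>V. v a ^ (q+1)) + (\<Sum>a\<in>V. v a ^ q) * (\<Sum>a\<in>V. v a)"
proof -
  define P where "P = {a \<in> V. 0 \<le> v a}"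
  define N where "N = {a \<in> V. v a < 0}"
  define f where "f = (\<lambda>a. \<bar>v a\<bar>)"
  define X where "X = (\<lambda>k. \<Sum>a\<in>P. f a ^ k)"
  define Y where "Y = (\<lambda>k. \<Sum>a\<in>N. f a ^ k)"
  have finPN: "finite P" "finite N" and V: "V = P \<union> N" "P \<inter> N = {}"
    using fin by (auto simp: P_def N_def)
  have cardPN: "card P + card N = card V" using card_Un_disjoint[OF finPN V(2)] V(1) by simp
  have f0: "0 \<le> f a" for a by (simp add: f_def)
  have even: "(\<Sum>a\<in>V. v a ^ (q+1)) = X (q+1) + Y (q+1)"
    unfolding V(1) sum.union_disjoint[OF finPN V(2)] X_def Y_def f_def
    using q by (simp add: power_even_abs del: power_Suc)
  have odd: "(\<Sum>a\<in>V. v a ^ k) = X k - Y k" if "odd k" for k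
  proof -
    have "(\<Sum>a\<in>N. v a ^ k) = - Y k"
      unfolding Y_def f_def sum_negf[symmetric] using that by (intro sum.cong) (auto simp: N_def power_minus_odd)
    moreover have "(\<Sum>a\<in>P. v a ^ k) = X k"
      unfolding X_def f_def by (intro sum.cong) (auto simp: P_def)
    ultimately show ?thesis unfolding V(1) sum.union_disjoint[OF finPN V(2)] by simp
  qed
  have lin: "(\<Sum>a\<in>V. v a) = X 1 - Y 1" using odd[of 1] by simp
  have XY0: "0 \<le> X k" "0 \<le> Y k" for k unfolding X_def Y_def by (auto intro!: sum_nonneg simp: f0)
  have q1: "q \<ge> 1" using q by (cases q) auto
  have trivial: ?thesis if "X = (\<lambda>_. 0) \<or> Y = (\<lambda>_. 0)"
  proof -
    have "(X (q+1) + Y (q+1)) / 2 ^ (q+3) \<le> (X (q+1) + Y (q+1)) / 1"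
      using XY0[of "q+1"] by (intro divide_left_mono) auto
    moreover have "0 \<le> (X q - Y q) * (X 1 - Y 1)"
      using that XY0[of q] XY0[of 1] by (auto simp: mult_nonneg_nonneg mult_nonpos_nonpos)
    ultimately show ?thesis unfolding even odd[OF q] lin by simp
  qed
  have three: "\<exists>y1 y2 y3. 0 \<le> y1 \<and> 0 \<le> y2 \<and> 0 \<le> y3 \<and> (\<forall>k. (\<Sum>a\<in>A. f a ^ k) = y1 ^ k + y2 ^ k + y3 ^ k)"
    if card3: "card A = 3" for A
  proof -
    obtain a b c where "A = {a, b, c}" "a \<noteq> b" "b \<noteq> c" "a \<noteq> c"
      using card3 unfolding card_3_iff by blast
    then have "0 \<le> f a \<and> 0 \<le> f b \<and> 0 \<le> f c \<and> (\<forall>k. (\<Sum>a\<in>A. f a ^ k) = f a ^ k + f b ^ k + f c ^ k)"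
      by (simp add: f0)
    then show ?thesis by blast
  qed
  consider "card P = 0" | "card N = 0" | "card P \<le> 2" "card N \<le> 2"
    | "card P = 1" "card N = 3" "q = 3 \<or> q = 5" | "card P = 3" "card N = 1" "q = 3 \<or> q = 5"
  proof -
    have "card P + card N \<le> 3 \<or> card P + card N = 4 \<and> (q = 3 \<or> q = 5)" using card cardPN by auto
    then have "card P = 0 \<or> card N = 0 \<or> card P \<le> 2 \<and> card N \<le> 2
      \<or> card P = 1 \<and> card N = 3 \<and> (q = 3 \<or> q = 5) \<or> card P = 3 \<and> card N = 1 \<and> (q = 3 \<or> q = 5)"
      by linarith
    then show thesis using that by blast
  qed
  then show ?thesis
  proof cases
    case 1 then show ?thesis using trivial finPN by (simp add: X_def)
  next
    case 2 then show ?thesis using trivial finPN by (simp add: Y_def)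
  next
    case 3
    obtain x1 x2 where x: "0 \<le> x1" "0 \<le> x2" "\<forall>k>0. X k = x1 ^ k + x2 ^ k"
    proof -
      have "\<exists>x1\<ge>0. \<exists>x2\<ge>0. \<forall>k>0. X k = x1 ^ k + x2 ^ k"
        unfolding X_def using finPN(1) 3(1) by (rule power_sums_two) (simp add: f0)
      then show thesis using that by blast
    qed
    obtain y1 y2 where y: "0 \<le> y1" "0 \<le> y2" "\<forall>k>0. Y k = y1 ^ k + y2 ^ k"
    proof -
      have "\<exists>y1\<ge>0. \<exists>y2\<ge>0. \<forall>k>0. Y k = y1 ^ k + y2 ^ k"
        unfolding Y_def using finPN(2) 3(2) by (rule power_sums_two) (simp add: f0)
      then show thesis using that by blast
    qed
    show ?thesis unfolding even odd[OF q] lin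
      using sign_balance_two_two[OF x(1,2) y(1,2) q1] q1 by (simp add: x(3) y(3) add.assoc)
  next
    case 4
    obtain p where "P = {p}" using 4(1) by (auto simp: card_1_singleton_iff)
    then have x: "X k = f p ^ k" for k by (simp add: X_def)
    obtain y1 y2 y3 where y: "0 \<le> y1" "0 \<le> y2" "0 \<le> y3" "\<forall>k. Y k = y1 ^ k + y2 ^ k + y3 ^ k"
      using three[OF 4(2)] unfolding Y_def by blast
    show ?thesis unfolding even odd[OF q] lin
      using sign_balance_one_three[OF f0[of p] y(1-3) 4(3)] by (simp add: x y(4) add.assoc)
  next
    case 5
    obtain p where "N = {p}" using 5(2) by (auto simp: card_1_singleton_iff)
    then have x: "Y k = f p ^ k" for k by (simp add: Y_def)
    obtain y1 y2 y3 where y: "0 \<le> y1" "0 \<le> y2" "0 \<le> y3" "\<forall>k. X k = y1 ^ k + y2 ^ k + y3 ^ k"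
      using three[OF 5(1)] unfolding X_def by blast
    have comm: "(X q - Y q) * (X 1 - Y 1) = (Y q - X q) * (Y 1 - X 1)" by (simp add: algebra_simps)
    show ?thesis unfolding even odd[OF q] lin comm
      using sign_balance_one_three[OF f0[of p] y(1-3) 5(3)] by (simp add: x y(4) add_ac)
  qed
qed

section \<open>Nodal interpolation and the mass-lumped nonlinearity\<close>

lemma simplex_barycentric_coordinates:
  fixes K :: "'a::euclidean_space set"
  assumes "int DIM('a) simplex K"
  shows "convex hull (vertices K) = K" "card (vertices K) = DIM('a) + 1"
    "\<exists>l. barycentric_coordinates (vertices K) l"
proof -
  obtain C where C: "\<not> affine_dependent C" "int (card C) = int DIM('a) + 1" "K = convex hull C"
    using assms by (auto simp: simplex)
  have V: "vertices K = C"
    using extreme_point_of_convex_hull_affine_independent[OF C(1)] by (auto simp: vertices_def C(3))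
  show "convex hull (vertices K) = K" unfolding V by (rule C(3)[symmetric])
  show "card (vertices K) = DIM('a) + 1" using C(2) by (simp add: V)
  have "\<forall>a. \<exists>c d. \<forall>b\<in>C. c \<bullet> b + d = (if a = b then 1 else 0)"
    by (intro allI affine_function_interpolates[OF C(1)])
  then obtain c d where cd: "\<forall>a. \<forall>b\<in>C. c a \<bullet> b + d a = (if a = b then 1 else 0)" by metis
  have "aff_dim C = int DIM('a)" using aff_dim_affine_independent[OF C(1)] C(2) by simp
  then have "affine hull C = UNIV" by (simp add: aff_dim_eq_full)
  then have "barycentric_coordinates C (\<lambda>a x. c a \<bullet> x + d a)"
    by unfold_locales (use cd aff_independent_finite[OF C(1)] in auto)
  then show "\<exists>l. barycentric_coordinates (vertices K) l" unfolding V by blast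
qed

context
  fixes D :: "'a::euclidean_space set" and \<T> :: "'a set set"
  assumes mesh: "mesh_of D \<T>"
begin

lemma mesh_finite: "finite \<T>" and mesh_Union: "\<Union>\<T> = closure D"
  and mesh_simplex: "K \<in> \<T> \<Longrightarrow> int DIM('a) simplex K"
  and mesh_face: "K \<in> \<T> \<Longrightarrow> K' \<in> \<T> \<Longrightarrow> (K \<inter> K') face_of K"
  using mesh by (auto simp: mesh_of_def triangulation_def)

lemma nodes_in_closure: "a \<in> nodes \<T> \<Longrightarrow> a \<in> closure D"
  unfolding nodes_def vertices_def mesh_Union[symmetric] extreme_point_of_def by blast

lemma finite_nodes: "finite (nodes \<T>)"
  unfolding nodes_def
proof (rule finite_UN_I[OF mesh_finite])
  fix K assume "K \<in> \<T>"
  from simplex_barycentric_coordinates(2)[OF mesh_simplex[OF this]]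
  show "finite (vertices K)" by (metis Suc_eq_plus1 card.infinite nat.distinct(1))
qed

lemma affine_agree_on_simplex:
  assumes K: "K \<in> \<T>" and x: "x \<in> K" and "\<And>a. a \<in> vertices K \<Longrightarrow> c \<bullet> a + d = c' \<bullet> a + (d'::real)"
  shows "c \<bullet> x + d = c' \<bullet> x + d'"
proof -
  have "convex {x. (c - c') \<bullet> x = d' - d}" by (rule convex_hyperplane)
  then have "convex hull (vertices K) \<subseteq> {x. (c - c') \<bullet> x = d' - d}"
    by (intro hull_minimal) (use assms(3) in \<open>auto simp: inner_diff_left algebra_simps\<close>)
  then have "(c - c') \<bullet> x = d' - d"
    using x simplex_barycentric_coordinates(1)[OF mesh_simplex[OF K]] by auto
  then show ?thesis by (simp add: inner_diff_left algebra_simps)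
qed

lemma piecewise_affine_eqI:
  assumes "piecewise_affine \<T> v" "piecewise_affine \<T> w"
    and "\<And>a. a \<in> nodes \<T> \<Longrightarrow> v a = w a" and "x \<in> closure D"
  shows "v x = w x"
proof -
  obtain K where K: "K \<in> \<T>" "x \<in> K" using assms(4) mesh_Union by blast
  obtain c d where v: "\<forall>x\<in>K. v x = c \<bullet> x + d" using assms(1) K(1) unfolding piecewise_affine_def by blast
  obtain c' d' where w: "\<forall>x\<in>K. w x = c' \<bullet> x + d'" using assms(2) K(1) unfolding piecewise_affine_def by blast
  have "c \<bullet> a + d = c' \<bullet> a + d'" if a: "a \<in> vertices K" for a
  proof -
    have "a \<in> K" "a \<in> nodes \<T>" using a K(1) by (auto simp: vertices_def extreme_point_of_def nodes_def)
    then show ?thesis using v w assms(3)[of a] by simp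
  qed
  then show ?thesis using affine_agree_on_simplex[OF K, of c d c' d'] v w K(2) by simp
qed

text \<open>
On each simplex the vertex values determine an affine function. The pieces agree on
intersections: such an intersection is a face of both simplices, hence the convex hull of
extreme points that are vertices of both.
\<close>

lemma nodal_interpolation_exists:
  "\<exists>v. piecewise_affine \<T> v \<and> (\<forall>a\<in>nodes \<T>. v a = f a)"
proof -
  have "\<forall>K\<in>\<T>. \<exists>c d. \<forall>a\<in>vertices K. c \<bullet> a + d = f a"
  proof
    fix K assume K: "K \<in> \<T>"
    obtain C where C: "\<not> affine_dependent C" "K = convex hull C"
      using mesh_simplex[OF K] by (auto simp: simplex)
    have "vertices K = C"
      using extreme_point_of_convex_hull_affine_independent[OF C(1)] by (auto simp: vertices_def C(2))
    then show "\<exists>c d. \<forall>a\<in>vertices K. c \<bullet> a + d = f a"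
      by (simp only: affine_function_interpolates[OF C(1)])
  qed
  then obtain c d where cd: "\<forall>K\<in>\<T>. \<forall>a\<in>vertices K. c K \<bullet> a + d K = f a" by metis
  have agree: "c K \<bullet> x + d K = c K' \<bullet> x + d K'"
    if K: "K \<in> \<T>" "x \<in> K" "K' \<in> \<T>" "x \<in> K'" for K K' x
  proof -
    let ?F = "K \<inter> K'"
    have F: "?F face_of K" "?F face_of K'" using mesh_face[OF K(1,3)] mesh_face[OF K(3,1)] by (auto simp: Int_commute)
    have "compact ?F" "convex ?F"
      using compact_simplex[OF mesh_simplex] convex_simplex[OF mesh_simplex] K(1,3)
      by (auto intro: compact_Int convex_Int)
    then have "?F = convex hull {a. a extreme_point_of ?F}" by (rule Krein_Milman_Minkowski)
    moreover have "{a. a extreme_point_of ?F} \<subseteq> {x. (c K - c K') \<bullet> x = d K' - d K}"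
    proof
      fix a assume "a \<in> {a. a extreme_point_of ?F}"
      then have "a \<in> vertices K" "a \<in> vertices K'"
        using extreme_point_of_face[OF F(1)] extreme_point_of_face[OF F(2)] by (auto simp: vertices_def)
      then have "c K \<bullet> a + d K = f a" "c K' \<bullet> a + d K' = f a" using cd K(1,3) by auto
      then show "a \<in> {x. (c K - c K') \<bullet> x = d K' - d K}" by (simp add: inner_diff_left)
    qed
    then have "convex hull {a. a extreme_point_of ?F} \<subseteq> {x. (c K - c K') \<bullet> x = d K' - d K}"
      by (intro hull_minimal convex_hyperplane)
    ultimately have "(c K - c K') \<bullet> x = d K' - d K" using K(2,4) by blast
    then show ?thesis by (simp add: inner_diff_left)
  qed
  define S where "S = (\<lambda>x. SOME K. K \<in> \<T> \<and> x \<in> K)"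
  define v where "v = (\<lambda>x. c (S x) \<bullet> x + d (S x))"
  have v: "v x = c K \<bullet> x + d K" if "K \<in> \<T>" "x \<in> K" for K x
  proof -
    have "S x \<in> \<T> \<and> x \<in> S x" unfolding S_def using that by (intro someI[of "\<lambda>K. K \<in> \<T> \<and> x \<in> K"]) blast
    then show ?thesis using agree[of "S x" x K] that by (simp add: v_def)
  qed
  then have "piecewise_affine \<T> v" unfolding piecewise_affine_def by blast
  moreover have "v a = f a" if "a \<in> nodes \<T>" for a
  proof -
    obtain K where "K \<in> \<T>" "a \<in> vertices K" using \<open>a \<in> nodes \<T>\<close> by (auto simp: nodes_def)
    moreover from this have "a \<in> K" by (auto simp: vertices_def extreme_point_of_def)
    ultimately show ?thesis using v[of K a] cd by simp
  qed
  ultimately show ?thesis by blast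
qed

lemma piecewise_affine_continuous:
  assumes "piecewise_affine \<T> v"
  shows "continuous_on (closure D) v"
proof -
  have "continuous_on (\<Union>K\<in>\<T>. K) v"
  proof (rule continuous_on_closed_Union[OF mesh_finite])
    fix K assume K: "K \<in> \<T>"
    show "closed K" by (rule closed_simplex[OF mesh_simplex[OF K]])
    obtain c d where v: "\<forall>x\<in>K. v x = c \<bullet> x + d" using assms K unfolding piecewise_affine_def by blast
    have "continuous_on K (\<lambda>x. c \<bullet> x + d)" by (intro continuous_intros)
    then show "continuous_on K v" using v by (simp cong: continuous_on_cong)
  qed
  then show ?thesis using mesh_Union by simp
qed

text \<open>
A common face of two different simplices is a proper face of at least one of them and so has
lower dimension.
\<close>

lemma negligible_overlap:
  assumes "K \<in> \<T>" "K' \<in> \<T>" "K \<noteq> K'"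
  shows "negligible (K \<inter> K')"
proof -
  have F: "(K \<inter> K') face_of K" "(K \<inter> K') face_of K'"
    using mesh_face[OF assms(1,2)] mesh_face[OF assms(2,1)] by (auto simp: Int_commute)
  have convex: "convex K" "convex K'" using assms convex_simplex[OF mesh_simplex] by auto
  have dim: "aff_dim K = int DIM('a)" "aff_dim K' = int DIM('a)"
    using aff_dim_simplex[OF mesh_simplex[OF assms(1)]] aff_dim_simplex[OF mesh_simplex[OF assms(2)]] by auto
  have "K \<inter> K' \<noteq> K \<or> K \<inter> K' \<noteq> K'" using assms(3) by blast
  then have "aff_dim (K \<inter> K') < int DIM('a)"
    using face_of_aff_dim_lt[OF convex(1) F(1)] face_of_aff_dim_lt[OF convex(2) F(2)] dim by auto
  then have "interior (K \<inter> K') = {}" using aff_dim_nonempty_interior[of "K \<inter> K'"] by auto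
  then show ?thesis using negligible_convex_interior[OF convex_Int[OF convex]] by simp
qed

text \<open>
Almost every point of the domain lies in exactly one simplex of the mesh.
\<close>

lemma integral_over_mesh:
  assumes D: "open D" "convex D" and f: "continuous_on (closure D) (f :: 'a \<Rightarrow> real)"
  shows "(LINT x|lebesgue_on D. f x) = (\<Sum>K\<in>\<T>. LINT x|lborel. indicator K x * f x)"
proof -
  have int: "integrable lborel (\<lambda>x. indicator K x * f x)" if "K \<in> \<T>" for K
  proof -
    have "K \<subseteq> closure D" using mesh_Union that by blast
    then have "continuous_on K f" using f continuous_on_subset by blast
    from borel_integrable_compact[OF compact_simplex[OF mesh_simplex[OF that]] this]
    show ?thesis by (simp add: indicator_def if_distrib cong: if_cong)
  qed
  have [measurable]: "(\<lambda>x. indicator D x * f x) \<in> borel_measurable borel"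
    using borel_measurable_continuous_on_indicator[of D f] D(1) continuous_on_subset[OF f closure_subset]
    by simp
  have "(LINT x|lebesgue_on D. f x) = (LINT x|lebesgue. indicator D x * f x)"
    using D(1) by (simp add: integral_restrict_space)
  also have "\<dots> = (LINT x|lborel. indicator D x * f x)"
    by (rule integral_completion) simp
  also have "\<dots> = (LINT x|lborel. (\<Sum>K\<in>\<T>. indicator K x * f x))"
  proof (rule integral_cong_AE)
    define Z where "Z = frontier D \<union> (\<Union>K\<in>\<T>. \<Union>K'\<in>\<T> - {K}. K \<inter> K')"
    have "negligible (\<Union>K'\<in>\<T> - {K}. K \<inter> K')" if "K \<in> \<T>" for K
    proof (rule negligible_Union)
      fix S assume "S \<in> (\<lambda>K'. K \<inter> K') ` (\<T> - {K})"
      then show "negligible S" by (auto intro!: negligible_overlap[OF that])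
    qed (simp add: mesh_finite)
    then have "negligible (\<Union>K\<in>\<T>. \<Union>K'\<in>\<T> - {K}. K \<inter> K')"
    proof (intro negligible_Union)
      fix S assume "S \<in> (\<lambda>K. \<Union>K'\<in>\<T> - {K}. K \<inter> K') ` \<T>"
      then obtain K where "K \<in> \<T>" "S = (\<Union>K'\<in>\<T> - {K}. K \<inter> K')" by blast
      then show "negligible S"
        using \<open>\<And>K. K \<in> \<T> \<Longrightarrow> negligible (\<Union>K'\<in>\<T> - {K}. K \<inter> K')\<close> by simp
    qed (simp add: mesh_finite)
    then have "negligible Z"
      unfolding Z_def by (intro negligible_Un negligible_convex_frontier[OF D(2)])
    then have "AE x in lebesgue. x \<notin> Z" by (intro AE_not_in) (simp add: negligible_iff_null_sets)
    then have "AE x in lborel. x \<notin> Z" by (simp add: AE_completion_iff)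
    then show "AE x in lborel. indicator D x * f x = (\<Sum>K\<in>\<T>. indicator K x * f x)"
    proof eventually_elim
      case (elim x)
      show ?case
      proof (cases "x \<in> D")
        case True
        then obtain K where K: "K \<in> \<T>" "x \<in> K" using mesh_Union closure_subset by blast
        have "x \<notin> K'" if "K' \<in> \<T>" "K' \<noteq> K" for K'
          using elim K that unfolding Z_def by blast
        then have "indicator K' x * f x = (if K' = K then f x else 0)" if "K' \<in> \<T>" for K'
          using K(2) that by (cases "K' = K") simp_all
        then show ?thesis using True mesh_finite K(1) by simp
      next
        case False
        then have "x \<notin> closure D" using elim D(1) by (auto simp: Z_def frontier_def interior_open)
        then have "\<forall>K\<in>\<T>. x \<notin> K" using mesh_Union by blast
        then show ?thesis using False by simp
      qed
    qed
    show "(\<lambda>x. \<Sum>K\<in>\<T>. indicator K x * f x) \<in> borel_measurable lborel"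
      using int by (intro borel_measurable_sum) auto
  qed simp
  also have "\<dots> = (\<Sum>K\<in>\<T>. LINT x|lborel. indicator K x * f x)"
    by (intro Bochner_Integration.integral_sum int)
  finally show ?thesis .
qed

end

text \<open>
The integral of \<open>w * u\<close> is evaluated with the mass matrix and bounded below by the sign balance,
while \<open>|u|\<^sup>q\<^sup>+\<^sup>1\<close> is at most the sum of its values at the vertices. The number 20 is
\<open>n + n\<^sup>2\<close> for \<open>n = 4\<close>, the ratio of the volume to the factor of the mass matrix of a tetrahedron;
for a triangle the ratio is 12.
\<close>

lemma simplex_coercivity:
  fixes K :: "'a::euclidean_space set"
  assumes K: "int DIM('a) simplex K" and q: "odd q"
    and dim: "DIM('a) = 2 \<or> DIM('a) = 3 \<and> q \<in> {3, 5}"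
    and u: "\<forall>x\<in>K. u x = c \<bullet> x + d" and w: "\<forall>x\<in>K. w x = c' \<bullet> x + d'"
    and wu: "\<And>a. a \<in> vertices K \<Longrightarrow> w a = u a ^ q"
  shows "(LINT x|lborel. indicator K x * \<bar>u x\<bar> ^ (q+1)) \<le> 20 * 2 ^ (q+3) * (LINT x|lborel. indicator K x * (w x * u x))"
proof -
  obtain l where "barycentric_coordinates (vertices K) l"
    using simplex_barycentric_coordinates(3)[OF K] by blast
  then interpret barycentric_coordinates "vertices K" l .
  define V where "V = vertices K"
  have hull: "convex hull V = K" and card: "card V = DIM('a) + 1"
    using simplex_barycentric_coordinates[OF K] by (auto simp: V_def)
  have finV: "finite V" using fin by (simp add: V_def)
  obtain \<beta> where \<beta>: "\<beta> \<ge> 0" "simplex_integral (\<lambda>_. 1) = \<beta> * (real (card V) + (real (card V))\<^sup>2)"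
    "\<And>v w. simplex_integral (\<lambda>x. (\<Sum>a\<in>V. v a * l a x) * (\<Sum>a\<in>V. w a * l a x)) = \<beta> * ((\<Sum>a\<in>V. v a * w a) + (\<Sum>a\<in>V. v a) * (\<Sum>a\<in>V. w a))"
    using integral_product unfolding V_def[symmetric] by blast
  have u': "u x = (\<Sum>a\<in>V. u a * l a x)" and w': "w x = (\<Sum>a\<in>V. w a * l a x)" if "x \<in> K" for x
    using affine_eq_sum[of u c d x] affine_eq_sum[of w c' d' x] u w that hull by (auto simp: V_def)
  define E where "E = (\<Sum>a\<in>V. u a ^ (q+1))"
  have even: "even (q+1)" using q by simp
  have E0: "0 \<le> E" unfolding E_def by (intro sum_nonneg zero_le_even_power even)
  have "(LINT x|lborel. indicator K x * (w x * u x)) = simplex_integral (\<lambda>x. (\<Sum>a\<in>V. w a * l a x) * (\<Sum>a\<in>V. u a * l a x))"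
    unfolding simplex_integral_def unfolding V_def[symmetric] hull
    by (intro Bochner_Integration.integral_cong refl) (auto simp: indicator_def u' w')
  also have "\<dots> = \<beta> * ((\<Sum>a\<in>V. u a ^ q * u a) + (\<Sum>a\<in>V. u a ^ q) * (\<Sum>a\<in>V. u a))"
    unfolding \<beta>(3) using wu by (simp add: V_def)
  also have "(\<Sum>a\<in>V. u a ^ q * u a) = E" by (simp add: E_def mult.commute)
  also have "\<beta> * (E + (\<Sum>a\<in>V. u a ^ q) * (\<Sum>a\<in>V. u a)) \<ge> \<beta> * (E / 2 ^ (q+3))"
    unfolding E_def using card dim by (intro mult_left_mono sign_balance[OF finV q] \<beta>(1)) auto
  finally have 1: "\<beta> * E \<le> 2 ^ (q+3) * (LINT x|lborel. indicator K x * (w x * u x))"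
    by (simp add: field_simps)
  have bound: "\<bar>u x\<bar> ^ (q+1) \<le> E" if x: "x \<in> K" for x
  proof -
    define m where "m = Max ((\<lambda>a. \<bar>u a\<bar>) ` V)"
    have "V \<noteq> {}" using card by auto
    then have "m \<in> (\<lambda>a. \<bar>u a\<bar>) ` V" unfolding m_def using finV by (intro Max_in) auto
    then obtain a where a: "a \<in> V" "m = \<bar>u a\<bar>" by blast
    have "\<bar>(\<Sum>a\<in>V. u a * l a x) - 0\<bar> \<le> m"
    proof (rule convex_sum_bound_le)
      show "\<And>a. a \<in> V \<Longrightarrow> 0 \<le> l a x" using x mem_simplex_iff hull by (auto simp: V_def)
      show "(\<Sum>a\<in>V. l a x) = 1" using coordinates by (simp add: V_def)
      show "\<And>a. a \<in> V \<Longrightarrow> \<bar>u a - 0\<bar> \<le> m" unfolding m_def using finV by (intro Max_ge) auto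
    qed
    then have "\<bar>u x\<bar> ^ (q+1) \<le> \<bar>u a\<bar> ^ (q+1)" using u'[OF x] a(2) by (intro power_mono) auto
    also have "\<dots> = u a ^ (q+1)" using even by (rule power_even_abs)
    also have "\<dots> \<le> E" unfolding E_def by (rule member_le_sum[OF a(1) zero_le_even_power[OF even] finV])
    finally show ?thesis .
  qed
  have "compact K" using compact_simplex hull by (simp add: V_def)
  moreover have "continuous_on K (\<lambda>x. \<bar>c \<bullet> x + d\<bar> ^ (q+1))" by (intro continuous_intros)
  then have "continuous_on K (\<lambda>x. \<bar>u x\<bar> ^ (q+1))" using u by (simp cong: continuous_on_cong)
  ultimately have int: "integrable lborel (\<lambda>x. indicator K x * \<bar>u x\<bar> ^ (q+1))"
    using borel_integrable_compact[of K "\<lambda>x. \<bar>u x\<bar> ^ (q+1)"] by (simp add: indicator_def if_distrib cong: if_cong)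
  have "(LINT x|lborel. indicator K x * \<bar>u x\<bar> ^ (q+1)) \<le> simplex_integral (\<lambda>_. E)"
    unfolding simplex_integral_def unfolding V_def[symmetric] hull
    by (rule integral_mono[OF int]) 
      (use bound integrable_on_simplex[of "\<lambda>_. E"] hull in \<open>auto simp: indicator_def V_def\<close>)
  also have "simplex_integral (\<lambda>_. E) = E * simplex_integral (\<lambda>_. 1)" using simplex_integral_cmult[of E "\<lambda>_. 1"] by simp
  also have "\<dots> \<le> E * (\<beta> * 20)"
    unfolding \<beta>(2) using E0 \<beta>(1) card dim
    by (intro mult_left_mono) (auto simp: power2_eq_square)
  also have "E * (\<beta> * 20) = 20 * (\<beta> * E)" by (simp only: ac_simps)
  also have "\<dots> \<le> 20 * (2 ^ (q+3) * (LINT x|lborel. indicator K x * (w x * u x)))"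
    using 1 by (rule mult_left_mono) simp
  finally show ?thesis by (simp only: mult.assoc)
qed

text \<open>
The nodal interpolant of \<open>u - u\<^sup>q\<close> is \<open>u\<close> minus the piecewise affine function with nodal values
\<open>u\<^sup>q\<close>. The nodes on the boundary are consistent with this because \<open>u\<close> vanishes there.
\<close>

lemma lumped_nonlinearity_coercive:
  fixes D :: "'a::euclidean_space set"
  assumes mesh: "mesh_of D \<T>" and D: "open D" "convex D" and q: "odd q"
    and dim: "DIM('a) = 2 \<or> DIM('a) = 3 \<and> q \<in> {3, 5}"
    and u: "piecewise_affine \<T> u" "\<And>x. x \<in> frontier D \<Longrightarrow> u x = 0"
  defines "I \<equiv> nodal_interpolant D \<T> (\<lambda>x. u x - u x ^ q)"
  shows "piecewise_affine \<T> I"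
    "(LINT x|lebesgue_on D. \<bar>u x\<bar> ^ (q+1)) \<le> 20 * 2 ^ (q+3) * (LINT x|lebesgue_on D. (u x - I x) * u x)"
proof -
  have "piecewise_affine \<T> I \<and> (\<forall>a\<in>nodes \<T>. I a = (if a \<in> D then u a - u a ^ q else 0))"
    unfolding I_def nodal_interpolant_def
    by (rule someI_ex[OF nodal_interpolation_exists[OF mesh, of "\<lambda>a. if a \<in> D then u a - u a ^ q else 0"]])
  then have I: "piecewise_affine \<T> I" "\<And>a. a \<in> nodes \<T> \<Longrightarrow> I a = (if a \<in> D then u a - u a ^ q else 0)"
    by auto
  show "piecewise_affine \<T> I" by (fact I(1))
  define w where "w = (\<lambda>x. u x - I x)"
  have w_node: "w a = u a ^ q" if "a \<in> nodes \<T>" for a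
  proof (cases "a \<in> D")
    case False
    then have "a \<in> frontier D"
      using nodes_in_closure[OF mesh that] D(1) by (auto simp: frontier_def interior_open)
    then show ?thesis using False I(2)[OF that] u(2) q by (auto simp: w_def zero_power odd_pos)
  qed (use I(2)[OF that] in \<open>simp add: w_def\<close>)
  have w: "piecewise_affine \<T> w"
    unfolding piecewise_affine_def
  proof
    fix K assume "K \<in> \<T>"
    then have "\<exists>c d. \<forall>x\<in>K. u x = c \<bullet> x + d" "\<exists>c d. \<forall>x\<in>K. I x = c \<bullet> x + d"
      using u(1) I(1) by (auto simp: piecewise_affine_def)
    then obtain c d c' d' where "\<forall>x\<in>K. u x = c \<bullet> x + d" "\<forall>x\<in>K. I x = c' \<bullet> x + d'" by metis
    then have "\<forall>x\<in>K. w x = (c - c') \<bullet> x + (d - d')" by (simp add: w_def inner_diff_left)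
    then show "\<exists>c d. \<forall>x\<in>K. w x = c \<bullet> x + d" by blast
  qed
  have cont: "continuous_on (closure D) u" "continuous_on (closure D) w"
    using u(1) w by (auto intro: piecewise_affine_continuous[OF mesh])
  have "(LINT x|lebesgue_on D. \<bar>u x\<bar> ^ (q+1)) = (\<Sum>K\<in>\<T>. LINT x|lborel. indicator K x * \<bar>u x\<bar> ^ (q+1))"
    by (intro integral_over_mesh[OF mesh D] continuous_intros cont)
  also have "\<dots> \<le> (\<Sum>K\<in>\<T>. 20 * 2 ^ (q+3) * (LINT x|lborel. indicator K x * (w x * u x)))"
  proof (rule sum_mono)
    fix K assume K: "K \<in> \<T>"
    obtain c d where uK: "\<forall>x\<in>K. u x = c \<bullet> x + d" using u(1) K unfolding piecewise_affine_def by blast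
    obtain c' d' where wK: "\<forall>x\<in>K. w x = c' \<bullet> x + d'" using w K unfolding piecewise_affine_def by blast
    show "(LINT x|lborel. indicator K x * \<bar>u x\<bar> ^ (q+1)) \<le> 20 * 2 ^ (q+3) * (LINT x|lborel. indicator K x * (w x * u x))"
      by (rule simplex_coercivity[OF mesh_simplex[OF mesh K] q dim uK wK])
        (use w_node K in \<open>auto simp: nodes_def\<close>)
  qed
  also have "\<dots> = 20 * 2 ^ (q+3) * (\<Sum>K\<in>\<T>. LINT x|lborel. indicator K x * (w x * u x))"
    by (simp add: sum_distrib_left)
  also have "(\<Sum>K\<in>\<T>. LINT x|lborel. indicator K x * (w x * u x)) = (LINT x|lebesgue_on D. w x * u x)"
    by (intro integral_over_mesh[OF mesh D, symmetric] continuous_intros cont)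
  finally show "(LINT x|lebesgue_on D. \<bar>u x\<bar> ^ (q+1)) \<le> 20 * 2 ^ (q+3) * (LINT x|lebesgue_on D. (u x - I x) * u x)"
    by (simp add: w_def)
qed

section \<open>The seminorm of square integrable functions and Lipschitz maps\<close>

lemma Lp_norm_2_squared: "(Lp_norm D 2 f)\<^sup>2 = L2_inner D f f"
  unfolding Lp_norm_def L2_inner_def by (simp add: sqrt_def[symmetric] power2_norm_eq_inner)

lemma Lp_norm_nonneg: "p > 0 \<Longrightarrow> 0 \<le> Lp_norm D p f"
  unfolding Lp_norm_def by (intro real_root_ge_zero integral_nonneg_AE) auto

lemma Lp_norm_power:
  fixes f :: "'a::euclidean_space \<Rightarrow> real"
  assumes "p > 0" shows "Lp_norm D p f ^ p = (LINT x|lebesgue_on D. \<bar>f x\<bar> ^ p)"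
  unfolding Lp_norm_def using assms by (subst real_root_pow_pos2) (auto intro!: integral_nonneg_AE)

lemma L2_measurable: "f \<in> L2 D \<Longrightarrow> f \<in> borel_measurable (lebesgue_on D)"
  by (simp add: L2_def)

lemma L2_product_integrable:
  fixes f g :: "'a::euclidean_space \<Rightarrow> real"
  assumes "f \<in> L2 D" "g \<in> L2 D" shows "integrable (lebesgue_on D) (\<lambda>x. f x * g x)"
proof (rule Bochner_Integration.integrable_bound)
  show "integrable (lebesgue_on D) (\<lambda>x. (f x)\<^sup>2 + (g x)\<^sup>2)"
    using assms by (auto simp: L2_def)
  show "(\<lambda>x. f x * g x) \<in> borel_measurable (lebesgue_on D)"
    using assms by (auto simp: L2_def)
  have "\<bar>a * b\<bar> \<le> a\<^sup>2 + b\<^sup>2" for a b :: real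
    using sum_squares_bound[of a b] sum_squares_bound[of a "- b"] zero_le_power2[of a] zero_le_power2[of b]
    by (auto simp: abs_if)
  then show "AE x in lebesgue_on D. norm (f x * g x) \<le> norm ((f x)\<^sup>2 + (g x)\<^sup>2)"
    by (auto intro!: AE_I2 order_trans[OF _ abs_ge_self])
qed

lemma L2_linear_combination:
  fixes f g :: "'a::euclidean_space \<Rightarrow> real"
  assumes f: "f \<in> L2 D" and g: "g \<in> L2 D" shows "(\<lambda>x. r * f x + s * g x) \<in> L2 D"
proof -
  have "integrable (lebesgue_on D) (\<lambda>x. r\<^sup>2 * (f x * f x) + (2 * r * s) * (f x * g x) + s\<^sup>2 * (g x * g x))"
    by (intro Bochner_Integration.integrable_add integrable_mult_right L2_product_integrable f g)
  also have "(\<lambda>x. r\<^sup>2 * (f x * f x) + (2 * r * s) * (f x * g x) + s\<^sup>2 * (g x * g x)) = (\<lambda>x. (r * f x + s * g x)\<^sup>2)"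
    by (simp add: fun_eq_iff power2_eq_square algebra_simps)
  finally show ?thesis using L2_measurable[OF f] L2_measurable[OF g] by (simp add: L2_def)
qed

lemma L2_add: "f \<in> L2 D \<Longrightarrow> g \<in> L2 D \<Longrightarrow> (\<lambda>x. f x + g x :: real) \<in> L2 D"
  using L2_linear_combination[of f D g 1 1] by simp

lemma L2_diff: "f \<in> L2 D \<Longrightarrow> g \<in> L2 D \<Longrightarrow> (\<lambda>x. f x - g x :: real) \<in> L2 D"
  using L2_linear_combination[of f D g 1 "-1"] by simp

lemma L2_cmult: "f \<in> L2 D \<Longrightarrow> (\<lambda>x. r * f x :: real) \<in> L2 D"
  using L2_linear_combination[of f D f r 0] by simp

lemma L2_sum: "finite I \<Longrightarrow> (\<And>i. i \<in> I \<Longrightarrow> f i \<in> L2 D) \<Longrightarrow> (\<lambda>x. \<Sum>i\<in>I. f i x :: real) \<in> L2 D"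
proof (induction rule: finite_induct)
  case empty
  show ?case by (simp add: L2_def)
next
  case (insert i I)
  then show ?case using L2_add[of "f i" D "\<lambda>x. \<Sum>i\<in>I. f i x"] by simp
qed

lemma L2_inner_commute: "L2_inner D f g = L2_inner D g f"
  by (simp add: L2_inner_def inner_commute)

lemma L2_inner_linear_combination:
  fixes f g h :: "'a::euclidean_space \<Rightarrow> real"
  assumes "f \<in> L2 D" "g \<in> L2 D" "h \<in> L2 D"
  shows "L2_inner D (\<lambda>x. r * f x + s * g x) h = r * L2_inner D f h + s * L2_inner D g h"
proof -
  have "(LINT x|lebesgue_on D. (r * f x + s * g x) * h x) = (LINT x|lebesgue_on D. r * (f x * h x) + s * (g x * h x))"
    by (simp add: algebra_simps)
  also have "\<dots> = r * (LINT x|lebesgue_on D. f x * h x) + s * (LINT x|lebesgue_on D. g x * h x)"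
    using L2_product_integrable[OF assms(1,3)] L2_product_integrable[OF assms(2,3)] by simp
  finally show ?thesis by (simp add: L2_inner_def)
qed

lemma L2_inner_diff_left:
  fixes f g h :: "'a::euclidean_space \<Rightarrow> real"
  shows "f \<in> L2 D \<Longrightarrow> g \<in> L2 D \<Longrightarrow> h \<in> L2 D \<Longrightarrow> L2_inner D (\<lambda>x. f x - g x) h = L2_inner D f h - L2_inner D g h"
  using L2_inner_linear_combination[of f D g h 1 "-1"] by simp

lemma L2_norm_square_diff:
  fixes f g :: "'a::euclidean_space \<Rightarrow> real"
  assumes "f \<in> L2 D" "g \<in> L2 D"
  shows "L2_inner D (\<lambda>x. f x - r * g x) (\<lambda>x. f x - r * g x) = L2_inner D f f - 2 * r * L2_inner D f g + r\<^sup>2 * L2_inner D g g"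
proof -
  have "(LINT x|lebesgue_on D. (f x - r * g x) * (f x - r * g x))
     = (LINT x|lebesgue_on D. f x * f x + (- 2 * r) * (f x * g x) + r\<^sup>2 * (g x * g x))"
    by (simp add: algebra_simps power2_eq_square)
  also have "\<dots> = (LINT x|lebesgue_on D. f x * f x) + (- 2 * r) * (LINT x|lebesgue_on D. f x * g x) + r\<^sup>2 * (LINT x|lebesgue_on D. g x * g x)"
    using L2_product_integrable[OF assms] L2_product_integrable[OF assms(1,1)] L2_product_integrable[OF assms(2,2)] by simp
  finally show ?thesis by (simp add: L2_inner_def)
qed

text \<open>
Functions are not identified when they agree almost everywhere, so the inner product is only
semidefinite and the degenerate case \<open>C = 0\<close> has to be treated separately.
\<close>

lemma L2_Cauchy_Schwarz:
  fixes f g :: "'a::euclidean_space \<Rightarrow> real"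
  assumes f: "f \<in> L2 D" and g: "g \<in> L2 D"
  shows "\<bar>L2_inner D f g\<bar> \<le> Lp_norm D 2 f * Lp_norm D 2 g"
proof -
  define A B C where "A = L2_inner D f f" and "B = L2_inner D f g" and "C = L2_inner D g g"
  have nonneg: "0 \<le> A - 2 * r * B + r\<^sup>2 * C" for r
    using L2_norm_square_diff[OF f g, of r] zero_le_power2[of "Lp_norm D 2 (\<lambda>x. f x - r * g x)"]
    by (simp add: Lp_norm_2_squared A_def B_def C_def)
  have C0: "0 \<le> C" unfolding C_def Lp_norm_2_squared[symmetric] by simp
  have "B\<^sup>2 \<le> A * C"
  proof (cases "C = 0")
    case True
    have "B = 0"
    proof (rule ccontr)
      assume "B \<noteq> 0"
      then show False using nonneg[of "(A + 1) / (2 * B)"] True by simp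
    qed
    then show ?thesis using True by simp
  next
    case False
    have "0 \<le> C * (A - 2 * (B / C) * B + (B / C)\<^sup>2 * C)" using nonneg[of "B / C"] C0 by (rule mult_nonneg_nonneg[rotated])
    also have "\<dots> = A * C - B\<^sup>2" using False by (simp add: field_simps power2_eq_square)
    finally show ?thesis by simp
  qed
  then have "\<bar>B\<bar>\<^sup>2 \<le> (Lp_norm D 2 f * Lp_norm D 2 g)\<^sup>2"
    by (simp add: power_mult_distrib Lp_norm_2_squared A_def C_def)
  then show ?thesis
    unfolding B_def by (rule power2_le_imp_le) (intro mult_nonneg_nonneg Lp_norm_nonneg; simp)
qed

lemma L2_triangle:
  fixes f g :: "'a::euclidean_space \<Rightarrow> real"
  assumes f: "f \<in> L2 D" and g: "g \<in> L2 D"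
  shows "Lp_norm D 2 (\<lambda>x. f x + g x) \<le> Lp_norm D 2 f + Lp_norm D 2 g"
proof -
  have "(Lp_norm D 2 (\<lambda>x. f x + g x))\<^sup>2 = (Lp_norm D 2 f)\<^sup>2 + 2 * L2_inner D f g + (Lp_norm D 2 g)\<^sup>2"
    using L2_norm_square_diff[OF f g, of "-1"] by (simp add: Lp_norm_2_squared)
  also have "\<dots> \<le> (Lp_norm D 2 f + Lp_norm D 2 g)\<^sup>2"
    using L2_Cauchy_Schwarz[OF f g] by (simp add: power2_sum)
  finally show ?thesis
    by (rule power2_le_imp_le) (intro add_nonneg_nonneg Lp_norm_nonneg; simp)
qed

lemma Lp_norm_2_cmult: "Lp_norm D 2 (\<lambda>x. r * f x :: real) = \<bar>r\<bar> * Lp_norm D 2 f"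
proof (rule power2_eq_imp_eq)
  show "(Lp_norm D 2 (\<lambda>x. r * f x))\<^sup>2 = (\<bar>r\<bar> * Lp_norm D 2 f)\<^sup>2"
  proof -
    have "L2_inner D (\<lambda>x. r * f x) (\<lambda>x. r * f x) = (LINT x|lebesgue_on D. r\<^sup>2 * (f x * f x))"
      unfolding L2_inner_def by (simp add: power2_eq_square ac_simps)
    also have "\<dots> = r\<^sup>2 * L2_inner D f f" unfolding L2_inner_def by simp
    finally show ?thesis by (simp add: Lp_norm_2_squared power_mult_distrib)
  qed
qed (auto intro!: mult_nonneg_nonneg Lp_norm_nonneg)

lemma Lp_norm_2_minus_commute: "Lp_norm D 2 (\<lambda>x. f x - g x :: real) = Lp_norm D 2 (\<lambda>x. g x - f x)"
  by (simp add: Lp_norm_def abs_minus_commute)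

lemma L2_norm_sum_le:
  fixes f :: "'i \<Rightarrow> 'a::euclidean_space \<Rightarrow> real"
  assumes "finite I" "\<And>i. i \<in> I \<Longrightarrow> f i \<in> L2 D"
  shows "Lp_norm D 2 (\<lambda>x. \<Sum>i\<in>I. f i x) \<le> (\<Sum>i\<in>I. Lp_norm D 2 (f i))"
  using assms
proof (induction rule: finite_induct)
  case empty
  show ?case by (simp add: Lp_norm_def)
next
  case (insert i I)
  then show ?case using L2_triangle[of "f i" D "\<lambda>x. \<Sum>i\<in>I. f i x"] L2_sum[of I f D] by fastforce
qed

text \<open>
Both \<open>G\<close> and \<open>v \<mapsto> DG(v)G(v)\<close> are used only through this property, which yields their linear growth
as well as the measurability of their inner products along an adapted process.
\<close>

definition L2_lipschitz :: "'a::euclidean_space set \<Rightarrow> real \<Rightarrow> (('a \<Rightarrow> real) \<Rightarrow> 'a \<Rightarrow> real) \<Rightarrow> bool" where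
  "L2_lipschitz D C \<Phi> \<longleftrightarrow> 0 \<le> C \<and> (\<forall>v\<in>L2 D. \<Phi> v \<in> L2 D) \<and>
     (\<forall>v\<in>L2 D. \<forall>w\<in>L2 D. Lp_norm D 2 (\<lambda>x. \<Phi> v x - \<Phi> w x) \<le> C * Lp_norm D 2 (\<lambda>x. v x - w x))"

lemma L2_lipschitz_id: "L2_lipschitz D 1 (\<lambda>v. v)"
  by (simp add: L2_lipschitz_def)

lemma L2_lipschitz_growth:
  assumes "L2_lipschitz D C \<Phi>" "v \<in> L2 D"
  shows "(Lp_norm D 2 (\<Phi> v))\<^sup>2 \<le> 2 * (Lp_norm D 2 (\<Phi> (\<lambda>_. 0)))\<^sup>2 + 2 * C\<^sup>2 * (Lp_norm D 2 v)\<^sup>2"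
proof -
  have z: "(\<lambda>_. 0) \<in> L2 D" by (simp add: L2_def)
  define a b where "a = Lp_norm D 2 (\<Phi> (\<lambda>_. 0))" and "b = C * Lp_norm D 2 v"
  have "Lp_norm D 2 (\<lambda>x. \<Phi> v x - \<Phi> (\<lambda>_. 0) x) \<le> C * Lp_norm D 2 (\<lambda>x. v x - (\<lambda>_. 0) x)"
    using assms z unfolding L2_lipschitz_def by blast
  then have L: "\<Phi> v \<in> L2 D" "\<Phi> (\<lambda>_. 0) \<in> L2 D" "Lp_norm D 2 (\<lambda>x. \<Phi> v x - \<Phi> (\<lambda>_. 0) x) \<le> b"
    using assms z by (auto simp: L2_lipschitz_def b_def)
  have "Lp_norm D 2 (\<Phi> v) \<le> Lp_norm D 2 (\<lambda>x. \<Phi> v x - \<Phi> (\<lambda>_. 0) x) + a"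
    using L2_triangle[OF L2_diff[OF L(1,2)] L(2)] by (simp add: a_def)
  with L(3) have "Lp_norm D 2 (\<Phi> v) \<le> a + b" by simp
  then have "(Lp_norm D 2 (\<Phi> v))\<^sup>2 \<le> (a + b)\<^sup>2" by (intro power_mono Lp_norm_nonneg) auto
  also have "\<dots> \<le> 2 * a\<^sup>2 + 2 * b\<^sup>2" using sum_squares_bound[of a b] by (simp add: power2_sum)
  finally show ?thesis by (simp add: a_def b_def power_mult_distrib)
qed

lemma L2_lipschitz_inner_diff:
  assumes \<Phi>: "L2_lipschitz D C \<Phi>" and \<Psi>: "L2_lipschitz D C' \<Psi>" and v: "v \<in> L2 D" and w: "w \<in> L2 D"
    and \<delta>: "Lp_norm D 2 (\<lambda>x. v x - w x) \<le> \<delta>"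
  shows "\<bar>L2_inner D (\<Phi> v) (\<Psi> v) - L2_inner D (\<Phi> w) (\<Psi> w)\<bar>
    \<le> C * \<delta> * (Lp_norm D 2 (\<Psi> w) + C' * \<delta>) + Lp_norm D 2 (\<Phi> w) * (C' * \<delta>)"
proof -
  have L: "\<Phi> v \<in> L2 D" "\<Phi> w \<in> L2 D" "\<Psi> v \<in> L2 D" "\<Psi> w \<in> L2 D" "0 \<le> C" "0 \<le> C'"
    using \<Phi> \<Psi> v w by (auto simp: L2_lipschitz_def)
  have "Lp_norm D 2 (\<lambda>x. \<Phi> v x - \<Phi> w x) \<le> C * Lp_norm D 2 (\<lambda>x. v x - w x)"
    using \<Phi> v w by (auto simp: L2_lipschitz_def)
  also have "\<dots> \<le> C * \<delta>" using \<delta> L(5) by (rule mult_left_mono)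
  finally have d\<Phi>: "Lp_norm D 2 (\<lambda>x. \<Phi> v x - \<Phi> w x) \<le> C * \<delta>" .
  have "Lp_norm D 2 (\<lambda>x. \<Psi> v x - \<Psi> w x) \<le> C' * Lp_norm D 2 (\<lambda>x. v x - w x)"
    using \<Psi> v w by (auto simp: L2_lipschitz_def)
  also have "\<dots> \<le> C' * \<delta>" using \<delta> L(6) by (rule mult_left_mono)
  finally have d\<Psi>: "Lp_norm D 2 (\<lambda>x. \<Psi> v x - \<Psi> w x) \<le> C' * \<delta>" .
  have n\<Psi>: "Lp_norm D 2 (\<Psi> v) \<le> Lp_norm D 2 (\<Psi> w) + C' * \<delta>"
    using L2_triangle[OF L2_diff[OF L(3,4)] L(4)] d\<Psi> by simp
  have "L2_inner D (\<Phi> v) (\<Psi> v) - L2_inner D (\<Phi> w) (\<Psi> w)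
    = L2_inner D (\<lambda>x. \<Phi> v x - \<Phi> w x) (\<Psi> v) + L2_inner D (\<lambda>x. \<Psi> v x - \<Psi> w x) (\<Phi> w)"
    using L L2_inner_diff_left[of "\<Phi> v" D "\<Phi> w" "\<Psi> v"] L2_inner_diff_left[of "\<Psi> v" D "\<Psi> w" "\<Phi> w"]
    by (simp add: L2_inner_commute[of D "\<Phi> w"])
  moreover have "\<bar>L2_inner D (\<lambda>x. \<Phi> v x - \<Phi> w x) (\<Psi> v)\<bar> \<le> C * \<delta> * (Lp_norm D 2 (\<Psi> w) + C' * \<delta>)"
    using L2_Cauchy_Schwarz[OF L2_diff[OF L(1,2)] L(3)]
      mult_mono[OF d\<Phi> n\<Psi> order_trans[OF Lp_norm_nonneg d\<Phi>] Lp_norm_nonneg] by simp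
  moreover have "\<bar>L2_inner D (\<lambda>x. \<Psi> v x - \<Psi> w x) (\<Phi> w)\<bar> \<le> Lp_norm D 2 (\<Phi> w) * (C' * \<delta>)"
    using L2_Cauchy_Schwarz[OF L2_diff[OF L(3,4)] L(2)]
      mult_left_mono[OF d\<Psi> Lp_norm_nonneg[of 2 D "\<Phi> w"]] by (simp add: mult.commute)
  ultimately show ?thesis by linarith
qed

text \<open>
The values \<open>X \<omega>\<close> range over a finite-dimensional space, with coefficients that are measurable in
\<open>\<omega>\<close>. The inner product is a continuous function of the coefficients, regarded as a sequence of
reals with the product topology, because \<open>\<Phi>\<close> and \<open>\<Psi>\<close> are Lipschitz.
\<close>

lemma lipschitz_functional_measurable:
  fixes X :: "'w \<Rightarrow> 'a::euclidean_space \<Rightarrow> real"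
  assumes \<Phi>: "L2_lipschitz D C \<Phi>" and \<Psi>: "L2_lipschitz D C' \<Psi>"
    and A: "finite A" "\<And>a. a \<in> A \<Longrightarrow> \<psi> a \<in> L2 D"
    and meas: "\<And>a. a \<in> A \<Longrightarrow> (\<lambda>\<omega>. c \<omega> a) \<in> borel_measurable N"
    and X: "\<And>\<omega> x. \<omega> \<in> space N \<Longrightarrow> x \<in> D \<Longrightarrow> X \<omega> x = (\<Sum>a\<in>A. c \<omega> a * \<psi> a x)"
    and XL: "\<And>\<omega>. \<omega> \<in> space N \<Longrightarrow> X \<omega> \<in> L2 D" and D: "D \<in> sets lebesgue"
  shows "(\<lambda>\<omega>. L2_inner D (\<Phi> (X \<omega>)) (\<Psi> (X \<omega>))) \<in> borel_measurable N"
proof -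
  obtain e and m :: nat where e: "bij_betw e {..<m} A"
    using ex_bij_betw_nat_finite[OF A(1)] by (auto simp: atLeast0LessThan)
  have eA: "e i \<in> A" if "i < m" for i using e that by (auto simp: bij_betw_def)
  define V where "V = (\<lambda>(z :: nat \<Rightarrow> real) x. \<Sum>i<m. z i * \<psi> (e i) x)"
  \<comment> \<open>Coefficients indexed by natural numbers: the product topology on \<open>nat \<Rightarrow> real\<close> is second
    countable, so its Borel sets are generated by the coordinates.\<close>
  define h where "h = (\<lambda>z. L2_inner D (\<Phi> (V z)) (\<Psi> (V z)))"
  have VL: "V z \<in> L2 D" for z
    unfolding V_def using eA A(2) by (intro L2_sum L2_cmult) auto
  have cont: "continuous_on UNIV h"
  proof (rule continuous_at_imp_continuous_on, rule ballI)
    fix z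
    define \<delta> where "\<delta> = (\<lambda>z'. \<Sum>i<m. \<bar>z' i - z i\<bar> * Lp_norm D 2 (\<psi> (e i)))"
    have "continuous_on UNIV \<delta>" unfolding \<delta>_def
      by (intro continuous_intros continuous_on_product_coordinates)
    then have "isCont \<delta> z" by (simp add: continuous_on_eq_continuous_at)
    moreover have "\<delta> z = 0" by (simp add: \<delta>_def)
    ultimately have \<delta>: "(\<delta> \<longlongrightarrow> 0) (at z)" by (simp add: isCont_def)
    have V\<delta>: "Lp_norm D 2 (\<lambda>x. V z' x - V z x) \<le> \<delta> z'" for z'
    proof -
      have "Lp_norm D 2 (\<lambda>x. V z' x - V z x) = Lp_norm D 2 (\<lambda>x. \<Sum>i<m. (z' i - z i) * \<psi> (e i) x)"
        by (simp add: V_def sum_subtractf[symmetric] left_diff_distrib)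
      also have "\<dots> \<le> (\<Sum>i<m. Lp_norm D 2 (\<lambda>x. (z' i - z i) * \<psi> (e i) x))"
        using eA A(2) by (intro L2_norm_sum_le L2_cmult) auto
      finally show ?thesis by (simp add: Lp_norm_2_cmult \<delta>_def)
    qed
    have "((\<lambda>z'. C * \<delta> z' * (Lp_norm D 2 (\<Psi> (V z)) + C' * \<delta> z') + Lp_norm D 2 (\<Phi> (V z)) * (C' * \<delta> z')) \<longlongrightarrow>
        C * 0 * (Lp_norm D 2 (\<Psi> (V z)) + C' * 0) + Lp_norm D 2 (\<Phi> (V z)) * (C' * 0)) (at z)"
      by (intro tendsto_intros \<delta>)
    then have "((\<lambda>z'. C * \<delta> z' * (Lp_norm D 2 (\<Psi> (V z)) + C' * \<delta> z') + Lp_norm D 2 (\<Phi> (V z)) * (C' * \<delta> z')) \<longlongrightarrow> 0) (at z)"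
      by simp
    then have "((\<lambda>z'. h z' - h z) \<longlongrightarrow> 0) (at z)"
      by (rule Lim_null_comparison[rotated])
        (auto simp: h_def intro!: always_eventually L2_lipschitz_inner_diff[OF \<Phi> \<Psi> VL VL V\<delta>])
    then show "isCont h z" by (simp add: isCont_def LIM_zero_iff)
  qed
  then have hm: "h \<in> borel_measurable borel" by (rule borel_measurable_continuous_onI)
  define zz where "zz = (\<lambda>\<omega> i. if i < m then c \<omega> (e i) else 0)"
  have "zz \<in> borel_measurable N"
  proof (rule measurable_coordinatewise_then_product)
    fix i show "(\<lambda>\<omega>. zz \<omega> i) \<in> borel_measurable N"
      by (cases "i < m") (simp_all add: zz_def meas eA)
  qed
  then have "(\<lambda>\<omega>. h (zz \<omega>)) \<in> borel_measurable N" using hm by (rule measurable_compose)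
  moreover have "h (zz \<omega>) = L2_inner D (\<Phi> (X \<omega>)) (\<Psi> (X \<omega>))" if \<omega>: "\<omega> \<in> space N" for \<omega>
  proof -
    have eq: "X \<omega> x = V (zz \<omega>) x" if "x \<in> D" for x
      using X[OF \<omega> that] sum.reindex_bij_betw[OF e, of "\<lambda>a. c \<omega> a * \<psi> a x"] by (simp add: V_def zz_def)
    have "Lp_norm D 2 (\<lambda>x. X \<omega> x - V (zz \<omega>) x) = Lp_norm D 2 (\<lambda>x. 0 :: real)"
      unfolding Lp_norm_def using D
      by (intro arg_cong[where f = "root 2"] Bochner_Integration.integral_cong refl) (simp add: eq space_restrict_space)
    then have "Lp_norm D 2 (\<lambda>x. X \<omega> x - V (zz \<omega>) x) \<le> 0" by (simp add: Lp_norm_def)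
    from L2_lipschitz_inner_diff[OF \<Phi> \<Psi> XL[OF \<omega>] VL this] show ?thesis by (simp add: h_def)
  qed
  ultimately show ?thesis by (simp cong: measurable_cong)
qed

text \<open>
This is scaling to the unit ball. Elements of seminorm zero cannot be scaled; on them the
operator vanishes because it is bounded.
\<close>

lemma bounded_operator_bound:
  fixes A :: "('a::euclidean_space \<Rightarrow> real) \<Rightarrow> 'a \<Rightarrow> real"
  assumes A: "bounded_operator (L2 D) (Lp_norm D 2) A" 
    and C: "\<And>v. v \<in> L2 D \<Longrightarrow> Lp_norm D 2 v \<le> 1 \<Longrightarrow> Lp_norm D 2 (A v) \<le> C" and v: "v \<in> L2 D"
  shows "Lp_norm D 2 (A v) \<le> C * Lp_norm D 2 v"
proof (cases "Lp_norm D 2 v = 0")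
  case True
  obtain B where "\<forall>v\<in>L2 D. Lp_norm D 2 (A v) \<le> B * Lp_norm D 2 v"
    using A by (auto simp: bounded_operator_def)
  then show ?thesis using True v by fastforce
next
  case False
  define n where "n = Lp_norm D 2 v"
  have n: "n > 0" using False Lp_norm_nonneg[of 2 D v] by (simp add: n_def)
  define w where "w = (\<lambda>x. (1 / n) * v x)"
  have w: "w \<in> L2 D" "Lp_norm D 2 w = 1"
    unfolding w_def by (rule L2_cmult[OF v]) (use Lp_norm_2_cmult[of D "1 / n" v] n in \<open>simp add: n_def\<close>)
  have AL: "A v \<in> L2 D" "A w \<in> L2 D" using A v w by (auto simp: bounded_operator_def)
  have "Lp_norm D 2 (\<lambda>x. A (\<lambda>y. n * w y + 0 * w y) x - (n * A w x + 0 * A w x)) = 0"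
    using A w(1) unfolding bounded_operator_def by blast
  moreover have "(\<lambda>y. n * w y + 0 * w y) = v" using n by (simp add: w_def)
  ultimately have "Lp_norm D 2 (\<lambda>x. A v x - n * A w x) = 0" by simp
  moreover have "Lp_norm D 2 (A v) \<le> Lp_norm D 2 (\<lambda>x. A v x - n * A w x) + Lp_norm D 2 (\<lambda>x. n * A w x)"
    using L2_triangle[OF L2_diff[OF AL(1) L2_cmult[OF AL(2), of n]] L2_cmult[OF AL(2), of n]] by simp
  ultimately have "Lp_norm D 2 (A v) \<le> n * Lp_norm D 2 (A w)" using n by (simp add: Lp_norm_2_cmult)
  also have "\<dots> \<le> n * C" using n C[OF w(1)] w(2) by (intro mult_left_mono) auto
  finally show ?thesis by (simp add: n_def mult.commute)
qed

text \<open>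
The difference \<open>DG(v)G(v) - DG(w)G(w)\<close> splits into \<open>DG(v)(G(v) - G(w))\<close>, which is controlled by the
bound on \<open>DG\<close> and the Lipschitz property of \<open>G\<close>, and \<open>(DG(v) - DG(w))G(w)\<close>, which is the subject of
the last assumption on the noise coefficient.
\<close>

lemma noise_coefficient_lipschitz:
  fixes D :: "'a::euclidean_space set"
  assumes "noise_coefficient_on (L2 D) (Lp_norm D 2) G DG D2G"
  shows "\<exists>C. L2_lipschitz D C G \<and> L2_lipschitz D C (\<lambda>v. DG v (G v))"
proof -
  obtain C where C: "C > 0"
    and lip: "\<And>v w. v \<in> L2 D \<Longrightarrow> w \<in> L2 D \<Longrightarrow> Lp_norm D 2 (\<lambda>x. G v x - G w x) \<le> C * Lp_norm D 2 (\<lambda>x. v x - w x)"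
    and sup: "(SUP u\<in>L2 D. SUP v\<in>{v\<in>L2 D. Lp_norm D 2 v \<le> 1}. ennreal (Lp_norm D 2 (DG u v))) +
          (SUP u\<in>L2 D. SUP v\<in>{v\<in>L2 D. Lp_norm D 2 v \<le> 1}. SUP w\<in>{w\<in>L2 D. Lp_norm D 2 w \<le> 1}. ennreal (Lp_norm D 2 (D2G u v w)))
          \<le> ennreal C"
    and comm: "\<And>v w. v \<in> L2 D \<Longrightarrow> w \<in> L2 D \<Longrightarrow>
           Lp_norm D 2 (\<lambda>x. DG v (G w) x - DG w (G w) x) \<le> C * Lp_norm D 2 (\<lambda>x. v x - w x)"
    using assms unfolding noise_coefficient_on_def by blast
  have G: "\<And>v. v \<in> L2 D \<Longrightarrow> G v \<in> L2 D" and DG: "\<And>u. u \<in> L2 D \<Longrightarrow> bounded_operator (L2 D) (Lp_norm D 2) (DG u)"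
    using assms by (auto simp: noise_coefficient_on_def first_gateaux_derivative_def)
  have unit: "Lp_norm D 2 (DG u v) \<le> C" if "u \<in> L2 D" "v \<in> L2 D" "Lp_norm D 2 v \<le> 1" for u v
  proof -
    have "ennreal (Lp_norm D 2 (DG u v)) \<le> (SUP u\<in>L2 D. SUP v\<in>{v\<in>L2 D. Lp_norm D 2 v \<le> 1}. ennreal (Lp_norm D 2 (DG u v)))"
      using that by (intro SUP_upper2[of u] SUP_upper2[of v]) auto
    also have "\<dots> \<le> ennreal C" using sup by (rule order_trans[OF add_increasing2[OF zero_le order_refl]])
    finally show ?thesis using C by (simp add: ennreal_le_iff)
  qed
  have bnd: "Lp_norm D 2 (DG u v) \<le> C * Lp_norm D 2 v" if "u \<in> L2 D" "v \<in> L2 D" for u v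
    by (rule bounded_operator_bound[OF DG unit]) (use that in auto)
  have DGL: "DG u v \<in> L2 D" if "u \<in> L2 D" "v \<in> L2 D" for u v
    using DG[OF that(1)] that(2) by (auto simp: bounded_operator_def)
  have lip2: "Lp_norm D 2 (\<lambda>x. DG v (G v) x - DG w (G w) x) \<le> (C * C + C) * Lp_norm D 2 (\<lambda>x. v x - w x)"
    if v: "v \<in> L2 D" and w: "w \<in> L2 D" for v w
  proof -
    let ?d = "\<lambda>y. 1 * G v y + (-1) * G w y"
    have d: "?d \<in> L2 D" by (rule L2_linear_combination[OF G[OF v] G[OF w]])
    have m: "DG v (G v) \<in> L2 D" "DG v (G w) \<in> L2 D" "DG w (G w) \<in> L2 D" "DG v ?d \<in> L2 D"
      using DGL G v w d by auto
    have "Lp_norm D 2 (\<lambda>x. DG v ?d x - (1 * DG v (G v) x + (-1) * DG v (G w) x)) = 0"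
      using DG[OF v] G[OF v] G[OF w] unfolding bounded_operator_def by blast
    then have z: "Lp_norm D 2 (\<lambda>x. (DG v (G v) x - DG v (G w) x) - DG v ?d x) = 0"
      by (subst Lp_norm_2_minus_commute) simp
    have "Lp_norm D 2 (\<lambda>x. DG v (G v) x - DG v (G w) x) \<le> Lp_norm D 2 (DG v ?d)"
      using L2_triangle[OF L2_diff[OF L2_diff[OF m(1,2)] m(4)] m(4)] z by simp
    also have "\<dots> \<le> C * Lp_norm D 2 ?d" by (rule bnd[OF v d])
    also have "\<dots> \<le> C * (C * Lp_norm D 2 (\<lambda>x. v x - w x))"
      using lip[OF v w] C by (intro mult_left_mono) auto
    finally have 1: "Lp_norm D 2 (\<lambda>x. DG v (G v) x - DG v (G w) x) \<le> C * (C * Lp_norm D 2 (\<lambda>x. v x - w x))" .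
    have "Lp_norm D 2 (\<lambda>x. DG v (G v) x - DG w (G w) x)
        \<le> Lp_norm D 2 (\<lambda>x. DG v (G v) x - DG v (G w) x) + Lp_norm D 2 (\<lambda>x. DG v (G w) x - DG w (G w) x)"
      using L2_triangle[OF L2_diff[OF m(1,2)] L2_diff[OF m(2,3)]] by simp
    with 1 comm[OF v w] show ?thesis by (simp add: algebra_simps)
  qed
  have "L2_lipschitz D (C * C + C) G"
    unfolding L2_lipschitz_def
  proof (intro conjI ballI G)
    show "0 \<le> C * C + C" using C by simp
    fix v w :: "'a \<Rightarrow> real" assume vw: "v \<in> L2 D" "w \<in> L2 D"
    have "C * Lp_norm D 2 (\<lambda>x. v x - w x) \<le> (C * C + C) * Lp_norm D 2 (\<lambda>x. v x - w x)"
      using C by (intro mult_right_mono Lp_norm_nonneg) auto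
    then show "Lp_norm D 2 (\<lambda>x. G v x - G w x) \<le> (C * C + C) * Lp_norm D 2 (\<lambda>x. v x - w x)"
      using lip[OF vw] by simp
  qed
  moreover have "L2_lipschitz D (C * C + C) (\<lambda>v. DG v (G v))"
    unfolding L2_lipschitz_def using C lip2 DGL G by auto
  ultimately show ?thesis by blast
qed

section \<open>Random finite element functions and Gaussian increments\<close>

lemma cube_eq_box: "cube L = box 0 (L *\<^sub>R One)"
  by (auto simp: cube_def mem_box)

lemma open_cube: "open (cube L)" and convex_cube: "convex (cube L)" and bounded_cube: "bounded (cube L)"
  by (auto simp: cube_eq_box convex_box)

lemma open_bounded_finite_measure:
  fixes D :: "'a::euclidean_space set"
  assumes "open D" "bounded D" shows "finite_measure (lebesgue_on D)"
  using assms by (intro finite_measure_lebesgue_on lmeasurable_open)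

lemma continuous_closure_integrable:
  fixes f :: "'a::euclidean_space \<Rightarrow> real"
  assumes D: "open D" "bounded D" and f: "continuous_on (closure D) f"
  shows "f \<in> borel_measurable (lebesgue_on D)" "integrable (lebesgue_on D) f"
proof -
  show m: "f \<in> borel_measurable (lebesgue_on D)"
    using D(1) continuous_on_subset[OF f closure_subset] by (intro continuous_imp_measurable_on_sets_lebesgue) auto
  have "bounded (f ` closure D)"
    using f D(2) by (intro compact_imp_bounded compact_continuous_image) (auto simp: compact_closure)
  then obtain B where B: "\<forall>x\<in>closure D. \<bar>f x\<bar> \<le> B" unfolding bounded_iff by auto
  interpret finite_measure "lebesgue_on D" by (rule open_bounded_finite_measure[OF D])
  show "integrable (lebesgue_on D) f"
  proof (rule integrable_const_bound[of _ B])
    show "AE x in lebesgue_on D. norm (f x) \<le> B"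
      using B closure_subset[of D] by (intro AE_I2) auto
  qed (rule m)
qed

lemma continuous_closure_in_L2:
  fixes f :: "'a::euclidean_space \<Rightarrow> real"
  assumes D: "open D" "bounded D" and f: "continuous_on (closure D) f"
  shows "f \<in> L2 D"
  using continuous_closure_integrable(1)[OF D f] continuous_closure_integrable(2)[OF D, of "\<lambda>x. (f x)\<^sup>2"] f
  by (auto simp: L2_def intro!: continuous_intros)

lemma hat_functions_exist:
  fixes D :: "'a::euclidean_space set"
  assumes mesh: "mesh_of D \<T>"
  shows "\<exists>\<psi>. (\<forall>a. piecewise_affine \<T> (\<psi> a)) \<and>
    (\<forall>v x. piecewise_affine \<T> v \<longrightarrow> x \<in> closure D \<longrightarrow> v x = (\<Sum>a\<in>nodes \<T>. v a * \<psi> a x))"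
proof -
  have "\<forall>a. \<exists>v. piecewise_affine \<T> v \<and> (\<forall>b\<in>nodes \<T>. v b = (if b = a then 1 else 0))"
    by (intro allI nodal_interpolation_exists[OF mesh])
  then obtain \<psi> where \<psi>: "\<forall>a. piecewise_affine \<T> (\<psi> a)" "\<forall>a. \<forall>b\<in>nodes \<T>. \<psi> a b = (if b = a then 1 else 0)"
    by metis
  have "v x = (\<Sum>a\<in>nodes \<T>. v a * \<psi> a x)" if v: "piecewise_affine \<T> v" and x: "x \<in> closure D" for v x
  proof (rule piecewise_affine_eqI[OF mesh v _ _ x])
    show "piecewise_affine \<T> (\<lambda>x. \<Sum>a\<in>nodes \<T>. v a * \<psi> a x)"
      unfolding piecewise_affine_def
    proof
      fix K assume "K \<in> \<T>"
      then have "\<forall>a. \<exists>c d. \<forall>x\<in>K. \<psi> a x = c \<bullet> x + d" using \<psi>(1) by (simp add: piecewise_affine_def)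
      then obtain c d where cd: "\<forall>a. \<forall>x\<in>K. \<psi> a x = c a \<bullet> x + d a" by metis
      have "(\<Sum>a\<in>nodes \<T>. v a * \<psi> a x) = (\<Sum>a\<in>nodes \<T>. v a *\<^sub>R c a) \<bullet> x + (\<Sum>a\<in>nodes \<T>. v a * d a)"
        if "x \<in> K" for x
        using that cd by (simp add: inner_sum_left sum.distrib[symmetric] distrib_left)
      then show "\<exists>c d. \<forall>x\<in>K. (\<Sum>a\<in>nodes \<T>. v a * \<psi> a x) = c \<bullet> x + d" by blast
    qed
    fix b assume b: "b \<in> nodes \<T>"
    have "(\<Sum>a\<in>nodes \<T>. v a * \<psi> a b) = (\<Sum>a\<in>nodes \<T>. if b = a then v a else 0)"
      using \<psi>(2) b by (intro sum.cong) auto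
    then show "v b = (\<Sum>a\<in>nodes \<T>. v a * \<psi> a b)"
      using finite_nodes[OF mesh] b by simp
  qed
  then show ?thesis using \<psi>(1) by blast
qed

lemma fe_space_L2: "v \<in> fe_space D \<T> \<Longrightarrow> v \<in> L2 D"
  by (auto simp: fe_space_def H10_def H1_def)

text \<open>
The locale is used for \<open>N\<close> equal to the \<open>\<sigma>\<close>-algebra of the past, where independence of the next
increment is needed, and to the full \<open>\<sigma>\<close>-algebra.
\<close>

locale random_fe_function =
  fixes D :: "'a::euclidean_space set" and \<T> :: "'a set set" and N :: "'w measure" and X :: "'w \<Rightarrow> 'a \<Rightarrow> real"
  assumes mesh: "mesh_of D \<T>" and D: "open D" "bounded D"
    and fe: "\<omega> \<in> space N \<Longrightarrow> X \<omega> \<in> fe_space D \<T>"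
    and eval: "x \<in> closure D \<Longrightarrow> (\<lambda>\<omega>. X \<omega> x) \<in> borel_measurable N"
begin

lemma expansion:
  "\<exists>\<psi>. (\<forall>a. continuous_on (closure D) (\<psi> a)) \<and>
    (\<forall>\<omega>\<in>space N. \<forall>x\<in>D. X \<omega> x = (\<Sum>a\<in>nodes \<T>. X \<omega> a * \<psi> a x))"
proof -
  obtain \<psi> where \<psi>: "\<forall>a. piecewise_affine \<T> (\<psi> a)"
    "\<forall>v x. piecewise_affine \<T> v \<longrightarrow> x \<in> closure D \<longrightarrow> v x = (\<Sum>a\<in>nodes \<T>. v a * \<psi> a x)"
    using hat_functions_exist[OF mesh] by blast
  have "X \<omega> x = (\<Sum>a\<in>nodes \<T>. X \<omega> a * \<psi> a x)" if "\<omega> \<in> space N" "x \<in> D" for \<omega> x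
    using fe[OF that(1)] \<psi>(2) that(2) closure_subset by (auto simp: fe_space_def)
  then show ?thesis using piecewise_affine_continuous[OF mesh] \<psi>(1) by blast
qed

lemma jointly_measurable: "(\<lambda>(\<omega>, x). X \<omega> x) \<in> borel_measurable (N \<Otimes>\<^sub>M lebesgue_on D)"
proof -
  obtain \<psi> where \<psi>: "\<forall>a. continuous_on (closure D) (\<psi> a)"
    "\<forall>\<omega>\<in>space N. \<forall>x\<in>D. X \<omega> x = (\<Sum>a\<in>nodes \<T>. X \<omega> a * \<psi> a x)"
    using expansion by blast
  have [measurable]: "\<psi> a \<in> borel_measurable (lebesgue_on D)" for a
    by (rule continuous_closure_integrable(1)[OF D \<psi>(1)[rule_format]])
  have [measurable]: "a \<in> nodes \<T> \<Longrightarrow> (\<lambda>\<omega>. X \<omega> a) \<in> borel_measurable N" for a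
    by (rule eval) (rule nodes_in_closure[OF mesh])
  have "(\<lambda>(\<omega>, x). \<Sum>a\<in>nodes \<T>. X \<omega> a * \<psi> a x) \<in> borel_measurable (N \<Otimes>\<^sub>M lebesgue_on D)"
    by measurable
  then show ?thesis
    by (rule measurable_cong[THEN iffD1, rotated]) (auto simp: space_pair_measure \<psi>(2))
qed

lemma lipschitz_inner_measurable:
  assumes "L2_lipschitz D C \<Phi>" "L2_lipschitz D C' \<Psi>"
  shows "(\<lambda>\<omega>. L2_inner D (\<Phi> (X \<omega>)) (\<Psi> (X \<omega>))) \<in> borel_measurable N"
proof -
  obtain \<psi> where \<psi>: "\<forall>a. continuous_on (closure D) (\<psi> a)"
    "\<forall>\<omega>\<in>space N. \<forall>x\<in>D. X \<omega> x = (\<Sum>a\<in>nodes \<T>. X \<omega> a * \<psi> a x)"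
    using expansion by blast
  have L2: "\<psi> a \<in> L2 D" "\<omega> \<in> space N \<Longrightarrow> X \<omega> \<in> L2 D" for a \<omega>
    using continuous_closure_in_L2[OF D \<psi>(1)[rule_format]] fe_space_L2[OF fe] by auto
  show ?thesis
    by (rule lipschitz_functional_measurable[where \<psi> = \<psi> and c = X, OF assms finite_nodes[OF mesh]])
      (use \<psi> L2 D eval nodes_in_closure[OF mesh] in auto)
qed

lemma integral_measurable:
  assumes "(\<lambda>(\<omega>, x). f \<omega> x :: real) \<in> borel_measurable (N \<Otimes>\<^sub>M lebesgue_on D)"
  shows "(\<lambda>\<omega>. LINT x|lebesgue_on D. f \<omega> x) \<in> borel_measurable N"
proof -
  interpret finite_measure "lebesgue_on D" by (rule open_bounded_finite_measure[OF D])
  show ?thesis by (rule borel_measurable_lebesgue_integral[OF assms])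
qed

end

lemma centered_normal_moments:
  assumes dist: "distributed M lborel Y (normal_density 0 (sqrt \<tau>))" and \<tau>: "\<tau> > 0"
  shows "has_bochner_integral M Y 0"
    "has_bochner_integral M (\<lambda>\<omega>. (Y \<omega>)\<^sup>2) \<tau>"
    "has_bochner_integral M (\<lambda>\<omega>. (Y \<omega>) ^ 4) (3 * \<tau>\<^sup>2)"
proof -
  have transfer: "has_bochner_integral M (\<lambda>\<omega>. g (Y \<omega>)) r"
    if "has_bochner_integral lborel (\<lambda>x. normal_density 0 (sqrt \<tau>) x * g x) r" "g \<in> borel_measurable borel" for g r
    using that distributed_integrable[OF dist, of g] distributed_integral[OF dist, of g]
    by (auto simp: has_bochner_integral_iff)
  have s: "0 < sqrt \<tau>" using \<tau> by simp
  show "has_bochner_integral M Y 0"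
    using normal_moment_odd[OF s, where k = 0 and \<mu> = 0] by (intro transfer[of "\<lambda>x. x"]) auto
  show "has_bochner_integral M (\<lambda>\<omega>. (Y \<omega>)\<^sup>2) \<tau>"
    using normal_moment_even[OF s, where k = 1 and \<mu> = 0] \<tau>
    by (intro transfer[of "\<lambda>x. x\<^sup>2"]) (auto simp: fact_numeral)
  have "fact 4 / ((2 / \<tau>)\<^sup>2 * 2) = (3 * \<tau>\<^sup>2 :: real)"
    using \<tau> by (simp add: fact_numeral field_simps power2_eq_square)
  then show "has_bochner_integral M (\<lambda>\<omega>. (Y \<omega>) ^ 4) (3 * \<tau>\<^sup>2)"
    using normal_moment_even[OF s, where k = 2 and \<mu> = 0] \<tau>
    by (intro transfer[of "\<lambda>x. x ^ 4"]) (auto simp: fact_numeral)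
qed

text \<open>
Here \<open>X\<close> is known at the beginning of the time step and \<open>Y\<close> is the increment over it.
\<close>

lemma independent_increment_product:
  fixes X Y :: "'w \<Rightarrow> real"
  assumes "prob_space M" and sub: "subalgebra M F" 
    and indep: "prob_space.indep_set M (sets F) {Y -` B \<inter> space M | B. B \<in> sets borel}"
    and Ym: "Y \<in> borel_measurable M"
    and X: "X \<in> borel_measurable F" "integrable M X"
    and g: "g \<in> borel_measurable borel" "has_bochner_integral M (\<lambda>\<omega>. g (Y \<omega>)) (r::real)"
  shows "has_bochner_integral M (\<lambda>\<omega>. X \<omega> * g (Y \<omega>)) ((LINT \<omega>|M. X \<omega>) * r)"
proof -
  interpret prob_space M by fact
  have XM: "X \<in> borel_measurable M" by (rule measurable_from_subalg[OF sub X(1)])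
  have "indep_var borel X borel Y"
    unfolding indep_var_def indep_vars_def2
  proof (intro conjI ballI)
    show "random_variable (case i of True \<Rightarrow> borel | False \<Rightarrow> borel) (case i of True \<Rightarrow> X | False \<Rightarrow> Y)" for i
      using XM Ym by (cases i) auto
    show "indep_sets (\<lambda>i. {(case i of True \<Rightarrow> X | False \<Rightarrow> Y) -` A \<inter> space M |A. A \<in> sets (case i of True \<Rightarrow> borel | False \<Rightarrow> borel)}) UNIV"
    proof (rule indep_sets_mono_sets[OF indep[unfolded indep_set_def]])
      fix i
      have "X -` A \<inter> space M \<in> sets F" if "A \<in> sets borel" for A
        using measurable_sets[OF X(1) that] sub by (simp add: subalgebra_def)
      then show "{(case i of True \<Rightarrow> X | False \<Rightarrow> Y) -` A \<inter> space M |A. A \<in> sets (case i of True \<Rightarrow> borel | False \<Rightarrow> borel)}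
        \<subseteq> (case i of True \<Rightarrow> sets F | False \<Rightarrow> {Y -` B \<inter> space M |B. B \<in> sets borel})"
        by (cases i) auto
    qed
  qed
  from indep_var_compose[OF this measurable_ident g(1)]
  have "indep_var borel X borel (\<lambda>\<omega>. g (Y \<omega>))" by (simp add: comp_def)
  from indep_var_lebesgue_integral[OF this X(2)] indep_var_integrable[OF this X(2)] g(2)
  show ?thesis by (auto simp: has_bochner_integral_iff)
qed

section \<open>Energy inequalities\<close>

text \<open>
The reaction term \<open>u\<close> has the wrong sign and is absorbed by the dissipation of order \<open>q + 1\<close>. Above
the threshold \<open>2 / c \<ge> 1\<close> the power dominates the square; below it the square is bounded.
\<close>

lemma square_le_power:
  fixes s c :: real
  assumes "c > 0" "c \<le> 2" "odd q" "q \<ge> 3"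
  shows "2 * s\<^sup>2 \<le> c * \<bar>s\<bar> ^ (q+1) + 2 * (2 / c)\<^sup>2"
proof (cases "\<bar>s\<bar> \<le> 2 / c")
  case True
  then have "\<bar>s\<bar>\<^sup>2 \<le> (2 / c)\<^sup>2" by (intro power_mono) auto
  then show ?thesis using assms(1) by (intro add_increasing) auto
next
  case False
  have one: "1 \<le> 2 / c" using assms by simp
  have "2 / c \<le> \<bar>s\<bar> ^ 1" using False by simp
  also have "\<dots> \<le> \<bar>s\<bar> ^ (q - 1)" using False one assms(4) by (intro power_increasing) auto
  finally have "2 \<le> c * \<bar>s\<bar> ^ (q - 1)" using assms(1) by (simp add: field_simps)
  then have "2 * \<bar>s\<bar>\<^sup>2 \<le> c * \<bar>s\<bar> ^ (q - 1) * \<bar>s\<bar>\<^sup>2" by (intro mult_right_mono) auto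
  also have "\<dots> = c * \<bar>s\<bar> ^ (q + 1)"
  proof -
    have "q - 1 + 2 = q + 1" using assms(4) by simp
    then show ?thesis by (simp only: mult.assoc power_add[symmetric])
  qed
  finally show ?thesis by (simp add: add_increasing2)
qed

text \<open>
This is the scheme tested with \<open>u'\<close>, with \<open>w\<close> and \<open>z\<close> standing for the increment and its
compensated square. Each of the two noise terms spends one eighth of \<open>\<parallel>u' - u\<parallel>\<^sup>2\<close> on replacing \<open>u'\<close>
by \<open>u\<close>; half of the dissipation of the nonlinearity is spent on the reaction term.
\<close>

lemma energy_inequality:
  fixes D :: "'a::euclidean_space set"
  assumes mesh: "mesh_of D \<T>" and D: "open D" "convex D" "bounded D" and q: "odd q" "q \<ge> 3"
    and dim: "DIM('a) = 2 \<or> DIM('a) = 3 \<and> q \<in> {3, 5}"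
    and u: "u \<in> fe_space D \<T>" and u': "u' \<in> fe_space D \<T>"
    and G: "G u \<in> L2 D" and \<Gamma>: "\<Gamma> u \<in> L2 D" and \<tau>: "\<tau> > 0"
    and scheme: "L2_inner D (\<lambda>x. u' x - u x) u' + \<tau> * L2_inner D (grad D u') (grad D u')
       = \<tau> * L2_inner D (nodal_interpolant D \<T> (\<lambda>x. u' x - u' x ^ q)) u' + L2_inner D (G u) u' * w
         + 1 / 2 * L2_inner D (\<lambda>x. \<Gamma> u x * z) u'"
  defines "c \<equiv> 1 / (20 * 2 ^ (q + 3))"
  shows "L2_inner D u' u' + L2_inner D (\<lambda>x. u' x - u x) (\<lambda>x. u' x - u x) / 2
      + 2 * \<tau> * L2_inner D (grad D u') (grad D u') + \<tau> * c * (LINT x|lebesgue_on D. \<bar>u' x\<bar> ^ (q+1))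
    \<le> L2_inner D u u + \<tau> * (2 * (2 / c)\<^sup>2 * measure lebesgue D) + 2 * L2_inner D (G u) u * w
      + L2_inner D (\<Gamma> u) u * z + 4 * L2_inner D (G u) (G u) * w\<^sup>2 + L2_inner D (\<Gamma> u) (\<Gamma> u) * z\<^sup>2"
proof -
  define I where "I = nodal_interpolant D \<T> (\<lambda>x. u' x - u' x ^ q)"
  define d where "d = (\<lambda>x. u' x - u x)"
  define \<Lambda> where "\<Lambda> = (LINT x|lebesgue_on D. \<bar>u' x\<bar> ^ (q+1))"
  have pa: "piecewise_affine \<T> u'" and bd: "\<And>x. x \<in> frontier D \<Longrightarrow> u' x = 0"
    using u' by (auto simp: fe_space_def)
  have "(1::real) \<le> 2 ^ (q + 3)" by (rule one_le_power) simp
  then have "1 \<le> 2 * (20 * 2 ^ (q + 3) :: real)" by linarith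
  then have c: "0 < c" "c \<le> 2" by (simp_all add: c_def pos_divide_le_eq del: power_add)
  have L: "u \<in> L2 D" "u' \<in> L2 D" "d \<in> L2 D"
    using fe_space_L2[OF u] fe_space_L2[OF u'] by (auto simp: d_def intro: L2_diff)
  have cont: "continuous_on (closure D) u'" by (rule piecewise_affine_continuous[OF mesh pa])
  have paI: "piecewise_affine \<T> I"
    unfolding I_def by (rule lumped_nonlinearity_coercive(1)[OF mesh D(1,2) q(1) dim pa bd])
  have IL: "I \<in> L2 D"
    by (rule continuous_closure_in_L2[OF D(1,3) piecewise_affine_continuous[OF mesh paI]])
  have coercive: "c * \<Lambda> \<le> L2_inner D u' u' - L2_inner D I u'"
  proof -
    have "\<Lambda> \<le> 20 * 2 ^ (q+3) * (LINT x|lebesgue_on D. (u' x - I x) * u' x)"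
      unfolding \<Lambda>_def I_def by (rule lumped_nonlinearity_coercive(2)[OF mesh D(1,2) q(1) dim pa bd])
    also have "(LINT x|lebesgue_on D. (u' x - I x) * u' x) = L2_inner D u' u' - L2_inner D I u'"
      using L2_inner_diff_left[OF L(2) IL L(2)] by (simp add: L2_inner_def)
    finally show ?thesis by (simp add: c_def field_simps)
  qed
  have absorb: "2 * L2_inner D u' u' \<le> c * \<Lambda> + 2 * (2 / c)\<^sup>2 * measure lebesgue D"
  proof -
    interpret finite_measure "lebesgue_on D" by (rule open_bounded_finite_measure[OF D(1,3)])
    have int: "integrable (lebesgue_on D) (\<lambda>x. \<bar>u' x\<bar> ^ (q+1))" "integrable (lebesgue_on D) (\<lambda>x. 2 * (u' x)\<^sup>2)"
      by (intro continuous_closure_integrable(2)[OF D(1,3)] continuous_intros cont)+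
    have "(LINT x|lebesgue_on D. 2 * (u' x)\<^sup>2) \<le> (LINT x|lebesgue_on D. c * \<bar>u' x\<bar> ^ (q+1) + 2 * (2 / c)\<^sup>2)"
      by (intro integral_mono int Bochner_Integration.integrable_add integrable_mult_right integrable_const square_le_power c q)
    also have "\<dots> = c * \<Lambda> + 2 * (2 / c)\<^sup>2 * measure lebesgue D"
      using int(1) D(1) by (simp add: \<Lambda>_def measure_restrict_space)
    finally show ?thesis by (simp add: L2_inner_def power2_eq_square)
  qed
  have split: "L2_inner D d u' = (L2_inner D u' u' - L2_inner D u u + L2_inner D d d) / 2"
  proof -
    have "L2_inner D d d = L2_inner D u' u' - 2 * L2_inner D u' u + L2_inner D u u"
      using L2_norm_square_diff[OF L(2,1), of 1] by (simp add: d_def)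
    moreover have "L2_inner D d u' = L2_inner D u' u' - L2_inner D u u'"
      unfolding d_def by (rule L2_inner_diff_left[OF L(2,1,2)])
    moreover have "L2_inner D u u' = L2_inner D u' u" by (rule L2_inner_commute)
    ultimately show ?thesis by simp
  qed
  have noise: "L2_inner D f u' * r \<le> L2_inner D f u * r + L2_inner D d d / 8 + 2 * L2_inner D f f * r\<^sup>2"
    if f: "f \<in> L2 D" for f r
  proof -
    have "L2_inner D f u' = L2_inner D d f + L2_inner D f u"
      using L2_inner_diff_left[OF L(2,1) f] L2_inner_commute[of D f u'] L2_inner_commute[of D f u]
      by (simp add: d_def)
    \<comment> \<open>Expanding \<open>\<parallel>d - 4 r f\<parallel>\<^sup>2 \<ge> 0\<close> gives Young's inequality with weight 1/8 on \<open>\<parallel>d\<parallel>\<^sup>2\<close>.\<close>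
    moreover have "L2_inner D d f * r \<le> L2_inner D d d / 8 + 2 * L2_inner D f f * r\<^sup>2"
    proof -
      have "0 \<le> L2_inner D (\<lambda>x. d x - (4 * r) * f x) (\<lambda>x. d x - (4 * r) * f x)"
        unfolding Lp_norm_2_squared[symmetric] by simp
      also have "\<dots> = L2_inner D d d - 8 * (L2_inner D d f * r) + 16 * (L2_inner D f f * r\<^sup>2)"
        unfolding L2_norm_square_diff[OF L(3) f] by (simp add: power_mult_distrib)
      finally show ?thesis by simp
    qed
    ultimately show ?thesis by (simp add: distrib_right)
  qed
  have "L2_inner D (\<lambda>x. \<Gamma> u x * z) u' = L2_inner D (\<Gamma> u) u' * z"
    using L2_inner_linear_combination[OF \<Gamma> \<Gamma> L(2), of z 0] by (simp add: mult.commute)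
  then have "L2_inner D d u' + \<tau> * L2_inner D (grad D u') (grad D u')
     = \<tau> * L2_inner D I u' + L2_inner D (G u) u' * w + L2_inner D (\<Gamma> u) u' * (z / 2)"
    using scheme by (simp add: I_def d_def)
  also have "\<dots> \<le> \<tau> * (L2_inner D u' u' - c * \<Lambda>)
      + (L2_inner D (G u) u * w + L2_inner D d d / 8 + 2 * L2_inner D (G u) (G u) * w\<^sup>2)
      + (L2_inner D (\<Gamma> u) u * (z / 2) + L2_inner D d d / 8 + 2 * L2_inner D (\<Gamma> u) (\<Gamma> u) * (z / 2)\<^sup>2)"
    using coercive \<tau> by (intro add_mono noise G \<Gamma> mult_left_mono) auto
  finally have "L2_inner D u' u' + L2_inner D d d / 2 + 2 * \<tau> * L2_inner D (grad D u') (grad D u')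
    \<le> L2_inner D u u + \<tau> * (2 * L2_inner D u' u' - 2 * (c * \<Lambda>)) + 2 * (L2_inner D (G u) u * w)
      + L2_inner D (\<Gamma> u) u * z + 4 * (L2_inner D (G u) (G u) * w\<^sup>2) + L2_inner D (\<Gamma> u) (\<Gamma> u) * z\<^sup>2"
    unfolding split by (simp add: field_simps power2_eq_square)
  moreover have "\<tau> * (2 * L2_inner D u' u' - 2 * (c * \<Lambda>)) \<le> \<tau> * (2 * (2 / c)\<^sup>2 * measure lebesgue D - c * \<Lambda>)"
    by (rule mult_left_mono) (use absorb \<tau> in linarith)+
  moreover have "\<tau> * (2 * (2 / c)\<^sup>2 * measure lebesgue D - c * \<Lambda>) = \<tau> * (2 * (2 / c)\<^sup>2 * measure lebesgue D) - \<tau> * c * \<Lambda>"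
    by (simp add: right_diff_distrib mult.assoc)
  ultimately show ?thesis unfolding d_def[symmetric] \<Lambda>_def[symmetric] by linarith
qed

lemma discrete_gronwall:
  fixes e r :: "nat \<Rightarrow> real"
  assumes step: "\<And>n. n < N \<Longrightarrow> e (Suc n) + r n \<le> (1 + \<kappa> * \<tau>) * e n + \<kappa> * \<tau>"
    and nn: "\<And>n. n \<le> N \<Longrightarrow> 0 \<le> e n" "\<And>n. n < N \<Longrightarrow> 0 \<le> r n"
    and \<kappa>: "\<kappa> \<ge> 0" "\<tau> \<ge> 0" "real N * \<tau> \<le> T"
  shows "\<And>n. n \<le> N \<Longrightarrow> e n \<le> exp (\<kappa> * T) * (e 0 + 1)"
    "(\<Sum>n<N. r n) \<le> e 0 + \<kappa> * T * (exp (\<kappa> * T) * (e 0 + 1) + 1)"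
proof -
  define Q where "Q = exp (\<kappa> * T) * (e 0 + 1)"
  have e0: "0 \<le> e 0" using nn(1)[of 0] by simp
  have "e n + 1 \<le> exp (\<kappa> * \<tau> * n) * (e 0 + 1)" if "n \<le> N" for n
    using that
  proof (induction n)
    case (Suc n)
    have "e (Suc n) + 1 \<le> (1 + \<kappa> * \<tau>) * (e n + 1)"
      using step[of n] nn(2)[of n] Suc.prems by (simp add: algebra_simps)
    also have "\<dots> \<le> exp (\<kappa> * \<tau>) * (exp (\<kappa> * \<tau> * n) * (e 0 + 1))"
      using Suc \<kappa> nn(1)[of n] exp_ge_add_one_self[of "\<kappa> * \<tau>"] by (intro mult_mono) auto
    also have "\<dots> = exp (\<kappa> * \<tau> * Suc n) * (e 0 + 1)"
      by (simp add: exp_add[symmetric] algebra_simps)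
    finally show ?case .
  qed simp
  moreover have "exp (\<kappa> * \<tau> * n) * (e 0 + 1) \<le> Q" if "n \<le> N" for n
  proof -
    have "real n * \<tau> \<le> real N * \<tau>" using that \<kappa> by (intro mult_right_mono) auto
    then have "\<kappa> * (real n * \<tau>) \<le> \<kappa> * T" using \<kappa> by (intro mult_left_mono) auto
    then show ?thesis unfolding Q_def using e0 by (intro mult_right_mono) (auto simp: ac_simps)
  qed
  ultimately have eQ: "e n \<le> Q" if "n \<le> N" for n using that by force
  then show "e n \<le> exp (\<kappa> * T) * (e 0 + 1)" if "n \<le> N" for n using that by (simp add: Q_def)
  have sum: "(\<Sum>n<m. r n) + e m \<le> e 0 + real m * (\<kappa> * \<tau> * (Q + 1))" if "m \<le> N" for m
    using that
  proof (induction m)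
    case (Suc m)
    have "\<kappa> * \<tau> * e m \<le> \<kappa> * \<tau> * Q" using eQ[of m] Suc.prems \<kappa> by (intro mult_left_mono) auto
    then show ?case using Suc step[of m] by (simp add: algebra_simps)
  qed simp
  have "real N * (\<kappa> * \<tau> * (Q + 1)) = (\<kappa> * (Q + 1)) * (real N * \<tau>)" by simp
  also have "\<dots> \<le> (\<kappa> * (Q + 1)) * T"
    using \<kappa> eQ[of 0] e0 by (intro mult_left_mono) auto
  finally show "(\<Sum>n<N. r n) \<le> e 0 + \<kappa> * T * (exp (\<kappa> * T) * (e 0 + 1) + 1)"
    using sum[of N] nn(1)[of N] by (simp add: Q_def ac_simps)
qed

text \<open>
The right-hand side of the pathwise inequality is integrable, its terms \<open>p\<close> and \<open>r\<close> have mean zero,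
and the moments of the increment turn the remaining ones into a multiple of \<open>\<tau>\<close>. Integrability of
the left-hand side follows, so that it propagates from one time step to the next. Since weak
gradients are arbitrary representatives, measurability of the gradient term \<open>g\<close> is not evident. It
is bounded by what the other terms leave of the right-hand side, and \<open>\<gamma>\<close> is the mean of this
measurable bound.
\<close>

lemma expected_energy_step:
  fixes a b d \<Lambda> g p r s t :: "'w \<Rightarrow> real"
  assumes M: "prob_space M" and sub: "subalgebra M F"
    and indep: "prob_space.indep_set M (sets F) {Y -` B \<inter> space M | B. B \<in> sets borel}"
    and dist: "distributed M lborel Y (normal_density 0 (sqrt \<tau>))" and \<tau>: "\<tau> > 0" "\<tau> \<le> T"
    and meas [measurable]: "a \<in> borel_measurable M" "d \<in> borel_measurable M" "\<Lambda> \<in> borel_measurable M"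
    and measF: "b \<in> borel_measurable F" "p \<in> borel_measurable F" "r \<in> borel_measurable F"
      "s \<in> borel_measurable F" "t \<in> borel_measurable F"
    and nn: "\<And>\<omega>. \<omega> \<in> space M \<Longrightarrow> 0 \<le> a \<omega>" "\<And>\<omega>. \<omega> \<in> space M \<Longrightarrow> 0 \<le> d \<omega>"
      "\<And>\<omega>. \<omega> \<in> space M \<Longrightarrow> 0 \<le> \<Lambda> \<omega>" "\<And>\<omega>. \<omega> \<in> space M \<Longrightarrow> 0 \<le> g \<omega>"
      "\<And>\<omega>. \<omega> \<in> space M \<Longrightarrow> 0 \<le> b \<omega>" "\<And>\<omega>. \<omega> \<in> space M \<Longrightarrow> 0 \<le> s \<omega>" "\<And>\<omega>. \<omega> \<in> space M \<Longrightarrow> 0 \<le> t \<omega>"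
    and bint: "integrable M b"
    and growth: "\<And>\<omega>. \<omega> \<in> space M \<Longrightarrow> s \<omega> \<le> A + A * b \<omega>" "\<And>\<omega>. \<omega> \<in> space M \<Longrightarrow> t \<omega> \<le> A + A * b \<omega>"
      "\<And>\<omega>. \<omega> \<in> space M \<Longrightarrow> \<bar>p \<omega>\<bar> \<le> s \<omega> + b \<omega>" "\<And>\<omega>. \<omega> \<in> space M \<Longrightarrow> \<bar>r \<omega>\<bar> \<le> t \<omega> + b \<omega>"
    and energy: "AE \<omega> in M. a \<omega> + d \<omega> / 2 + 2 * \<tau> * g \<omega> + \<tau> * c * \<Lambda> \<omega>
      \<le> b \<omega> + \<tau> * K + 2 * p \<omega> * Y \<omega> + r \<omega> * ((Y \<omega>)\<^sup>2 - \<tau>) + 4 * s \<omega> * (Y \<omega>)\<^sup>2 + t \<omega> * ((Y \<omega>)\<^sup>2 - \<tau>)\<^sup>2"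
    and c: "c > 0" and A: "A \<ge> 0" and K: "K \<ge> 0"
  defines "\<kappa> \<equiv> K + (4 + 2 * T) * A"
  shows "integrable M a" "integrable M d" "integrable M \<Lambda>"
    "\<exists>\<gamma>\<ge>0. (\<integral>\<^sup>+ \<omega>. ennreal (g \<omega>) \<partial>M) \<le> ennreal \<gamma> \<and>
      (LINT \<omega>|M. a \<omega>) + ((LINT \<omega>|M. d \<omega>) / 2 + \<tau> * \<gamma> + \<tau> * c * (LINT \<omega>|M. \<Lambda> \<omega>))
        \<le> (1 + \<kappa> * \<tau>) * (LINT \<omega>|M. b \<omega>) + \<kappa> * \<tau>"
proof -
  interpret prob_space M by (fact M)
  have [measurable]: "b \<in> borel_measurable M" "p \<in> borel_measurable M" "r \<in> borel_measurable M"
      "s \<in> borel_measurable M" "t \<in> borel_measurable M"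
    using measF by (auto intro: measurable_from_subalg[OF sub])
  have Ym [measurable]: "Y \<in> borel_measurable M" using distributed_measurable[OF dist] by simp
  have Ab: "integrable M (\<lambda>\<omega>. A + A * b \<omega>)" "integrable M (\<lambda>\<omega>. A + A * b \<omega> + b \<omega>)" using bint by auto
  have int: "integrable M s" "integrable M t" "integrable M p" "integrable M r"
  proof -
    show "integrable M s" "integrable M t"
      using growth(1,2) nn(6,7) by (auto intro!: Bochner_Integration.integrable_bound[OF Ab(1)] AE_I2 order_trans[OF _ abs_ge_self])
    show "integrable M p" "integrable M r"
      using growth by (auto intro!: Bochner_Integration.integrable_bound[OF Ab(2)] AE_I2 order_trans[OF _ abs_ge_self]) force+
  qed
  note moments = centered_normal_moments[OF dist \<tau>(1)]
  have z1: "has_bochner_integral M (\<lambda>\<omega>. (Y \<omega>)\<^sup>2 - \<tau>) (\<tau> - \<tau>)"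
    using moments(2) by (simp add: has_bochner_integral_iff prob_space)
  have z2: "has_bochner_integral M (\<lambda>\<omega>. ((Y \<omega>)\<^sup>2 - \<tau>)\<^sup>2) (2 * \<tau>\<^sup>2)"
  proof -
    have "integrable M (\<lambda>\<omega>. (Y \<omega>) ^ 4 - 2 * \<tau> * (Y \<omega>)\<^sup>2 + \<tau>\<^sup>2)"
      "(LINT \<omega>|M. (Y \<omega>) ^ 4 - 2 * \<tau> * (Y \<omega>)\<^sup>2 + \<tau>\<^sup>2) = 2 * \<tau>\<^sup>2"
      using moments(2,3) by (auto simp: has_bochner_integral_iff prob_space power2_eq_square)
    moreover have "(\<lambda>\<omega>. (Y \<omega>) ^ 4 - 2 * \<tau> * (Y \<omega>)\<^sup>2 + \<tau>\<^sup>2) = (\<lambda>\<omega>. ((Y \<omega>)\<^sup>2 - \<tau>)\<^sup>2)"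
      by (simp add: fun_eq_iff power2_eq_square algebra_simps eval_nat_numeral)
    ultimately show ?thesis by (simp add: has_bochner_integral_iff)
  qed
  note product = independent_increment_product[OF M sub indep Ym]
  have P: "has_bochner_integral M (\<lambda>\<omega>. p \<omega> * Y \<omega>) (expectation p * 0)"
    by (rule product[OF measF(2) int(3), of "\<lambda>x. x"]) (use moments in auto)
  have R: "has_bochner_integral M (\<lambda>\<omega>. r \<omega> * ((Y \<omega>)\<^sup>2 - \<tau>)) (expectation r * (\<tau> - \<tau>))"
    by (rule product[OF measF(3) int(4), of "\<lambda>x. x\<^sup>2 - \<tau>"]) (use z1 in auto)
  have S: "has_bochner_integral M (\<lambda>\<omega>. s \<omega> * (Y \<omega>)\<^sup>2) (expectation s * \<tau>)"
    by (rule product[OF measF(4) int(1), of "\<lambda>x. x\<^sup>2"]) (use moments in auto)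
  have Tt: "has_bochner_integral M (\<lambda>\<omega>. t \<omega> * ((Y \<omega>)\<^sup>2 - \<tau>)\<^sup>2) (expectation t * (2 * \<tau>\<^sup>2))"
    by (rule product[OF measF(5) int(2), of "\<lambda>x. (x\<^sup>2 - \<tau>)\<^sup>2"]) (use z2 in auto)
  define Z where "Z = (\<lambda>\<omega>. b \<omega> + \<tau> * K + 2 * (p \<omega> * Y \<omega>) + r \<omega> * ((Y \<omega>)\<^sup>2 - \<tau>)
    + 4 * (s \<omega> * (Y \<omega>)\<^sup>2) + t \<omega> * ((Y \<omega>)\<^sup>2 - \<tau>)\<^sup>2)"
  have Zint: "integrable M Z" and EZ: "expectation Z = expectation b + \<tau> * K + 4 * (expectation s * \<tau>) + expectation t * (2 * \<tau>\<^sup>2)"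
    using P R S Tt bint by (auto simp: Z_def has_bochner_integral_iff prob_space)
  have AEZ: "AE \<omega> in M. a \<omega> + d \<omega> / 2 + 2 * \<tau> * g \<omega> + \<tau> * c * \<Lambda> \<omega> \<le> Z \<omega>"
    using energy by eventually_elim (simp add: Z_def ac_simps)
  have parts: "AE \<omega> in M. 0 \<le> a \<omega> \<and> 0 \<le> d \<omega> / 2 \<and> 0 \<le> \<tau> * g \<omega> \<and> 0 \<le> \<tau> * c * \<Lambda> \<omega>"
    using nn \<tau> c by (intro AE_I2) auto
  show aint: "integrable M a"
    by (rule Bochner_Integration.integrable_bound[OF Zint]) (use AEZ parts in \<open>auto\<close>)
  have "integrable M (\<lambda>\<omega>. d \<omega> / 2)"
    by (rule Bochner_Integration.integrable_bound[OF Zint]) (use AEZ parts in \<open>auto\<close>)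
  then show dint: "integrable M d" using integrable_mult_right[of 2 M "\<lambda>\<omega>. d \<omega> / 2"] by simp
  have "integrable M (\<lambda>\<omega>. \<tau> * c * \<Lambda> \<omega>)"
    by (rule Bochner_Integration.integrable_bound[OF Zint]) (use AEZ parts in \<open>auto\<close>)
  then show \<Lambda>int: "integrable M \<Lambda>" using \<tau> c by simp
  \<comment> \<open>A measurable upper bound of \<open>\<tau> * g\<close>.\<close>
  define Q where "Q = (\<lambda>\<omega>. Z \<omega> - a \<omega> - d \<omega> / 2 - \<tau> * c * \<Lambda> \<omega>)"
  have Qint: "integrable M Q" and EQ: "expectation Q = expectation Z - expectation a - expectation d / 2 - \<tau> * c * expectation \<Lambda>"
    using Zint aint dint \<Lambda>int by (auto simp: Q_def)
  have Qg: "AE \<omega> in M. \<tau> * g \<omega> \<le> Q \<omega> \<and> 0 \<le> Q \<omega>"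
    using AEZ parts by eventually_elim (auto simp: Q_def)
  define \<gamma> where "\<gamma> = expectation Q / \<tau>"
  have Q0: "0 \<le> expectation Q" using Qg by (intro integral_nonneg_AE) auto
  have "(\<integral>\<^sup>+ \<omega>. ennreal (g \<omega>) \<partial>M) \<le> (\<integral>\<^sup>+ \<omega>. ennreal (Q \<omega> / \<tau>) \<partial>M)"
    using Qg by (intro nn_integral_mono_AE, eventually_elim) (use \<tau> in \<open>auto simp: field_simps intro!: ennreal_leI\<close>)
  also have "\<dots> = ennreal \<gamma>"
    unfolding \<gamma>_def using Qint Qg \<tau> by (subst nn_integral_eq_integral) auto
  finally have g\<gamma>: "(\<integral>\<^sup>+ \<omega>. ennreal (g \<omega>) \<partial>M) \<le> ennreal \<gamma>" .
  define B where "B = expectation b"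
  have B0: "0 \<le> B" unfolding B_def using nn by (intro integral_nonneg_AE AE_I2) auto
  have "expectation s \<le> (LINT \<omega>|M. A + A * b \<omega>)" "expectation t \<le> (LINT \<omega>|M. A + A * b \<omega>)"
    by (rule integral_mono[OF int(1) Ab(1) growth(1)], assumption)
       (rule integral_mono[OF int(2) Ab(1) growth(2)], assumption)
  then have st: "expectation s \<le> A + A * B" "expectation t \<le> A + A * B"
    using bint by (simp_all add: prob_space B_def)
  have "expectation Z \<le> B + \<tau> * K + 4 * ((A + A * B) * \<tau>) + (A + A * B) * (2 * (T * \<tau>))"
  proof -
    have "\<tau>\<^sup>2 \<le> T * \<tau>" using \<tau> by (simp add: power2_eq_square)
    then have "expectation t * (2 * \<tau>\<^sup>2) \<le> (A + A * B) * (2 * (T * \<tau>))"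
      using st(2) A B0 by (intro mult_mono) auto
    moreover have "expectation s * \<tau> \<le> (A + A * B) * \<tau>" using st \<tau> by (intro mult_right_mono) auto
    ultimately show ?thesis unfolding EZ B_def by linarith
  qed
  also have "\<dots> = B + (4 + 2 * T) * A * \<tau> * B + \<kappa> * \<tau>" by (simp add: \<kappa>_def algebra_simps)
  also have "\<dots> \<le> (1 + \<kappa> * \<tau>) * B + \<kappa> * \<tau>"
    using K \<tau> B0 by (simp add: \<kappa>_def algebra_simps)
  finally have "expectation a + (expectation d / 2 + \<tau> * \<gamma> + \<tau> * c * expectation \<Lambda>) \<le> (1 + \<kappa> * \<tau>) * B + \<kappa> * \<tau>"
    using EQ \<tau> by (simp add: \<gamma>_def)
  then show "\<exists>\<gamma>\<ge>0. (\<integral>\<^sup>+ \<omega>. ennreal (g \<omega>) \<partial>M) \<le> ennreal \<gamma> \<and>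
      (LINT \<omega>|M. a \<omega>) + ((LINT \<omega>|M. d \<omega>) / 2 + \<tau> * \<gamma> + \<tau> * c * (LINT \<omega>|M. \<Lambda> \<omega>))
        \<le> (1 + \<kappa> * \<tau>) * (LINT \<omega>|M. b \<omega>) + \<kappa> * \<tau>"
    using g\<gamma> Q0 \<tau> by (intro exI[of _ \<gamma>]) (auto simp: B_def \<gamma>_def)
qed

section \<open>The uniform bound\<close>

text \<open>
The data on which the final constant may depend. The mesh, the number of time steps and the
solution are quantified in the lemmas below.
\<close>

locale milstein_setting =
  fixes D :: "'a::euclidean_space set" and q :: nat and T :: real
    and G :: "('a \<Rightarrow> real) \<Rightarrow> 'a \<Rightarrow> real" and DG :: "('a \<Rightarrow> real) \<Rightarrow> ('a \<Rightarrow> real) \<Rightarrow> 'a \<Rightarrow> real"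
    and M :: "'w measure" and \<F> :: "real \<Rightarrow> 'w measure" and W :: "real \<Rightarrow> 'w \<Rightarrow> real" and u0 :: "'a \<Rightarrow> real" and C :: real
  assumes D: "open D" "convex D" "bounded D" and q: "odd q" "q \<ge> 3"
    and dim: "DIM('a) = 2 \<or> DIM('a) = 3 \<and> q \<in> {3, 5}" and T: "T > 0"
    and filtered: "filtered_prob_space M \<F>" and wiener: "wiener_process M \<F> W"
    and lip: "L2_lipschitz D C G" "L2_lipschitz D C (\<lambda>v. DG v (G v))" and u0: "u0 \<in> L2 D"
begin

lemma prob: "prob_space M" and sub: "subalgebra M (\<F> t)"
  using filtered by (auto simp: filtered_prob_space_def)

text \<open>
The constants of the estimate: linear growth of the noise, coercivity of the nonlinearity, the
remainder of absorbing the reaction term, and the resulting rate in the Gronwall inequality.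
\<close>

definition "growth_const = 2 * (Lp_norm D 2 (G (\<lambda>_. 0)))\<^sup>2 + 2 * (Lp_norm D 2 (DG (\<lambda>_. 0) (G (\<lambda>_. 0))))\<^sup>2 + 2 * C\<^sup>2"
definition "coercivity_const = (1 / (20 * 2 ^ (q + 3)) :: real)"
definition "absorption_const = 2 * (2 / coercivity_const)\<^sup>2 * measure lebesgue D"
definition "gronwall_rate = absorption_const + (4 + 2 * T) * growth_const"

lemma constants: "0 \<le> growth_const" "0 < coercivity_const" "0 \<le> absorption_const" "0 \<le> gronwall_rate"
proof -
  show "0 \<le> growth_const" "0 < coercivity_const" by (simp_all add: growth_const_def coercivity_const_def)
  show "0 \<le> absorption_const" by (simp add: absorption_const_def)
  then show "0 \<le> gronwall_rate" using \<open>0 \<le> growth_const\<close> T by (simp add: gronwall_rate_def)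
qed

lemma L2_inner_self_nonneg: "0 \<le> L2_inner D f f"
  unfolding Lp_norm_2_squared[symmetric] by simp

lemma growth:
  assumes v: "v \<in> L2 D"
  shows "L2_inner D (G v) (G v) \<le> growth_const + growth_const * L2_inner D v v"
    "L2_inner D (DG v (G v)) (DG v (G v)) \<le> growth_const + growth_const * L2_inner D v v"
proof -
  have "2 * C\<^sup>2 * L2_inner D v v \<le> growth_const * L2_inner D v v"
    by (intro mult_right_mono L2_inner_self_nonneg) (simp add: growth_const_def)
  moreover have "2 * (Lp_norm D 2 (G (\<lambda>_. 0)))\<^sup>2 \<le> growth_const" "2 * (Lp_norm D 2 (DG (\<lambda>_. 0) (G (\<lambda>_. 0))))\<^sup>2 \<le> growth_const"
    by (simp_all add: growth_const_def)
  ultimately show "L2_inner D (G v) (G v) \<le> growth_const + growth_const * L2_inner D v v"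
    "L2_inner D (DG v (G v)) (DG v (G v)) \<le> growth_const + growth_const * L2_inner D v v"
    using L2_lipschitz_growth[OF lip(1) v] L2_lipschitz_growth[OF lip(2) v]
    unfolding Lp_norm_2_squared by linarith+
qed

lemma inner_le_squares:
  fixes f v :: "'a \<Rightarrow> real"
  assumes "f \<in> L2 D" "v \<in> L2 D"
  shows "\<bar>L2_inner D f v\<bar> \<le> L2_inner D f f + L2_inner D v v"
proof -
  have "2 * (Lp_norm D 2 f * Lp_norm D 2 v) \<le> (Lp_norm D 2 f)\<^sup>2 + (Lp_norm D 2 v)\<^sup>2"
    using sum_squares_bound[of "Lp_norm D 2 f" "Lp_norm D 2 v"] by simp
  then show ?thesis
    using L2_Cauchy_Schwarz[OF assms] L2_inner_self_nonneg[of f] L2_inner_self_nonneg[of v]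
    unfolding Lp_norm_2_squared by linarith
qed

text \<open>
An orthogonal projection does not increase the norm.
\<close>

lemma initial_energy:
  assumes mesh: "mesh_of D \<T>" and sol: "scheme_solution D \<T> q G DG M \<F> W u0 T N u"
  shows "integrable M (\<lambda>\<omega>. L2_inner D (u 0 \<omega>) (u 0 \<omega>))"
    "(LINT \<omega>|M. L2_inner D (u 0 \<omega>) (u 0 \<omega>)) \<le> (Lp_norm D 2 u0)\<^sup>2"
proof -
  interpret prob_space M by (rule prob)
  have fe: "\<forall>n\<le>N. \<forall>\<omega>\<in>space M. u n \<omega> \<in> fe_space D \<T>"
    and eval: "\<forall>n\<le>N. \<forall>x\<in>closure D. (\<lambda>\<omega>. u n \<omega> x) \<in> borel_measurable (\<F> (real n * (T / real N)))"
    and init: "AE \<omega> in M. is_L2_projection D (fe_space D \<T>) u0 (u 0 \<omega>)"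
    using sol by (simp_all add: scheme_solution_def Let_def)
  have "(\<lambda>\<omega>. u 0 \<omega> x) \<in> borel_measurable M" if "x \<in> closure D" for x
    using eval that by (intro measurable_from_subalg[OF sub]) blast
  then interpret X: random_fe_function D \<T> M "u 0"
    by unfold_locales (use mesh D fe in auto)
  have meas: "(\<lambda>\<omega>. L2_inner D (u 0 \<omega>) (u 0 \<omega>)) \<in> borel_measurable M"
    by (rule X.lipschitz_inner_measurable[OF L2_lipschitz_id L2_lipschitz_id])
  have bound: "AE \<omega> in M. L2_inner D (u 0 \<omega>) (u 0 \<omega>) \<le> (Lp_norm D 2 u0)\<^sup>2"
    using init AE_space
  proof eventually_elim
    case (elim \<omega>)
    have v: "u 0 \<omega> \<in> fe_space D \<T>" using fe elim(2) by blast
    define n where "n = Lp_norm D 2 (u 0 \<omega>)"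
    have n0: "0 \<le> n" unfolding n_def by (rule Lp_norm_nonneg) simp
    have "n\<^sup>2 = L2_inner D u0 (u 0 \<omega>)"
      using elim(1) v by (simp add: is_L2_projection_def n_def Lp_norm_2_squared)
    also have "\<dots> \<le> Lp_norm D 2 u0 * n"
      using L2_Cauchy_Schwarz[OF u0 fe_space_L2[OF v]] by (simp add: n_def)
    finally have "n \<le> Lp_norm D 2 u0"
      using n0 Lp_norm_nonneg[of 2 D u0] by (cases "n = 0") (auto simp: power2_eq_square)
    then show ?case using n0 unfolding Lp_norm_2_squared[symmetric] n_def[symmetric] by (intro power_mono)
  qed
  show int: "integrable M (\<lambda>\<omega>. L2_inner D (u 0 \<omega>) (u 0 \<omega>))"
  proof (rule integrable_const_bound[of _ "(Lp_norm D 2 u0)\<^sup>2"])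
    show "AE \<omega> in M. norm (L2_inner D (u 0 \<omega>) (u 0 \<omega>)) \<le> (Lp_norm D 2 u0)\<^sup>2"
      using bound by eventually_elim (simp add: L2_inner_self_nonneg)
  qed (rule meas)
  show "(LINT \<omega>|M. L2_inner D (u 0 \<omega>) (u 0 \<omega>)) \<le> (Lp_norm D 2 u0)\<^sup>2"
    using integral_mono_AE[OF int integrable_const bound] by (simp add: prob_space)
qed

lemma one_step:
  assumes mesh: "mesh_of D \<T>" and sol: "scheme_solution D \<T> q G DG M \<F> W u0 T N u" and n: "n < N"
    and int: "integrable M (\<lambda>\<omega>. L2_inner D (u n \<omega>) (u n \<omega>))"
  defines "\<tau> \<equiv> T / real N" 
  defines "d \<equiv> \<lambda>\<omega>. L2_inner D (\<lambda>x. u (Suc n) \<omega> x - u n \<omega> x) (\<lambda>x. u (Suc n) \<omega> x - u n \<omega> x)"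
    and "\<Lambda> \<equiv> \<lambda>\<omega>. LINT x|lebesgue_on D. \<bar>u (Suc n) \<omega> x\<bar> ^ (q+1)"
  shows "integrable M (\<lambda>\<omega>. L2_inner D (u (Suc n) \<omega>) (u (Suc n) \<omega>))" "integrable M d" "integrable M \<Lambda>"
    "\<exists>\<gamma>\<ge>0. (\<integral>\<^sup>+ \<omega>. ennreal (L2_inner D (grad D (u (Suc n) \<omega>)) (grad D (u (Suc n) \<omega>))) \<partial>M) \<le> ennreal \<gamma> \<and>
      (LINT \<omega>|M. L2_inner D (u (Suc n) \<omega>) (u (Suc n) \<omega>))
        + ((LINT \<omega>|M. d \<omega>) / 2 + \<tau> * \<gamma> + \<tau> * coercivity_const * (LINT \<omega>|M. \<Lambda> \<omega>))
        \<le> (1 + gronwall_rate * \<tau>) * (LINT \<omega>|M. L2_inner D (u n \<omega>) (u n \<omega>)) + gronwall_rate * \<tau>"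
proof -
  interpret prob_space M by (rule prob)
  define F where "F = \<F> (real n * \<tau>)"
  define Y where "Y = (\<lambda>\<omega>. W (real (Suc n) * \<tau>) \<omega> - W (real n * \<tau>) \<omega>)"
  have \<tau>: "0 < \<tau>" "\<tau> \<le> T" using T n by (auto simp: \<tau>_def field_simps)
  have fe: "\<forall>n\<le>N. \<forall>\<omega>\<in>space M. u n \<omega> \<in> fe_space D \<T>"
    and eval: "\<forall>n\<le>N. \<forall>x\<in>closure D. (\<lambda>\<omega>. u n \<omega> x) \<in> borel_measurable (\<F> (real n * \<tau>))"
    and scheme: "AE \<omega> in M. \<forall>n<N. \<forall>v\<in>fe_space D \<T>.
           L2_inner D (\<lambda>x. u (Suc n) \<omega> x - u n \<omega> x) v
             + \<tau> * L2_inner D (grad D (u (Suc n) \<omega>)) (grad D v)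
           = \<tau> * L2_inner D (nodal_interpolant D \<T> (\<lambda>x. u (Suc n) \<omega> x - (u (Suc n) \<omega> x) ^ q)) v
             + L2_inner D (G (u n \<omega>)) v * (W (real (Suc n) * \<tau>) \<omega> - W (real n * \<tau>) \<omega>)
             + 1 / 2 * L2_inner D (\<lambda>x. DG (u n \<omega>) (G (u n \<omega>)) x * ((W (real (Suc n) * \<tau>) \<omega> - W (real n * \<tau>) \<omega>)\<^sup>2 - \<tau>)) v"
    using sol by (simp_all add: scheme_solution_def Let_def \<tau>_def)
  have diff: "real (Suc n) * \<tau> - real n * \<tau> = \<tau>" by (simp add: algebra_simps)
  have times: "0 \<le> real n * \<tau>" "real n * \<tau> < real (Suc n) * \<tau>" using \<tau> by auto
  have "\<forall>s\<ge>0. \<forall>t>s. distributed M lborel (\<lambda>\<omega>. W t \<omega> - W s \<omega>) (normal_density 0 (sqrt (t - s))) \<and>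
      indep_set (sets (\<F> s)) {(\<lambda>\<omega>. W t \<omega> - W s \<omega>) -` B \<inter> space M | B. B \<in> sets borel}"
    using wiener unfolding wiener_process_def by (elim conjE)
  from this[rule_format, OF times]
  have dist: "distributed M lborel Y (normal_density 0 (sqrt \<tau>))"
    and indep: "indep_set (sets F) {Y -` B \<inter> space M | B. B \<in> sets borel}"
    unfolding Y_def F_def diff by (rule conjunct1, rule conjunct2)
  have spF: "space F = space M" using sub by (simp add: F_def subalgebra_def)
  have subF: "subalgebra M F" by (simp add: F_def sub)
  have n': "n \<le> N" "Suc n \<le> N" using n by auto
  have evalF: "(\<lambda>\<omega>. u n \<omega> x) \<in> borel_measurable F" if "x \<in> closure D" for x
    using eval n'(1) that unfolding F_def by blast
  have evalM: "(\<lambda>\<omega>. u m \<omega> x) \<in> borel_measurable M" if "m \<le> N" "x \<in> closure D" for m x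
    using eval that by (intro measurable_from_subalg[OF sub]) blast
  interpret XF: random_fe_function D \<T> F "u n"
    by unfold_locales (use mesh D fe evalF spF n' in auto)
  interpret X: random_fe_function D \<T> M "u n"
    by unfold_locales (use mesh D fe evalM n' in auto)
  interpret X': random_fe_function D \<T> M "u (Suc n)"
    by unfold_locales (use mesh D fe evalM n' in auto)
  have L2: "u n \<omega> \<in> L2 D" "G (u n \<omega>) \<in> L2 D" "DG (u n \<omega>) (G (u n \<omega>)) \<in> L2 D" if "\<omega> \<in> space M" for \<omega>
    using fe_space_L2[OF X.fe[OF that]] lip by (auto simp: L2_lipschitz_def)
  note [measurable] = X.jointly_measurable X'.jointly_measurable
  have dm: "d \<in> borel_measurable M"
    unfolding d_def L2_inner_def inner_real_def by (rule X.integral_measurable) measurable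
  have \<Lambda>m: "\<Lambda> \<in> borel_measurable M"
    unfolding \<Lambda>_def by (rule X'.integral_measurable) measurable
  have energy: "AE \<omega> in M. L2_inner D (u (Suc n) \<omega>) (u (Suc n) \<omega>) + d \<omega> / 2
      + 2 * \<tau> * L2_inner D (grad D (u (Suc n) \<omega>)) (grad D (u (Suc n) \<omega>)) + \<tau> * coercivity_const * \<Lambda> \<omega>
    \<le> L2_inner D (u n \<omega>) (u n \<omega>) + \<tau> * absorption_const + 2 * L2_inner D (G (u n \<omega>)) (u n \<omega>) * Y \<omega>
      + L2_inner D (DG (u n \<omega>) (G (u n \<omega>))) (u n \<omega>) * ((Y \<omega>)\<^sup>2 - \<tau>)
      + 4 * L2_inner D (G (u n \<omega>)) (G (u n \<omega>)) * (Y \<omega>)\<^sup>2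
      + L2_inner D (DG (u n \<omega>) (G (u n \<omega>))) (DG (u n \<omega>) (G (u n \<omega>))) * ((Y \<omega>)\<^sup>2 - \<tau>)\<^sup>2"
    using scheme AE_space
  proof eventually_elim
    case (elim \<omega>)
    have "u (Suc n) \<omega> \<in> fe_space D \<T>" using X'.fe[OF elim(2)] .
    note s = elim(1)[rule_format, OF n this, folded Y_def]
    show ?case
      unfolding d_def \<Lambda>_def coercivity_const_def absorption_const_def
      by (rule energy_inequality[OF mesh D q dim X.fe[OF elim(2)] X'.fe[OF elim(2)],
            where \<Gamma> = "\<lambda>v. DG v (G v)"])
        (use s L2[OF elim(2)] \<tau> in \<open>simp_all add: Y_def\<close>)
  qed
  note step = expected_energy_step[OF prob subF indep dist \<tau>
      X'.lipschitz_inner_measurable[OF L2_lipschitz_id L2_lipschitz_id] dm \<Lambda>m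
      XF.lipschitz_inner_measurable[OF L2_lipschitz_id L2_lipschitz_id]
      XF.lipschitz_inner_measurable[OF lip(1) L2_lipschitz_id]
      XF.lipschitz_inner_measurable[OF lip(2) L2_lipschitz_id]
      XF.lipschitz_inner_measurable[OF lip(1) lip(1)]
      XF.lipschitz_inner_measurable[OF lip(2) lip(2)]
      L2_inner_self_nonneg _ _ L2_inner_self_nonneg L2_inner_self_nonneg L2_inner_self_nonneg L2_inner_self_nonneg
      int _ _ _ _ energy constants(2) constants(1) constants(3), folded gronwall_rate_def]
  have side: "0 \<le> d \<omega>" "0 \<le> \<Lambda> \<omega>" for \<omega>
    by (auto simp: d_def \<Lambda>_def L2_inner_self_nonneg)
  show "integrable M (\<lambda>\<omega>. L2_inner D (u (Suc n) \<omega>) (u (Suc n) \<omega>))"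
    by (rule step(1)) (use side growth L2 inner_le_squares in auto)
  show "integrable M d"
    by (rule step(2)) (use side growth L2 inner_le_squares in auto)
  show "integrable M \<Lambda>"
    by (rule step(3)) (use side growth L2 inner_le_squares in auto)
  show "\<exists>\<gamma>\<ge>0. (\<integral>\<^sup>+ \<omega>. ennreal (L2_inner D (grad D (u (Suc n) \<omega>)) (grad D (u (Suc n) \<omega>))) \<partial>M) \<le> ennreal \<gamma> \<and>
      (LINT \<omega>|M. L2_inner D (u (Suc n) \<omega>) (u (Suc n) \<omega>))
        + ((LINT \<omega>|M. d \<omega>) / 2 + \<tau> * \<gamma> + \<tau> * coercivity_const * (LINT \<omega>|M. \<Lambda> \<omega>))
        \<le> (1 + gronwall_rate * \<tau>) * (LINT \<omega>|M. L2_inner D (u n \<omega>) (u n \<omega>)) + gronwall_rate * \<tau>"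
    by (rule step(4)) (use side growth L2 inner_le_squares in auto)
qed

definition "sup_bound = exp (gronwall_rate * T) * ((Lp_norm D 2 u0)\<^sup>2 + 1)"
definition "sum_bound = (Lp_norm D 2 u0)\<^sup>2 + gronwall_rate * T * (sup_bound + 1)"

lemma energy_bound:
  assumes mesh: "mesh_of D \<T>" and sol: "scheme_solution D \<T> q G DG M \<F> W u0 T N u" and N: "N \<ge> 1"
  shows "(SUP n\<in>{..N}. \<integral>\<^sup>+ \<omega>. ennreal ((Lp_norm D 2 (u n \<omega>))\<^sup>2) \<partial>M)
           + (\<Sum>n<N. \<integral>\<^sup>+ \<omega>. ennreal ((Lp_norm D 2 (\<lambda>x. u (Suc n) \<omega> x - u n \<omega> x))\<^sup>2) \<partial>M)
           + ennreal (T / real N) *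
               (\<Sum>n<N. \<integral>\<^sup>+ \<omega>. ennreal ((Lp_norm D 2 (grad D (u (Suc n) \<omega>)))\<^sup>2) \<partial>M)
           + ennreal (T / real N / 2) *
               (\<Sum>n<N. \<integral>\<^sup>+ \<omega>. ennreal ((Lp_norm D (q + 1) (u (Suc n) \<omega>)) ^ (q + 1)) \<partial>M)
           \<le> ennreal (sup_bound + 2 * sum_bound + sum_bound + sum_bound / (2 * coercivity_const))"
proof -
  interpret prob_space M by (rule prob)
  define \<tau> where "\<tau> = T / real N"
  have \<tau>: "0 < \<tau>" "real N * \<tau> = T" using T N by (auto simp: \<tau>_def)
  define a where "a = (\<lambda>n \<omega>. L2_inner D (u n \<omega>) (u n \<omega>))"
  define d where "d = (\<lambda>n \<omega>. L2_inner D (\<lambda>x. u (Suc n) \<omega> x - u n \<omega> x) (\<lambda>x. u (Suc n) \<omega> x - u n \<omega> x))"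
  define g where "g = (\<lambda>n \<omega>. L2_inner D (grad D (u (Suc n) \<omega>)) (grad D (u (Suc n) \<omega>)))"
  define \<Lambda> where "\<Lambda> = (\<lambda>n \<omega>. LINT x|lebesgue_on D. \<bar>u (Suc n) \<omega> x\<bar> ^ (q+1))"
  have nonneg: "0 \<le> a n \<omega>" "0 \<le> d n \<omega>" "0 \<le> \<Lambda> n \<omega>" for n \<omega>
    by (simp_all add: a_def d_def \<Lambda>_def L2_inner_self_nonneg)
  have aint: "integrable M (a n)" if "n \<le> N" for n
    using that
  proof (induction n)
    case 0
    show ?case unfolding a_def by (rule initial_energy(1)[OF mesh sol])
  next
    case (Suc n)
    then show ?case using one_step(1)[OF mesh sol, of n] by (simp add: a_def)
  qed
  have dint: "integrable M (d n)" and \<Lambda>int: "integrable M (\<Lambda> n)" if "n < N" for n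
    using one_step(2,3)[OF mesh sol that] aint[of n] that by (simp_all add: a_def d_def \<Lambda>_def)
  have "\<forall>n\<in>{..<N}. \<exists>\<gamma>\<ge>0. (\<integral>\<^sup>+ \<omega>. ennreal (g n \<omega>) \<partial>M) \<le> ennreal \<gamma> \<and>
      expectation (a (Suc n)) + (expectation (d n) / 2 + \<tau> * \<gamma> + \<tau> * coercivity_const * expectation (\<Lambda> n))
        \<le> (1 + gronwall_rate * \<tau>) * expectation (a n) + gronwall_rate * \<tau>"
  proof
    fix n assume "n \<in> {..<N}"
    then have n: "n < N" by simp
    show "\<exists>\<gamma>\<ge>0. (\<integral>\<^sup>+ \<omega>. ennreal (g n \<omega>) \<partial>M) \<le> ennreal \<gamma> \<and>
      expectation (a (Suc n)) + (expectation (d n) / 2 + \<tau> * \<gamma> + \<tau> * coercivity_const * expectation (\<Lambda> n))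
        \<le> (1 + gronwall_rate * \<tau>) * expectation (a n) + gronwall_rate * \<tau>"
      using one_step(4)[OF mesh sol n aint[of n, unfolded a_def]] n
      unfolding a_def d_def g_def \<Lambda>_def \<tau>_def by simp
  qed
  then obtain \<gamma> where \<gamma>: "\<forall>n\<in>{..<N}. 0 \<le> \<gamma> n \<and> (\<integral>\<^sup>+ \<omega>. ennreal (g n \<omega>) \<partial>M) \<le> ennreal (\<gamma> n) \<and>
      expectation (a (Suc n)) + (expectation (d n) / 2 + \<tau> * \<gamma> n + \<tau> * coercivity_const * expectation (\<Lambda> n))
        \<le> (1 + gronwall_rate * \<tau>) * expectation (a n) + gronwall_rate * \<tau>"
    by metis
  have Enn: "0 \<le> expectation (a n)" "0 \<le> expectation (d n)" "0 \<le> expectation (\<Lambda> n)" for n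
    by (auto intro!: integral_nonneg_AE AE_I2 nonneg)
  define r where "r = (\<lambda>n. expectation (d n) / 2 + \<tau> * \<gamma> n + \<tau> * coercivity_const * expectation (\<Lambda> n))"
  have r0: "0 \<le> r n" if "n < N" for n
    using that \<gamma> \<tau> Enn constants by (auto simp: r_def)
  have E0: "expectation (a 0) \<le> (Lp_norm D 2 u0)\<^sup>2"
    unfolding a_def by (rule initial_energy(2)[OF mesh sol])
  have gron: "\<And>n. n \<le> N \<Longrightarrow> expectation (a n) \<le> exp (gronwall_rate * T) * (expectation (a 0) + 1)"
    "(\<Sum>n<N. r n) \<le> expectation (a 0) + gronwall_rate * T * (exp (gronwall_rate * T) * (expectation (a 0) + 1) + 1)"
    using discrete_gronwall[of N "\<lambda>n. expectation (a n)" r gronwall_rate \<tau> T] \<gamma> r0 Enn constants \<tau>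
    by (auto simp: r_def)
  have QE: "exp (gronwall_rate * T) * (expectation (a 0) + 1) \<le> sup_bound"
    unfolding sup_bound_def using E0 by (intro mult_left_mono) auto
  have aQ: "expectation (a n) \<le> sup_bound" if "n \<le> N" for n using gron(1)[OF that] QE by linarith
  have "gronwall_rate * T * (exp (gronwall_rate * T) * (expectation (a 0) + 1) + 1) \<le> gronwall_rate * T * (sup_bound + 1)"
    using QE constants T by (intro mult_left_mono) auto
  then have rS: "(\<Sum>n<N. r n) \<le> sum_bound" using gron(2) E0 unfolding sum_bound_def by linarith
  have sums: "(\<Sum>n<N. expectation (d n)) / 2 + \<tau> * (\<Sum>n<N. \<gamma> n) + \<tau> * coercivity_const * (\<Sum>n<N. expectation (\<Lambda> n)) \<le> sum_bound"
    using rS by (simp add: r_def sum.distrib sum_divide_distrib sum_distrib_left)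
  have sn: "0 \<le> (\<Sum>n<N. expectation (d n))" "0 \<le> (\<Sum>n<N. \<gamma> n)" "0 \<le> (\<Sum>n<N. expectation (\<Lambda> n))"
    using Enn \<gamma> by (auto intro!: sum_nonneg)
  have sn': "0 \<le> \<tau> * (\<Sum>n<N. \<gamma> n)" "0 \<le> \<tau> * coercivity_const * (\<Sum>n<N. expectation (\<Lambda> n))"
    using sn \<tau> constants by auto
  have dS: "(\<Sum>n<N. expectation (d n)) \<le> 2 * sum_bound" and gS: "\<tau> * (\<Sum>n<N. \<gamma> n) \<le> sum_bound"
    and "\<tau> * coercivity_const * (\<Sum>n<N. expectation (\<Lambda> n)) \<le> sum_bound"
    using sums sn sn' by linarith+
  then have \<Lambda>sum_bound: "\<tau> / 2 * (\<Sum>n<N. expectation (\<Lambda> n)) \<le> sum_bound / (2 * coercivity_const)"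
    using constants by (simp add: field_simps)
  have "(SUP n\<in>{..N}. \<integral>\<^sup>+ \<omega>. ennreal ((Lp_norm D 2 (u n \<omega>))\<^sup>2) \<partial>M) \<le> ennreal sup_bound"
  proof (rule SUP_least)
    fix n assume "n \<in> {..N}"
    then have n: "n \<le> N" by simp
    have "(\<integral>\<^sup>+ \<omega>. ennreal (a n \<omega>) \<partial>M) = ennreal (expectation (a n))"
      by (intro nn_integral_eq_integral aint n AE_I2 nonneg)
    then show "(\<integral>\<^sup>+ \<omega>. ennreal ((Lp_norm D 2 (u n \<omega>))\<^sup>2) \<partial>M) \<le> ennreal sup_bound"
      using aQ[OF n] by (simp add: Lp_norm_2_squared a_def ennreal_leI)
  qed
  moreover have "(\<Sum>n<N. \<integral>\<^sup>+ \<omega>. ennreal ((Lp_norm D 2 (\<lambda>x. u (Suc n) \<omega> x - u n \<omega> x))\<^sup>2) \<partial>M) \<le> ennreal (2 * sum_bound)"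
  proof -
    have "(\<Sum>n<N. \<integral>\<^sup>+ \<omega>. ennreal (d n \<omega>) \<partial>M) = (\<Sum>n<N. ennreal (expectation (d n)))"
      by (intro sum.cong refl nn_integral_eq_integral dint AE_I2 nonneg) auto
    also have "\<dots> = ennreal (\<Sum>n<N. expectation (d n))" using Enn by (simp add: sum_ennreal)
    finally show ?thesis using dS by (simp add: Lp_norm_2_squared d_def ennreal_leI)
  qed
  moreover have "ennreal (T / real N) * (\<Sum>n<N. \<integral>\<^sup>+ \<omega>. ennreal ((Lp_norm D 2 (grad D (u (Suc n) \<omega>)))\<^sup>2) \<partial>M) \<le> ennreal sum_bound"
  proof -
    have "(\<Sum>n<N. \<integral>\<^sup>+ \<omega>. ennreal (g n \<omega>) \<partial>M) \<le> (\<Sum>n<N. ennreal (\<gamma> n))"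
      using \<gamma> by (intro sum_mono) auto
    also have "\<dots> = ennreal (\<Sum>n<N. \<gamma> n)" using \<gamma> by (intro sum_ennreal) auto
    finally have "ennreal \<tau> * (\<Sum>n<N. \<integral>\<^sup>+ \<omega>. ennreal (g n \<omega>) \<partial>M) \<le> ennreal \<tau> * ennreal (\<Sum>n<N. \<gamma> n)"
      by (rule mult_left_mono) simp
    also have "\<dots> = ennreal (\<tau> * (\<Sum>n<N. \<gamma> n))" using \<tau> sn by (simp add: ennreal_mult)
    also have "\<dots> \<le> ennreal sum_bound" using gS by (rule ennreal_leI)
    finally show ?thesis by (simp add: Lp_norm_2_squared g_def \<tau>_def)
  qed
  moreover have "ennreal (T / real N / 2) * (\<Sum>n<N. \<integral>\<^sup>+ \<omega>. ennreal ((Lp_norm D (q + 1) (u (Suc n) \<omega>)) ^ (q + 1)) \<partial>M) \<le> ennreal (sum_bound / (2 * coercivity_const))"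
  proof -
    have "(\<Sum>n<N. \<integral>\<^sup>+ \<omega>. ennreal (\<Lambda> n \<omega>) \<partial>M) = (\<Sum>n<N. ennreal (expectation (\<Lambda> n)))"
      by (intro sum.cong refl nn_integral_eq_integral \<Lambda>int AE_I2 nonneg) auto
    also have "\<dots> = ennreal (\<Sum>n<N. expectation (\<Lambda> n))" using Enn by (simp add: sum_ennreal)
    finally have "ennreal (\<tau> / 2) * (\<Sum>n<N. \<integral>\<^sup>+ \<omega>. ennreal (\<Lambda> n \<omega>) \<partial>M) = ennreal (\<tau> / 2 * (\<Sum>n<N. expectation (\<Lambda> n)))"
      using \<tau> sn by (simp only:) (intro ennreal_mult[symmetric]; simp)
    also have "\<dots> \<le> ennreal (sum_bound / (2 * coercivity_const))" using \<Lambda>sum_bound by (rule ennreal_leI)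
    finally show ?thesis using Lp_norm_power[of "q + 1" D] by (simp add: \<Lambda>_def \<tau>_def)
  qed
  moreover have "0 \<le> sum_bound" using sums sn sn' by linarith
  moreover have "0 \<le> sup_bound" using aQ[of 0] Enn[of 0] by linarith
  moreover from \<open>0 \<le> sum_bound\<close> \<open>0 \<le> sup_bound\<close>
  have "ennreal (sup_bound + 2 * sum_bound + sum_bound + sum_bound / (2 * coercivity_const)) = ennreal sup_bound + ennreal (2 * sum_bound) + ennreal sum_bound + ennreal (sum_bound / (2 * coercivity_const))"
    using constants(2) by (simp only: ennreal_plus add_nonneg_nonneg mult_nonneg_nonneg
        divide_nonneg_nonneg zero_le_numeral less_imp_le)
  ultimately show ?thesis by (simp only: add_mono)
qed

end

theorem theorem4p3:
  fixes L T :: real and q :: nat and u0 :: "real ^ 'd \<Rightarrow> real"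
    and G :: "(real ^ 'd \<Rightarrow> real) \<Rightarrow> real ^ 'd \<Rightarrow> real"
    and DG :: "(real ^ 'd \<Rightarrow> real) \<Rightarrow> (real ^ 'd \<Rightarrow> real) \<Rightarrow> real ^ 'd \<Rightarrow> real"
    and D2G :: "(real ^ 'd \<Rightarrow> real) \<Rightarrow> (real ^ 'd \<Rightarrow> real) \<Rightarrow> (real ^ 'd \<Rightarrow> real) \<Rightarrow> real ^ 'd \<Rightarrow> real"
    and M :: "'w measure" and \<F> :: "real \<Rightarrow> 'w measure" and W :: "real \<Rightarrow> 'w \<Rightarrow> real"
  defines "D \<equiv> cube L"
  assumes "L > 0" and "T > 0"
    and "(CARD('d) = 2 \<and> q \<ge> 3 \<and> odd q) \<or> (CARD('d) = 3 \<and> q \<in> {3, 5})"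
    and "filtered_prob_space M \<F>" and "wiener_process M \<F> W"
    and "noise_coefficient D G DG D2G"
    and "u0 \<in> L2 D"
  shows "\<exists>C>0. \<forall>N \<T> u.
           N \<ge> 1 \<and> mesh_of D \<T> \<and> mesh_condition \<T> \<and> scheme_solution D \<T> q G DG M \<F> W u0 T N u \<longrightarrow>
           (SUP n\<in>{..N}. \<integral>\<^sup>+ \<omega>. ennreal ((Lp_norm D 2 (u n \<omega>))\<^sup>2) \<partial>M)
           + (\<Sum>n<N. \<integral>\<^sup>+ \<omega>. ennreal ((Lp_norm D 2 (\<lambda>x. u (Suc n) \<omega> x - u n \<omega> x))\<^sup>2) \<partial>M)
           + ennreal (T / real N) *
               (\<Sum>n<N. \<integral>\<^sup>+ \<omega>. ennreal ((Lp_norm D 2 (grad D (u (Suc n) \<omega>)))\<^sup>2) \<partial>M)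
           + ennreal (T / real N / 2) *
               (\<Sum>n<N. \<integral>\<^sup>+ \<omega>. ennreal ((Lp_norm D (q + 1) (u (Suc n) \<omega>)) ^ (q + 1)) \<partial>M)
           \<le> ennreal C"
proof -
  obtain C where lip: "L2_lipschitz D C G" "L2_lipschitz D C (\<lambda>v. DG v (G v))"
    using noise_coefficient_lipschitz[of D G DG D2G] assms(7) by (auto simp: noise_coefficient_def)
  interpret milstein_setting D q T G DG M \<F> W u0 C
    by unfold_locales (use assms lip open_cube convex_cube bounded_cube in auto)
  have sup_bound: "0 < sup_bound" by (simp add: sup_bound_def add_nonneg_pos)
  then have "0 \<le> sum_bound" using constants T by (simp add: sum_bound_def)
  then have "0 < sup_bound + 2 * sum_bound + sum_bound + sum_bound / (2 * coercivity_const)"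
    using sup_bound constants by (simp add: add_pos_nonneg)
  then show ?thesis using energy_bound by blast
qed

end
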